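(* Let $n \geq 2$, let $\mathbb{D}\subset\mathbb{C}$ be the open unit disc, let $\Omega_n = \{A \in \mathbb{C}^{n\times n} : \rho(A) < 1\}$ be the spectral ball and $\mathbb{G}_n = (\sigma_1,\dots,\sigma_n)(\mathbb{D}^n)$ the symmetrized polydisc, and let $\pi\colon \Omega_n \to \mathbb{G}_n$ be the map defined below. Let $a_1,\dots,a_m \in \mathbb{D}$ be distinct points, let $A_1,\dots,A_m \in \Omega_n$, and let $f\colon \mathbb{D}\to\mathbb{G}_n$ be holomorphic with $f(a_l) = \pi(A_l)$ for $l = 1,\dots,m$. Then the following are equivalent: (i) there exists a holomorphic map $F\colon \mathbb{D}\to\Omega_n$ with $\pi\circ F = f$ and $F(a_l) = A_l$ for $l=1,\dots,m$; (ii) for each $l$ there exist a neighborhood $U_l$ of $a_l$ and a holomorphic $F_l\colon U_l \to \Omega_n$ with $\pi\circ F_l = f|_{U_l}$ and $F_l(a_l) = A_l$; (iii) for each $l \in \{1,\dots,m\}$ the following condition holds with $p = a_l$ and $M = A_l$: writing $M$ as similar to $B_1\oplus\cdots\oplus B_s$, where $\lambda_1,\dots,\lambda_s$ are the distinct eigenvalues of $M$ and $B_j \in \mathbb{C}^{n_j\times n_j}$ has $\lambda_j$ as its only eigenvalue, one has \[ \left.\frac{d^k}{d\lambda^k}\chi_{f(v)}(\lambda)\right|_{\lambda=\lambda_j} = O\big((v-p)^{d_{n_j-k}(B_j)}\big) \quad \text{as } v\to p,\qquad 0\le k\le n_j-1,\ 1\le j\le s. \]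
   Context: $\rho(A)$ is the spectral radius of $A$ (largest modulus of an eigenvalue). $\sigma_1,\dots,\sigma_n$ are the elementary symmetric polynomials in $n$ variables, and $\pi = (\pi_1,\dots,\pi_n)$ where $\pi_j(A)$ is $\sigma_j$ applied to the eigenvalues of $A$ (with multiplicity); equivalently $\chi_A(\lambda) = \lambda^n + \sum_{j=1}^n (-1)^j \pi_j(A)\lambda^{n-j}$ is the characteristic polynomial of $A$. For a point $x = (x_1,\dots,x_n)\in\mathbb{G}_n$, $\chi_x(\lambda) := \lambda^n + \sum_{j=1}^n(-1)^j x_j \lambda^{n-j}$. For a square matrix $B\in\mathbb{C}^{r\times r}$ and $\ell\in\mathbb{N}$, $d_\ell(B)$ is the minimal $d\in\mathbb{N}$ such that there exist $x_1,\dots,x_d\in\mathbb{C}^r$ with $\dim \operatorname{span}_{\mathbb{C}}\{B^{k_1}x_1,\dots,B^{k_d}x_d : k_1,\dots,k_d\ge 0\} \ge \ell$. *)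

theory Defs
  imports "HOL-Analysis.Analysis" "HOL-Library.Landau_Symbols"
    "Jordan_Normal_Form.Spectral_Radius" "Jordan_Normal_Form.DL_Rank"
begin

text \<open>Points of C^n are represented as functions nat => complex with coordinates
  indexed by 1..n and value 0 outside {1..n}.\<close>

definition cvec_n :: "nat \<Rightarrow> (nat \<Rightarrow> complex) set" where
  "cvec_n n = {x. \<forall>j. j \<notin> {1..n} \<longrightarrow> x j = 0}"

definition esym :: "nat \<Rightarrow> nat \<Rightarrow> (nat \<Rightarrow> complex) \<Rightarrow> complex" where
  "esym n j z = (\<Sum>S\<in>{S. S \<subseteq> {0..<n} \<and> card S = j}. \<Prod>i\<in>S. z i)"

definition symm_polydisc :: "nat \<Rightarrow> (nat \<Rightarrow> complex) set" where
  "symm_polydisc n = {x. \<exists>z. (\<forall>i<n. z i \<in> ball 0 1) \<and>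
      x = (\<lambda>j. if j \<in> {1..n} then esym n j z else 0)}"

definition spectral_ball :: "nat \<Rightarrow> complex mat set" where
  "spectral_ball n = {A. A \<in> carrier_mat n n \<and> spectral_radius A < 1}"

text \<open>The map pi: pi_j(A) is given by chi_A(t) = t^n + sum_j (-1)^j pi_j(A) t^(n-j).\<close>
definition piA :: "nat \<Rightarrow> complex mat \<Rightarrow> (nat \<Rightarrow> complex)" where
  "piA n A = (\<lambda>j. if j \<in> {1..n} then (-1)^j * coeff (char_poly A) (n - j) else 0)"

definition chi_pt :: "nat \<Rightarrow> (nat \<Rightarrow> complex) \<Rightarrow> complex poly" where
  "chi_pt n x = monom 1 n + (\<Sum>j=1..n. monom ((-1)^j * x j) (n - j))"

definition holo_vec :: "nat \<Rightarrow> (complex \<Rightarrow> nat \<Rightarrow> complex) \<Rightarrow> complex set \<Rightarrow> bool" where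
  "holo_vec n f U \<longleftrightarrow> (\<forall>j\<in>{1..n}. (\<lambda>z. f z j) holomorphic_on U)"

definition holo_mat :: "nat \<Rightarrow> (complex \<Rightarrow> complex mat) \<Rightarrow> complex set \<Rightarrow> bool" where
  "holo_mat n F U \<longleftrightarrow> (\<forall>z\<in>U. F z \<in> carrier_mat n n) \<and>
     (\<forall>i<n. \<forall>k<n. (\<lambda>z. F z $$ (i, k)) holomorphic_on U)"

definition d_ell :: "nat \<Rightarrow> complex mat \<Rightarrow> nat \<Rightarrow> nat" where
  "d_ell r B l = (LEAST d. \<exists>xs. length xs = d \<and> set xs \<subseteq> carrier_vec r \<and>
     l \<le> vectorspace.dim class_ring
       ((module_vec TYPE(complex) r)\<lparr>carrier :=
          module.span class_ring (module_vec TYPE(complex) r)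
            {(B ^\<^sub>m k) *\<^sub>v x | k x. x \<in> set xs}\<rparr>))"

definition cond_iii :: "nat \<Rightarrow> (complex \<Rightarrow> nat \<Rightarrow> complex) \<Rightarrow> complex \<Rightarrow> complex mat \<Rightarrow> bool" where
  "cond_iii n f p M \<longleftrightarrow>
    (\<forall>lams Bs ns. length lams = length Bs \<and> length ns = length Bs \<and> distinct lams \<and>
       (\<forall>j<length Bs. Bs ! j \<in> carrier_mat (ns ! j) (ns ! j) \<and> spectrum (Bs ! j) = {lams ! j}) \<and>
       similar_mat M (diag_block_mat Bs) \<longrightarrow>
       (\<forall>j<length Bs. \<forall>k<ns ! j.
          (\<lambda>v. poly ((pderiv ^^ k) (chi_pt n (f v))) (lams ! j))
            \<in> O[at p](\<lambda>v. (v - p) ^ d_ell (ns ! j) (Bs ! j) (ns ! j - k))))"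

end

theory Submission
  imports Defs "HOL-Complex_Analysis.Complex_Analysis"
begin

text \<open>
  Near an interpolation node \<open>p\<close>, condition (iii) says that the coefficient of \<open>(v - p)^t\<close> in
  \<open>\<chi>\<^bsub>f(v)\<^esub>\<close> is divisible by \<open>\<psi>\<^bsub>t+1\<^esub> \<cdots> \<psi>\<^bsub>r\<^esub>\<close>, where \<open>\<psi>\<^sub>1, \<psi>\<^sub>2, \<dots>\<close> are the invariant factors of \<open>M\<close>:
  the \<open>i\<close>-th one collects the \<open>i\<close>-th largest Jordan block of every eigenvalue, and \<open>d\<^sub>\<ell>(B)\<close> is the least
  number of blocks of \<open>B\<close> whose sizes add up to at least \<open>\<ell>\<close>.

  Necessity: conjugate so that \<open>F(p)\<close> is in Jordan form and expand the determinant by Leibniz' formula.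
  The rows of a Jordan block of size \<open>b\<close> contribute a factor in the ideal \<open>(v - p, (\<lambda> - \<lambda>\<^sub>j)^b)\<close>.

  Sufficiency, globally at once: write \<open>\<chi>\<^bsub>f(z)\<^esub>\<close> in the Newton basis whose nodes \<open>\<mu>\<^sub>i(z)\<close> interpolate to high
  order the eigenvalues of all the \<open>A\<^sub>l\<close>, the smallest blocks first. By (iii) the \<open>i\<close>-th Newton coefficient is
  divisible by \<open>\<Prod>\<^sub>l (z - a\<^sub>l)^(e\<^bsub>l,i\<^esub> + 1)\<close>, where \<open>e\<^bsub>l,i\<^esub>\<close> counts the larger blocks of the same eigenvalue.
  Moving the powers \<open>(z - a\<^sub>l)^e\<^bsub>l,i\<^esub>\<close> from the last column of the companion matrix to its subdiagonal
  keeps the characteristic polynomial and turns its value at \<open>a\<^sub>l\<close> into a bidiagonal matrix similar to \<open>A\<^sub>l\<close>.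
  A holomorphic family of invertible matrices with prescribed values at the \<open>a\<^sub>l\<close> conjugates these values to the \<open>A\<^sub>l\<close>.
\<close>

section \<open>Jordan matrices indexed by labels\<close>

text \<open>Liftings constructed near the nodes one by one would still have to be glued. One family
  is therefore written down on the whole disc; the local data enter only through finite jets at
  finitely many points, and these can be prescribed by entire functions. This is done for the scalar
  Newton nodes and, with plain values, for the conjugating matrices.

  Blocks are ordered by their rank within their own eigenvalue, not by size across eigenvalues:
  layer \<open>s\<close> collects the \<open>s\<close>-th block of every eigenvalue. Up to an index
  of layer \<open>s\<close>, each eigenvalue has contributed only blocks of rank at least
  \<open>s\<close>, and this count turns (iii) into the order \<open>s + 1\<close>. Since the rank
  falls to 0 at the last index, the powers telescope along the subdiagonal, and the one surplus
  factor stays in the last column and makes it vanish at every node.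

  Both directions need \<open>d_ell\<close>, defined by spans of orbits, as a count of Jordan
  blocks; the substantial half is the upper bound for such spans. Membership in the spectral ball
  comes for free, because the spectrum is determined by the value of \<open>piA\<close>.\<close>

text \<open>A label \<open>(c, s, k)\<close> names the \<open>k\<close>-th basis vector of the \<open>s\<close>-th Jordan chain for the eigenvalue \<open>c\<close>.
  Working with lists of labels makes every reordering of Jordan blocks a permutation of the list.\<close>

type_synonym label = "complex \<times> nat \<times> nat"

definition nxt :: "label \<Rightarrow> label" where
  "nxt x = (fst x, fst (snd x), Suc (snd (snd x)))"

text \<open>For a distinct list, column \<open>y\<close> expresses that the matrix sends the basis
  vector \<open>y\<close> to \<open>fst y\<close> times \<open>y\<close> plus \<open>nxt y\<close>,
  where \<open>nxt y\<close> counts as zero if it is not in the list.\<close>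

definition jmat :: "label list \<Rightarrow> complex mat" where
  "jmat xs = mat (length xs) (length xs)
     (\<lambda>(i,j). if i = j then fst (xs ! i) else if xs ! i = nxt (xs ! j) then 1 else 0)"

lemma jmat_carrier [simp]: "jmat xs \<in> carrier_mat (length xs) (length xs)"
  by (simp add: jmat_def)

lemma jmat_dim [simp]: "dim_row (jmat xs) = length xs" "dim_col (jmat xs) = length xs"
  by (simp_all add: jmat_def)

lemma jmat_append:
  assumes "\<And>x y. x \<in> set xs \<Longrightarrow> y \<in> set ys \<Longrightarrow> x \<noteq> nxt y \<and> y \<noteq> nxt x"
  shows "jmat (xs @ ys) =
    four_block_mat (jmat xs) (0\<^sub>m (length xs) (length ys)) (0\<^sub>m (length ys) (length xs)) (jmat ys)"
proof (rule eq_matI)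
  fix i j
  assume "i < dim_row (four_block_mat (jmat xs) (0\<^sub>m (length xs) (length ys))
      (0\<^sub>m (length ys) (length xs)) (jmat ys))"
    and "j < dim_col (four_block_mat (jmat xs) (0\<^sub>m (length xs) (length ys))
      (0\<^sub>m (length ys) (length xs)) (jmat ys))"
  then have i: "i < length xs + length ys" and j: "j < length xs + length ys" by auto
  show "jmat (xs @ ys) $$ (i, j) = four_block_mat (jmat xs) (0\<^sub>m (length xs) (length ys))
      (0\<^sub>m (length ys) (length xs)) (jmat ys) $$ (i, j)"
    using i j assms[of "xs ! i" "ys ! (j - length xs)"] assms[of "xs ! j" "ys ! (i - length xs)"]
    by (auto simp: jmat_def nth_append)
qed auto

lemma diag_block_jmat:
  assumes "distinct cs"
    and "\<And>c d x y. c \<in> set cs \<Longrightarrow> d \<in> set cs \<Longrightarrow> c \<noteq> d \<Longrightarrow> x \<in> set (g c) \<Longrightarrow> y \<in> set (g d)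
      \<Longrightarrow> x \<noteq> nxt y"
  shows "diag_block_mat (map (\<lambda>c. jmat (g c)) cs) = jmat (concat (map g cs))"
  using assms
proof (induction cs)
  case Nil
  show ?case by (auto simp: jmat_def)
next
  case (Cons c cs)
  have IH: "diag_block_mat (map (\<lambda>c. jmat (g c)) cs) = jmat (concat (map g cs))"
  proof (rule Cons.IH)
    show "distinct cs" using Cons.prems(1) by simp
    show "x \<noteq> nxt y" if "c \<in> set cs" "d \<in> set cs" "c \<noteq> d" "x \<in> set (g c)" "y \<in> set (g d)"
      for c d x y using Cons.prems(2)[of c d x y] that by simp
  qed
  have "jmat (g c @ concat (map g cs)) = four_block_mat (jmat (g c))
     (0\<^sub>m (length (g c)) (length (concat (map g cs)))) (0\<^sub>m (length (concat (map g cs))) (length (g c)))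
     (jmat (concat (map g cs)))"
  proof (rule jmat_append)
    fix x y
    assume x: "x \<in> set (g c)" and y: "y \<in> set (concat (map g cs))"
    from y obtain d where d: "d \<in> set cs" "y \<in> set (g d)" by auto
    with Cons.prems(1) have "c \<noteq> d" by auto
    with Cons.prems(2)[of c d x y] Cons.prems(2)[of d c y x] x d
    show "x \<noteq> nxt y \<and> y \<noteq> nxt x" by auto
  qed
  then show ?case by (simp add: IH Let_def)
qed

text \<open>Entries depend only on the two labels and not on their positions, so reordering the list
  is conjugation by a permutation matrix, with its transpose as inverse.\<close>

lemma similar_jmat_mset:
  assumes "mset xs = mset ys"
  shows "similar_mat (jmat xs) (jmat ys)"
proof -
  from assms obtain p where p: "p permutes {..<length ys}" and xs: "permute_list p ys = xs"
    by (rule mset_eq_permutation)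
  define n where "n = length ys"
  have len: "length xs = n" using xs by (auto simp: n_def)
  have xsi: "xs ! i = ys ! (p i)" if "i < n" for i
    using that p xs permute_list_nth[OF p, of i] by (auto simp: n_def)
  have pn: "p i < n" if "i < n" for i
    using permutes_in_image[OF p, of i] that by (auto simp: n_def)
  have inj: "p i = p j \<longleftrightarrow> i = j" for i j
    using permutes_inj[OF p] by (auto simp: inj_def)
  define P where "P = mat n n (\<lambda>(i,j). if p i = j then 1 else 0 :: complex)"
  define Q where "Q = mat n n (\<lambda>(i,j). if p j = i then 1 else 0 :: complex)"
  have P_mult: "(P * X) $$ (i,j) = X $$ (p i, j)" if "X \<in> carrier_mat n n" "i < n" "j < n" for X i j
  proof -
    have "(P * X) $$ (i,j) = (\<Sum>k<n. P $$ (i,k) * X $$ (k,j))"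
      using that by (simp add: P_def scalar_prod_def atLeast0LessThan)
    also have "\<dots> = (\<Sum>k<n. (if p i = k then X $$ (k,j) else 0))"
      using that by (intro sum.cong) (auto simp: P_def)
    also have "\<dots> = X $$ (p i, j)" using that pn[of i] by simp
    finally show ?thesis .
  qed
  have PQ: "P * Q = 1\<^sub>m n"
  proof (rule eq_matI)
    fix i j assume "i < dim_row (1\<^sub>m n)" "j < dim_col (1\<^sub>m n)"
    then have ij: "i < n" "j < n" by auto
    have "(P * Q) $$ (i,j) = Q $$ (p i, j)" by (rule P_mult) (use ij in \<open>auto simp: Q_def\<close>)
    then show "(P * Q) $$ (i,j) = 1\<^sub>m n $$ (i,j)" using ij pn by (auto simp: Q_def inj)
  qed (auto simp: P_def Q_def)
  have QP: "Q * P = 1\<^sub>m n"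
    using PQ mat_mult_left_right_inverse[of P n Q] by (auto simp: P_def Q_def)
  have PJ: "(P * jmat ys) $$ (i,j) = jmat ys $$ (p i, j)" if "i < n" "j < n" for i j
    by (rule P_mult) (use that in \<open>auto simp: n_def\<close>)
  have J: "jmat xs = P * jmat ys * Q"
  proof (rule eq_matI)
    fix i j assume "i < dim_row (P * jmat ys * Q)" "j < dim_col (P * jmat ys * Q)"
    then have ij: "i < n" "j < n" by (auto simp: P_def Q_def)
    have "(P * jmat ys * Q) $$ (i,j) = (\<Sum>k<n. (P * jmat ys) $$ (i,k) * (if p j = k then 1 else 0))"
      using ij by (auto simp: Q_def P_def scalar_prod_def n_def atLeast0LessThan)
    also have "\<dots> = (\<Sum>k<n. (if p j = k then (P * jmat ys) $$ (i,k) else 0))"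
      by (rule sum.cong) auto
    also have "\<dots> = (P * jmat ys) $$ (i, p j)"
      using ij pn by (simp add: sum.delta)
    also have "\<dots> = jmat ys $$ (p i, p j)" using ij pn PJ by auto
    also have "\<dots> = jmat xs $$ (i,j)" using ij pn by (auto simp: jmat_def len n_def[symmetric] xsi inj)
    finally show "jmat xs $$ (i,j) = (P * jmat ys * Q) $$ (i,j)" by simp
  qed (auto simp: P_def Q_def len)
  show ?thesis
    by (rule similar_matI[OF _ PQ QP J]) (auto simp: P_def Q_def len n_def jmat_def)
qed

text \<open>The ones of \<open>jordan_block\<close> lie above the diagonal, whereas
  \<open>nxt\<close> puts a one in the row of the later label. Listing the chain backwards
  reconciles the two.\<close>

lemma jordan_block_jmat: "jordan_block b c = jmat (map (\<lambda>k. (c, s, k)) (rev [0..<b]))"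
  by (rule eq_matI) (auto simp: jmat_def nxt_def rev_nth)

text \<open>Injectivity of the chain names \<open>h\<close> prevents \<open>nxt\<close> from linking
  labels of different blocks, even when these share an eigenvalue.\<close>

lemma jordan_matrix_jmat:
  assumes "inj_on h {..<length n_as}"
  shows "jordan_matrix n_as = jmat (concat (map
     (\<lambda>i. map (\<lambda>k. (snd (n_as ! i), h i, k)) (rev [0..<fst (n_as ! i)])) [0..<length n_as]))"
proof -
  have "map (\<lambda>(n, a). jordan_block n a) n_as = map (\<lambda>i. jmat (map (\<lambda>k. (snd (n_as ! i), h i, k))
     (rev [0..<fst (n_as ! i)]))) [0..<length n_as]"
  proof (rule nth_equalityI)
    fix i assume "i < length (map (\<lambda>(n, a). jordan_block n a) n_as)"
    then show "map (\<lambda>(n, a). jordan_block n a) n_as ! i = map (\<lambda>i. jmat (map (\<lambda>k. (snd (n_as ! i), h i, k))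
     (rev [0..<fst (n_as ! i)]))) [0..<length n_as] ! i"
      using jordan_block_jmat[of "fst (n_as ! i)" "snd (n_as ! i)" "h i"] by (simp add: case_prod_beta)
  qed simp
  then show ?thesis unfolding jordan_matrix_def
    by (simp only:) (rule diag_block_jmat, use assms in \<open>auto simp: nxt_def inj_on_def\<close>)
qed

lemma jordan_nf_complex_exists:
  assumes "(A :: complex mat) \<in> carrier_mat n n"
  obtains n_as where "jordan_nf A n_as"
  using char_poly_factorized[OF assms] jordan_nf_exists[OF assms] by blast

lemma jordan_nf_eigenvalue:
  assumes "(B :: complex mat) \<in> carrier_mat r r" "jordan_nf B n_as" "x \<in> set n_as"
  shows "snd x \<in> spectrum B"
proof -
  have "char_poly B = (\<Prod>(n, a)\<leftarrow>n_as. [:- a, 1:] ^ n)"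
    using jordan_nf_char_poly[OF assms(2)] .
  moreover have "[:- snd x, 1:] ^ fst x dvd (\<Prod>(n, a)\<leftarrow>n_as. [:- a, 1:] ^ n)"
    using assms(3) by (intro prod_list_dvd) (force simp: case_prod_beta)
  moreover have "fst x \<noteq> 0" using assms(2,3) by (force simp: jordan_nf_def)
  ultimately have "poly (char_poly B) (snd x) = 0"
    by (metis dvd_power_same dvd_trans dvd_power gr0I poly_eq_0_iff_dvd)
  then show ?thesis by (simp add: spectrum_root_char_poly[OF assms(1)])
qed

text \<open>The chains for \<open>c\<close> are numbered by decreasing length, and \<open>b s\<close> is the length of the \<open>s\<close>-th one
  (\<open>0\<close> if there is none).\<close>

definition layers :: "complex \<Rightarrow> (nat \<Rightarrow> nat) \<Rightarrow> label set" where
  "layers c b = {(c, s, k) | s k. k < b s}"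

lemma jordan_layers:
  assumes B: "B \<in> carrier_mat r r" and spec: "spectrum B \<subseteq> {c}"
  obtains b N where "antimono b" "\<And>s. s \<ge> N \<Longrightarrow> b s = 0"
    "\<And>xs. distinct xs \<Longrightarrow> set xs = layers c b \<Longrightarrow> similar_mat B (jmat xs)"
proof -
  obtain n_as where jnf: "jordan_nf B n_as" using jordan_nf_complex_exists[OF B] .
  have sc: "snd (n_as ! i) = c" if "i < length n_as" for i
    using jordan_nf_eigenvalue[OF B jnf, of "n_as ! i"] that spec by auto
  define bs where "bs = rev (sort (map fst n_as))"
  have "mset (map fst n_as) = mset bs" by (simp add: bs_def)
  then obtain p where p: "p permutes {..<length bs}" and pl: "permute_list p bs = map fst n_as"
    by (rule mset_eq_permutation)
  have len: "length bs = length n_as" by (simp add: bs_def)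
  define b where "b s = (if s < length bs then bs ! s else 0)" for s
  have bp: "fst (n_as ! i) = b (p i)" if "i < length n_as" for i
  proof -
    have "map fst n_as ! i = bs ! p i"
      using that p permute_list_nth[OF p, of i] by (auto simp: pl[symmetric] len)
    moreover have "p i < length bs" using permutes_in_image[OF p, of i] that len by auto
    ultimately show ?thesis using that by (auto simp: b_def)
  qed
  \<comment> \<open>\<open>p i\<close> is the rank of block \<open>i\<close> when the sizes are
    sorted decreasingly; it serves as the number of the chain.\<close>
  define ys where "ys = concat (map (\<lambda>i. map (\<lambda>k. (snd (n_as ! i), p i, k))
     (rev [0..<fst (n_as ! i)])) [0..<length n_as])"
  have inj: "inj_on p {..<length n_as}" using permutes_inj[OF p] by (auto simp: inj_on_def inj_def)
  have J: "jordan_matrix n_as = jmat ys"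
    unfolding ys_def by (rule jordan_matrix_jmat[OF inj])
  have anti: "antimono b"
  proof (rule antimonoI)
    fix x y :: nat assume "x \<le> y"
    then show "b y \<le> b x"
      using sorted_rev_nth_mono[of bs x y] by (auto simp: b_def bs_def)
  qed
  have set_ys: "set ys = layers c b"
  proof -
    have "set ys = (\<Union>i\<in>{..<length n_as}. (\<lambda>k. (snd (n_as ! i), p i, k)) ` {..<fst (n_as ! i)})"
      by (simp add: ys_def atLeast0LessThan)
    also have "\<dots> = (\<Union>i\<in>{..<length n_as}. (\<lambda>k. (c, p i, k)) ` {..<b (p i)})"
      by (intro SUP_cong refl) (simp add: sc bp)
    also have "\<dots> = (\<Union>s\<in>p ` {..<length n_as}. {(c, s, k) | k. k < b s})" by auto
    also have "p ` {..<length n_as} = {..<length n_as}" using permutes_image[OF p] len by simp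
    also have "(\<Union>s\<in>{..<length n_as}. {(c, s, k) | k. k < b s}) = layers c b"
      by (auto simp: layers_def b_def len split: if_splits)
    finally show ?thesis .
  qed
  have dist: "distinct ys"
  proof -
    have "distinct (concat (map (\<lambda>i. map (\<lambda>k. (snd (n_as ! i), p i, k)) 
      (rev [0..<fst (n_as ! i)])) xs))" if "distinct xs" "set xs \<subseteq> {..<length n_as}" for xs
      using that
    proof (induction xs)
      case (Cons i xs)
      then show ?case using inj by (auto simp: distinct_map inj_on_def)
    qed auto
    from this[of "[0..<length n_as]"] show ?thesis unfolding ys_def by (metis atLeast0LessThan distinct_upt order_refl set_upt)
  qed
  show ?thesis
  proof (rule that[OF anti])
    show "b s = 0" if "s \<ge> length bs" for s using that by (simp add: b_def)
    fix xs assume "distinct xs" "set xs = layers c b"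
    then have "mset ys = mset xs" using dist set_ys by (metis set_eq_iff_mset_eq_distinct)
    then show "similar_mat B (jmat xs)" using jnf similar_jmat_mset similar_mat_trans
      unfolding jordan_nf_def J by blast
  qed
qed

lemma layers_eq_image:
  assumes "\<And>s. s \<ge> N \<Longrightarrow> b s = 0"
  shows "layers c b = (\<lambda>(s,k). (c,s,k)) ` (SIGMA s:{..<N}. {..<b s})"
proof -
  have *: "s < N" if "k < b s" for s k using that assms[of s] by (cases "s < N") auto
  show ?thesis
  proof (intro equalityI subsetI)
    fix x assume "x \<in> layers c b"
    then obtain s k where x: "x = (c,s,k)" "k < b s" by (auto simp: layers_def)
    then show "x \<in> (\<lambda>(s,k). (c,s,k)) ` (SIGMA s:{..<N}. {..<b s})"
      using *[of k s] by (intro image_eqI[of _ _ "(s,k)"]) auto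
  qed (auto simp: layers_def)
qed

lemma finite_layers: "(\<And>s. s \<ge> N \<Longrightarrow> b s = 0) \<Longrightarrow> finite (layers c b)"
  by (subst layers_eq_image[of N]) auto

lemma card_layers: 
  assumes "\<And>s. s \<ge> N \<Longrightarrow> b s = 0"
  shows "card (layers c b) = sum b {..<N}"
proof -
  have "inj_on (\<lambda>(s,k). (c,s,k)) (SIGMA s:{..<N}. {..<b s})" by (auto simp: inj_on_def)
  with layers_eq_image[of N b c, OF assms] show ?thesis by (simp add: card_image)
qed

section \<open>Decompositions into blocks with a single eigenvalue\<close>

definition block_decomp :: "complex mat \<Rightarrow> complex list \<Rightarrow> complex mat list \<Rightarrow> nat list \<Rightarrow> bool" where
  "block_decomp M lams Bs ns \<longleftrightarrow>
    length lams = length Bs \<and> length ns = length Bs \<and> distinct lams \<and>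
    (\<forall>j<length Bs. Bs ! j \<in> carrier_mat (ns ! j) (ns ! j) \<and> spectrum (Bs ! j) = {lams ! j}) \<and>
    similar_mat M (diag_block_mat Bs)"

lemma upper_triangular_char_poly_const_diag:
  assumes "B \<in> carrier_mat r r" "upper_triangular B" "\<And>i. i < r \<Longrightarrow> B $$ (i,i) = (c :: complex)"
  shows "char_poly B = [:-c, 1:] ^ r"
proof -
  have "map (\<lambda>a. [:- a, 1:]) (diag_mat B) = replicate r [:-c, 1:]"
    using assms by (intro nth_equalityI) (auto simp: diag_mat_def)
  then show ?thesis using char_poly_upper_triangular[OF assms(1,2)] by simp
qed

text \<open>\<open>cond_iii\<close> speaks about all decompositions and can be exploited only once
  some decomposition is at hand. Here it arises by grouping the labels of a Jordan form according to
  the eigenvalue.\<close>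

lemma block_decomp_exists:
  assumes M: "M \<in> carrier_mat n n"
  obtains lams Bs ns where "block_decomp M lams Bs ns"
proof -
  obtain n_as where jnf: "jordan_nf M n_as" using jordan_nf_complex_exists[OF M] .
  define ys where "ys = concat (map (\<lambda>i. map (\<lambda>k. (snd (n_as ! i), i, k))
     (rev [0..<fst (n_as ! i)])) [0..<length n_as])"
  have J: "jordan_matrix n_as = jmat ys"
    unfolding ys_def by (rule jordan_matrix_jmat) auto
  have sim: "similar_mat M (jmat ys)" using jnf by (simp add: jordan_nf_def J)
  define lams where "lams = remdups (map fst ys)"
  define g where "g c = filter (\<lambda>x. fst x = c) ys" for c
  define Bs where "Bs = map (\<lambda>c. jmat (g c)) lams"
  define ns where "ns = map (\<lambda>c. length (g c)) lams"
  have "diag_block_mat Bs = jmat (concat (map g lams))"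
    unfolding Bs_def by (rule diag_block_jmat) (auto simp: lams_def g_def nxt_def)
  moreover have "mset ys = mset (concat (map g lams))"
  proof -
    have "mset (concat (map g cs)) = filter_mset (\<lambda>x. fst x \<in> set cs) (mset ys)" if "distinct cs" for cs
      using that
    proof (induction cs)
      case (Cons c cs)
      have "filter_mset (\<lambda>x. fst x \<in> set (c # cs)) (mset ys) =
        filter_mset (\<lambda>x. fst x = c) (mset ys) + filter_mset (\<lambda>x. fst x \<in> set cs) (mset ys)"
        using Cons.prems by (intro multiset_eqI) auto
      then show ?case using Cons by (simp add: g_def)
    qed auto
    from this[of lams] have "mset (concat (map g lams)) = mset (filter (\<lambda>x. fst x \<in> set lams) ys)"
      by (simp only: lams_def distinct_remdups mset_filter)
    also have "filter (\<lambda>x. fst x \<in> set lams) ys = ys" by (rule filter_True) (auto simp: lams_def)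
    finally show ?thesis by simp
  qed
  ultimately have sim2: "similar_mat M (diag_block_mat Bs)"
    using sim similar_jmat_mset similar_mat_trans by metis
  \<comment> \<open>Chains are listed from their end, so a successor always stands before its
    predecessor. Sublists inherit this, and their matrices are upper triangular.\<close>
  have sorted: "sorted_wrt (\<lambda>x y. y \<noteq> nxt x) ys"
  proof -
    have "sorted_wrt (\<lambda>x y. y \<noteq> nxt x) (concat (map (\<lambda>i. map (\<lambda>k. (snd (n_as ! i), i, k))
       (rev [0..<fst (n_as ! i)])) is))" if "distinct is" for "is"
      using that
    proof (induction "is")
      case (Cons i "is")
      have "sorted_wrt (\<lambda>x y. y \<noteq> nxt x) (map (\<lambda>k. (snd (n_as ! i), i, k)) (rev [0..<fst (n_as ! i)]))"
        by (auto simp: sorted_wrt_iff_nth_less nxt_def rev_nth)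
      then show ?case using Cons by (auto simp: sorted_wrt_append nxt_def)
    qed auto
    then show ?thesis by (simp add: ys_def)
  qed
  have spec: "spectrum (jmat (g c)) = {c}" if c: "c \<in> set lams" for c
  proof -
    have "upper_triangular (jmat (g c))"
    proof -
      have "sorted_wrt (\<lambda>x y. y \<noteq> nxt x) (g c)" unfolding g_def by (rule sorted_wrt_filter[OF sorted])
      then show ?thesis by (auto simp: upper_triangular_def jmat_def sorted_wrt_iff_nth_less)
    qed
    then have "char_poly (jmat (g c)) = [:-c, 1:] ^ length (g c)"
    proof (rule upper_triangular_char_poly_const_diag[rotated])
      fix i assume "i < length (g c)"
      moreover from this have "g c ! i \<in> set (g c)" by simp
      ultimately show "jmat (g c) $$ (i,i) = c" by (auto simp: jmat_def g_def)
    qed simp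
    moreover have "length (g c) > 0" using c by (auto simp: lams_def g_def filter_empty_conv)
    ultimately show ?thesis by (auto simp: spectrum_root_char_poly[OF jmat_carrier])
  qed
  have "block_decomp M lams Bs ns"
    unfolding block_decomp_def using sim2 spec
    by (auto simp: Bs_def ns_def) (simp add: lams_def)
  then show ?thesis by (rule that)
qed

section \<open>Subspaces generated by orbits of a nilpotent matrix\<close>

text \<open>Read \<open>u (s, _)\<close> as the coefficients of a power series in \<open>t\<close>,
  one for each block. Then \<open>shf k\<close> is multiplication by \<open>t^k\<close> on the
  direct sum, before truncation to C[t]/(t^(b s)).\<close>

definition shf :: "nat \<Rightarrow> (nat \<times> nat \<Rightarrow> complex) \<Rightarrow> nat \<times> nat \<Rightarrow> complex" where
  "shf k u = (\<lambda>(s,i). if k \<le> i then u (s, i - k) else 0)"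

text \<open>These sets are the preimages of the subspaces of the truncated module: coordinates
  beyond the block sizes are ignored by putting every vector supported there into \<open>U\<close>,
  so that vectors never have to be cut off.\<close>

definition fsub :: "(nat \<Rightarrow> nat) \<Rightarrow> (nat \<times> nat \<Rightarrow> complex) set \<Rightarrow> bool" where
  "fsub b U \<longleftrightarrow> (\<forall>u. (\<forall>s k. k < b s \<longrightarrow> u (s,k) = 0) \<longrightarrow> u \<in> U) \<and>
     (\<forall>u\<in>U. \<forall>w\<in>U. \<forall>a. (\<lambda>x. u x + a * w x) \<in> U)"

lemma fsub_null: "fsub b U \<Longrightarrow> (\<And>s k. k < b s \<Longrightarrow> u (s,k) = 0) \<Longrightarrow> u \<in> U"
  by (auto simp: fsub_def)

lemma fsub_lin: "fsub b U \<Longrightarrow> u \<in> U \<Longrightarrow> w \<in> U \<Longrightarrow> (\<lambda>x. u x + a * w x) \<in> U"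
  by (auto simp: fsub_def)

lemma fsub_sum:
  assumes "fsub b U" "u \<in> U" "\<And>j. j < (m::nat) \<Longrightarrow> w j \<in> U"
  shows "(\<lambda>x. u x + (\<Sum>j<m. a j * w j x)) \<in> U"
  using assms(3)
proof (induction m)
  case 0
  show ?case using assms(2) by simp
next
  case (Suc m)
  have "(\<lambda>x. (u x + (\<Sum>j<m. a j * w j x)) + a m * w m x) \<in> U"
    using Suc assms by (intro fsub_lin[of b]) auto
  then show ?case by (simp add: add.assoc)
qed

text \<open>Power series over a field form a valuation ring, so an element of least order divides
  the others; if all vanish, any element will do.\<close>

lemma fps_min_dvd:
  fixes F :: "'b \<Rightarrow> complex fps"
  assumes "finite X" "X \<noteq> {}"
  obtains v where "v \<in> X" "\<And>u. u \<in> X \<Longrightarrow> F v dvd F u"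
proof (cases "\<exists>u\<in>X. F u \<noteq> 0")
  case False
  with assms show ?thesis using that by auto
next
  case True
  define Y where "Y = {u\<in>X. F u \<noteq> 0}"
  have "finite Y" "Y \<noteq> {}" using assms True by (auto simp: Y_def)
  then obtain v where v: "v \<in> Y" "\<And>u. u \<in> Y \<Longrightarrow> subdegree (F v) \<le> subdegree (F u)"
    using ex_min_if_finite[of "(\<lambda>u. subdegree (F u)) ` Y"] by (auto simp: not_less)
  have "F v dvd F u" if "u \<in> X" for u
    using that v by (cases "F u = 0") (auto simp: Y_def fps_dvd_iff)
  with v show ?thesis by (intro that[of v]) (auto simp: Y_def)
qed

text \<open>Gaussian elimination over the local ring of power series: the vector whose component in the
  largest remaining block has least order clears that component from all the others.\<close>

lemma shift_orbits_small:
  assumes anti: "antimono b"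
    and "\<And>u s k. u \<in> set us \<Longrightarrow> s < m \<Longrightarrow> k < b s \<Longrightarrow> u (s,k) = 0"
  shows "\<exists>G. length G \<le> sum b {m..<m + length us} \<and>
    (\<forall>U. fsub b U \<longrightarrow> set G \<subseteq> U \<longrightarrow> (\<forall>u\<in>set us. \<forall>k. shf k u \<in> U))"
  using assms(2)
proof (induction "length us" arbitrary: us m)
  case 0
  then show ?case by auto
next
  case (Suc t)
  define blk where "blk u = Abs_fps (\<lambda>k. if k < b m then u (m,k) else 0)" for u :: "nat \<times> nat \<Rightarrow> complex"
  from Suc.hyps(2) have "set us \<noteq> {}" by auto
  then obtain v where v: "v \<in> set us" and dvd: "\<And>u. u \<in> set us \<Longrightarrow> blk v dvd blk u"
    using fps_min_dvd[of "set us" blk] by auto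
  define h where "h u = (SOME g. blk u = blk v * g)" for u
  have h: "blk u = blk v * h u" if "u \<in> set us" for u
    using someI_ex[of "\<lambda>g. blk u = blk v * g"] dvd[OF that] unfolding h_def dvd_def by blast
  \<comment> \<open>Subtracts \<open>h u\<close> times \<open>v\<close>. Terms of the series
    \<open>h u\<close> from \<open>t^(b m)\<close> on do not affect the coordinates of block
    \<open>m\<close> below \<open>b m\<close>, so a finite sum suffices to clear that block.\<close>
  define red where "red u = (\<lambda>x. u x - (\<Sum>j<b m. fps_nth (h u) j * shf j v x))" for u
  define us' where "us' = map red (remove1 v us)"
  have len: "t = length us'" using Suc.hyps(2) v by (simp add: us'_def length_remove1)
  have "\<exists>G. length G \<le> sum b {Suc m..<Suc m + length us'} \<and>
    (\<forall>U. fsub b U \<longrightarrow> set G \<subseteq> U \<longrightarrow> (\<forall>u\<in>set us'. \<forall>k. shf k u \<in> U))"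
  proof (rule Suc.hyps(1)[OF len])
    fix u' s k
    assume u': "u' \<in> set us'" and s: "s < Suc m" and k: "k < b s"
    from u' obtain u where u: "u \<in> set us" and u'_eq: "u' = red u"
      by (auto simp: us'_def dest: notin_set_remove1 set_remove1_subset[THEN subsetD])
    show "u' (s,k) = 0"
    proof (cases "s < m")
      case True
      have "shf j v (s,k) = 0" for j using Suc.prems[OF v True, of "k - j"] k by (auto simp: shf_def)
      moreover have "u (s,k) = 0" using Suc.prems[OF u True k] .
      ultimately show ?thesis by (simp add: u'_eq red_def)
    next
      case False
      with s have s: "s = m" by simp
      have "u (m,k) = fps_nth (blk u) k" using k s by (simp add: blk_def)
      also have "\<dots> = (\<Sum>j=0..k. fps_nth (blk v) j * fps_nth (h u) (k - j))"
        using h[OF u] by (simp add: fps_mult_nth)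
      also have "\<dots> = (\<Sum>j=0..k. fps_nth (blk v) (k - j) * fps_nth (h u) j)"
        by (rule sum.reindex_bij_witness[of _ "\<lambda>j. k - j" "\<lambda>j. k - j"]) auto
      also have "\<dots> = (\<Sum>j=0..k. fps_nth (h u) j * shf j v (m,k))"
        using k s by (intro sum.cong) (auto simp: blk_def shf_def)
      also have "\<dots> = (\<Sum>j<b m. fps_nth (h u) j * shf j v (m,k))"
        using k s by (intro sum.mono_neutral_left) (auto simp: shf_def)
      finally show ?thesis by (simp add: u'_eq red_def s)
    qed
  qed
  then obtain G' where G': "length G' \<le> sum b {Suc m..<Suc m + length us'}"
    "\<forall>U. fsub b U \<longrightarrow> set G' \<subseteq> U \<longrightarrow> (\<forall>u\<in>set us'. \<forall>k. shf k u \<in> U)"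
    by (elim exE conjE)
  \<comment> \<open>Only \<open>b m\<close> shifts of \<open>v\<close> are needed: \<open>v\<close>
    vanishes on the blocks before \<open>m\<close>, and all others have size at most
    \<open>b m\<close>, so the higher shifts are null.\<close>
  define G where "G = map (\<lambda>k. shf k v) [0..<b m] @ G'"
  have "length G \<le> sum b {m..<m + length us}"
  proof -
    have "sum b {m..<m + length us} = b m + sum b {Suc m..<Suc m + length us'}"
    proof -
      have "m + length us = Suc m + length us'" using Suc.hyps(2) len by simp
      then show ?thesis by (simp only:) (subst sum.atLeast_Suc_lessThan, simp_all)
    qed
    then show ?thesis using G'(1) by (simp add: G_def)
  qed
  moreover have "shf k u \<in> U" if U: "fsub b U" "set G \<subseteq> U" and u: "u \<in> set us" for U u k
  proof -
    have vk: "shf k v \<in> U" for k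
    proof (cases "k < b m")
      case True
      then show ?thesis using U by (auto simp: G_def)
    next
      case False
      show ?thesis
      proof (rule fsub_null[OF U(1)])
        fix s i assume i: "i < b s"
        show "shf k v (s,i) = 0"
        proof (cases "s < m")
          case True
          then show ?thesis using Suc.prems[OF v True, of "i - k"] i by (auto simp: shf_def)
        next
          case s: False
          have "b s \<le> b m" using s by (intro antimonoD[OF anti]) simp
          then show ?thesis using False i by (auto simp: shf_def)
        qed
      qed
    qed
    show ?thesis
    proof (cases "u = v")
      case True
      then show ?thesis using vk by simp
    next
      case False
      then have "red u \<in> set us'" using u by (simp add: us'_def)
      then have "shf k (red u) \<in> U" using G'(2)[rule_format, OF U(1)] U(2) by (auto simp: G_def)
      then have "(\<lambda>x. shf k (red u) x + (\<Sum>j<b m. fps_nth (h u) j * shf (k + j) v x)) \<in> U"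
        by (rule fsub_sum[OF U(1)]) (rule vk)
      moreover have "(\<lambda>x. shf k (red u) x + (\<Sum>j<b m. fps_nth (h u) j * shf (k + j) v x)) = shf k u"
      proof
        fix x :: "nat \<times> nat"
        obtain s i where x: "x = (s,i)" by (cases x)
        show "shf k (red u) x + (\<Sum>j<b m. fps_nth (h u) j * shf (k + j) v x) = shf k u x"
          by (auto simp: x red_def shf_def add.commute intro!: sum.cong sum.neutral)
      qed
      ultimately show ?thesis by simp
    qed
  qed
  ultimately show ?case by blast
qed

section \<open>Dimensions of spans of possibly infinite sets of vectors\<close>

context vec_space
begin

lemma vectorspace_span:
  assumes "S \<subseteq> carrier_vec n"
  shows "vectorspace class_ring (span_vs S)"
  using assms span_is_subspace subspace_is_vs by simp

text \<open>Independent subsets have at most \<open>n\<close> elements, and one of maximal size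
  already spans. This gives finite generators for the orbit sets in \<open>d_ell\<close>, which are
  indexed by all powers of the matrix.\<close>

lemma finite_spanning_subset:
  assumes S: "S \<subseteq> carrier_vec n"
  obtains T where "finite T" "T \<subseteq> S" "span T = span S"
proof -
  define X where "X = {card T | T. T \<subseteq> S \<and> lin_indpt T}"
  have bound: "finite T \<and> card T \<le> n" if "T \<subseteq> S" "lin_indpt T" for T
    using li_le_dim[of T] that S dim_is_n by auto
  have X: "finite X" by (rule finite_subset[of _ "{..n}"]) (use bound in \<open>auto simp: X_def\<close>)
  have "lin_indpt {}" by (simp add: lin_dep_def)
  then have "X \<noteq> {}" by (auto simp: X_def)
  then have "Max X \<in> X" using X by (rule Max_in[rotated])
  then obtain T where T: "T \<subseteq> S" "lin_indpt T" "card T = Max X" by (auto simp: X_def)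
  have finT: "finite T" using bound T by blast
  have TV: "T \<subseteq> carrier_vec n" using T S by blast
  have "S \<subseteq> span T"
  proof
    fix s assume s: "s \<in> S"
    show "s \<in> span T"
    proof (rule ccontr)
      assume ns: "s \<notin> span T"
      then have "s \<notin> T" using in_own_span[of T] TV by auto
      moreover have "lin_indpt (T \<union> {s})"
        using lin_dep_iff_in_span[of T s] T TV s S ns \<open>s \<notin> T\<close> by auto
      then have "card (T \<union> {s}) \<in> X" using T s by (auto simp: X_def)
      then have "card (T \<union> {s}) \<le> Max X" using X by simp
      ultimately show False using T(3) finT by simp
    qed
  qed
  then have "span S \<subseteq> span T" using span_is_submodule[of T] TV by (intro span_is_subset) auto
  then show ?thesis using that[OF finT T(1)] span_is_monotone[OF T(1)] by auto
qed

lemma dim_span_le_card: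
  assumes S: "S \<subseteq> carrier_vec n" and G: "G \<subseteq> carrier_vec n" "finite G" and SG: "S \<subseteq> span G"
  shows "vectorspace.dim class_ring (span_vs S) \<le> card G"
proof -
  have sub: "span S \<subseteq> span G" using SG span_is_submodule[of G] G(1) by (intro span_is_subset) auto
  interpret WG: vectorspace class_ring "span_vs G" by (rule vectorspace_span[OF G(1)])
  have subS: "subspace class_ring (span S) V" and subG: "subspace class_ring (span G) V"
    using span_is_subspace S G(1) by auto
  have nest: "subspace class_ring (span S) (vs (span G))"
    by (rule nested_subspaces[OF subG subS sub])
  have GG: "G \<subseteq> span G" using in_own_span G by simp
  have gen: "WG.span G = carrier (span_vs G)"
    using span_li_not_depend(1)[OF GG] span_is_submodule[of G] G(1) by simp
  have dG: "WG.dim \<le> card G"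
    using WG.gen_ge_dim[OF G(2) _ gen] GG by simp
  have fdG: "WG.fin_dim" using fin_dim_span[OF G(2)] G(1) by simp
  have fdS: "vectorspace.fin_dim class_ring (vs (span S))"
  proof -
    obtain T where T: "finite T" "T \<subseteq> S" "span T = span S" using finite_spanning_subset[OF S] by blast
    then show ?thesis using fin_dim_span[of T] S by auto
  qed
  have "vectorspace.dim class_ring ((vs (span G))\<lparr>carrier := span S\<rparr>) \<le> WG.dim"
    by (rule WG.subspace_dim[OF nest fdG]) (use fdS in simp)
  then show ?thesis using dG by simp
qed

lemma lin_indpt_le_dim_span:
  assumes "S \<subseteq> carrier_vec n" "G \<subseteq> span S" "lin_indpt G"
  shows "card G \<le> vectorspace.dim class_ring (span_vs S)"
proof -
  obtain T where T: "finite T" "T \<subseteq> S" "span T = span S" using finite_spanning_subset[OF assms(1)] by blast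
  interpret W: vectorspace class_ring "span_vs S" by (rule vectorspace_span[OF assms(1)])
  have fd: "W.fin_dim" using fin_dim_span[of T] T assms(1) by auto
  have "W.lin_indpt G"
    using span_li_not_depend(2)[OF assms(2)] span_is_submodule[of S] assms by simp
  then show ?thesis using W.li_le_dim(2)[OF fd] assms(2) by simp
qed

end

section \<open>The number \<open>d_ell\<close> in terms of Jordan block sizes\<close>

locale jordan_coords =
  fixes B :: "complex mat" and r :: nat and c :: complex and b :: "nat \<Rightarrow> nat" and N :: nat
    and xs :: "label list" and P Q :: "complex mat"
  assumes B: "B \<in> carrier_mat r r" and anti: "antimono b" and bN: "\<And>s. s \<ge> N \<Longrightarrow> b s = 0"
    and dist: "distinct xs" and set_xs: "set xs = layers c b"
    and wit: "similar_mat_wit B (jmat xs) P Q"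
begin

lemma P: "P \<in> carrier_mat r r" and Q: "Q \<in> carrier_mat r r" and len: "length xs = r"
  and PQ: "P * Q = 1\<^sub>m r" and QP: "Q * P = 1\<^sub>m r" and B_eq: "B = P * jmat xs * Q"
  using similar_mat_witD2[OF B wit] by auto

lemma r_sum: "r = sum b {..<N}"
  using card_layers[of N b c, OF bN] dist set_xs len distinct_card by fastforce

definition tv :: "(nat \<times> nat \<Rightarrow> complex) \<Rightarrow> complex vec" where
  "tv u = P *\<^sub>v vec r (\<lambda>i. u (snd (xs ! i)))"

lemma fst_xs: "i < r \<Longrightarrow> fst (xs ! i) = c"
  using nth_mem[of i xs] set_xs len by (auto simp: layers_def)

lemma tv_carrier [simp]: "tv u \<in> carrier_vec r"
  unfolding tv_def using P by simp

lemma tv_lin: "tv (\<lambda>x. u x + a * w x) = tv u + a \<cdot>\<^sub>v tv w"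
proof -
  have "vec r (\<lambda>i. u (snd (xs ! i)) + a * w (snd (xs ! i)))
    = vec r (\<lambda>i. u (snd (xs ! i))) + a \<cdot>\<^sub>v vec r (\<lambda>i. w (snd (xs ! i)))" by auto
  then show ?thesis unfolding tv_def using P
    by (simp add: mult_add_distrib_mat_vec[of _ r r] mult_mat_vec[of _ r r])
qed

lemma tv_null: "(\<And>s k. k < b s \<Longrightarrow> u (s,k) = 0) \<Longrightarrow> tv u = 0\<^sub>v r"
proof -
  assume u: "\<And>s k. k < b s \<Longrightarrow> u (s,k) = 0"
  have "u (snd (xs ! i)) = 0" if "i < r" for i
    using nth_mem[of i xs] that set_xs len u by (auto simp: layers_def)
  then have "vec r (\<lambda>i. u (snd (xs ! i))) = 0\<^sub>v r" by auto
  moreover have "P *\<^sub>v 0\<^sub>v r = 0\<^sub>v r" using P by auto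
  ultimately show ?thesis by (simp add: tv_def)
qed

lemma tv_surj:
  assumes "x \<in> carrier_vec r"
  obtains u where "x = tv u"
proof -
  \<comment> \<open>Reads the coordinate at the unique position of the label \<open>(c, y)\<close>;
    for \<open>y\<close> outside the blocks the value is arbitrary and never read.\<close>
  define u where "u y = (Q *\<^sub>v x) $ (THE i. i < r \<and> xs ! i = (c, y))" for y
  have "u (snd (xs ! i)) = (Q *\<^sub>v x) $ i" if "i < r" for i
  proof -
    have "(THE j. j < r \<and> xs ! j = (c, snd (xs ! i))) = i"
    proof (rule the_equality)
      show "i < r \<and> xs ! i = (c, snd (xs ! i))" using that fst_xs[OF that] by (simp add: prod_eq_iff)
      fix j assume j: "j < r \<and> xs ! j = (c, snd (xs ! i))"
      then have "xs ! j = xs ! i" using fst_xs[OF that] by (simp add: prod_eq_iff)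
      then show "j = i" using nth_eq_iff_index_eq[OF dist, of j i] j that len by simp
    qed
    then show ?thesis by (simp add: u_def)
  qed
  then have "vec r (\<lambda>i. u (snd (xs ! i))) = Q *\<^sub>v x" using Q by auto
  then have "tv u = P *\<^sub>v (Q *\<^sub>v x)" by (simp add: tv_def)
  also have "\<dots> = x" using P Q assms PQ by (simp flip: assoc_mult_mat_vec)
  finally show ?thesis using that by metis
qed

lemma jmat_mult_vec:
  "jmat xs *\<^sub>v vec r (\<lambda>i. u (snd (xs ! i))) = vec r (\<lambda>i. c * u (snd (xs ! i)) + shf 1 u (snd (xs ! i)))"
proof (rule eq_vecI)
  fix i assume "i < dim_vec (vec r (\<lambda>i. c * u (snd (xs ! i)) + shf 1 u (snd (xs ! i))))"
  then have i: "i < r" by simp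
  have "(jmat xs *\<^sub>v vec r (\<lambda>i. u (snd (xs ! i)))) $ i
      = (\<Sum>j<r. jmat xs $$ (i,j) * u (snd (xs ! j)))"
    using i len by (simp add: scalar_prod_def atLeast0LessThan)
  also have "\<dots> = (\<Sum>j<r. (if j = i then c * u (snd (xs ! i)) else 0) +
      (if xs ! i = nxt (xs ! j) then u (snd (xs ! j)) else 0))"
    using i len fst_xs by (intro sum.cong) (auto simp: jmat_def nxt_def prod_eq_iff)
  also have "\<dots> = c * u (snd (xs ! i)) + (\<Sum>j<r. (if xs ! i = nxt (xs ! j) then u (snd (xs ! j)) else 0))"
    using i by (simp add: sum.distrib)
  also have "(\<Sum>j<r. (if xs ! i = nxt (xs ! j) then u (snd (xs ! j)) else 0)) = shf 1 u (snd (xs ! i))"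
  proof -
    obtain s k where sk: "xs ! i = (c,s,k)" "k < b s"
      using nth_mem[of i xs] i set_xs len by (auto simp: layers_def)
    show ?thesis
    proof (cases k)
      case 0
      then show ?thesis by (auto simp: sk nxt_def shf_def)
    next
      case (Suc k')
      then have "(c,s,k') \<in> set xs" using sk set_xs by (auto simp: layers_def)
      then obtain j where j: "j < r" "xs ! j = (c,s,k')" using len by (auto simp: in_set_conv_nth)
      have "xs ! i = nxt (xs ! l) \<longleftrightarrow> l = j" if "l < r" for l
        using that j sk Suc dist len fst_xs[OF that] nth_eq_iff_index_eq[OF dist, of l j]
        by (auto simp: nxt_def prod_eq_iff)
      then have "(\<Sum>l<r. (if xs ! i = nxt (xs ! l) then u (snd (xs ! l)) else 0))
          = (\<Sum>l<r. (if l = j then u (snd (xs ! l)) else 0))" by (intro sum.cong) auto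
      also have "\<dots> = u (s,k')" using j by simp
      finally show ?thesis by (simp add: sk Suc shf_def)
    qed
  qed
  finally show "(jmat xs *\<^sub>v vec r (\<lambda>i. u (snd (xs ! i)))) $ i
     = vec r (\<lambda>i. c * u (snd (xs ! i)) + shf 1 u (snd (xs ! i))) $ i" using i by simp
qed (use len in simp)

text \<open>In Jordan coordinates the matrix acts as multiplication by \<open>c + t\<close>; this is
  the link between powers of \<open>B\<close> and shifts.\<close>

lemma B_tv: "B *\<^sub>v tv u = tv (\<lambda>x. shf 1 u x + c * u x)"
proof -
  have J: "jmat xs \<in> carrier_mat r r" using len jmat_carrier[of xs] by simp
  have "B *\<^sub>v tv u = P *\<^sub>v (jmat xs *\<^sub>v (Q *\<^sub>v (P *\<^sub>v vec r (\<lambda>i. u (snd (xs ! i))))))"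
    unfolding B_eq tv_def using P Q J by (simp add: assoc_mult_mat_vec[of _ r r _ r])
  also have "Q *\<^sub>v (P *\<^sub>v vec r (\<lambda>i. u (snd (xs ! i)))) = vec r (\<lambda>i. u (snd (xs ! i)))"
    using P Q QP by (simp flip: assoc_mult_mat_vec)
  finally show ?thesis unfolding jmat_mult_vec by (simp add: tv_def add.commute)
qed

sublocale V: vec_space "TYPE(complex)" r .

lemma pow_Suc_mult_vec:
  assumes "x \<in> carrier_vec r"
  shows "(B ^\<^sub>m Suc k) *\<^sub>v x = B *\<^sub>v ((B ^\<^sub>m k) *\<^sub>v x)"
proof -
  have "B ^\<^sub>m k * B = B * B ^\<^sub>m k"
  proof (induction k)
    case (Suc k)
    then show ?case using B pow_carrier_mat[OF B, of k] by (simp add: assoc_mult_mat[of _ r r _ r])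
  qed (use B in simp)
  moreover have "B * B ^\<^sub>m k *\<^sub>v x = B *\<^sub>v (B ^\<^sub>m k *\<^sub>v x)"
    by (rule assoc_mult_mat_vec[OF B pow_carrier_mat[OF B] assms])
  ultimately show ?thesis by simp
qed

lemma orbit_carrier:
  assumes "set ys \<subseteq> carrier_vec r"
  shows "{(B ^\<^sub>m k) *\<^sub>v x | k x. x \<in> set ys} \<subseteq> carrier_vec r"
  using assms mult_mat_vec_carrier[OF pow_carrier_mat[OF B]] by blast

text \<open>The universally quantified \<open>U\<close> of \<open>shift_orbits_small\<close> is
  instantiated by the coordinate vectors whose image lies in the span \<open>W\<close> of the images
  of \<open>G\<close>. All orbits then lie in \<open>W\<close>, and \<open>d\<close> vectors never
  generate more than the \<open>d\<close> largest blocks together.\<close>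

lemma dim_orbits_le:
  assumes ys: "set ys \<subseteq> carrier_vec r"
  shows "vectorspace.dim class_ring (V.span_vs {(B ^\<^sub>m k) *\<^sub>v x | k x. x \<in> set ys}) \<le> sum b {..<length ys}"
proof -
  define g where "g x = (SOME u. x = tv u)" for x
  have g: "x = tv (g x)" if "x \<in> set ys" for x
  proof -
    have "x \<in> carrier_vec r" using ys that by blast
    then obtain u where "x = tv u" by (rule tv_surj)
    then show ?thesis unfolding g_def by (rule someI[of "\<lambda>u. x = tv u"])
  qed
  have "\<exists>G. length G \<le> sum b {0..<0 + length (map g ys)} \<and>
    (\<forall>U. fsub b U \<longrightarrow> set G \<subseteq> U \<longrightarrow> (\<forall>u\<in>set (map g ys). \<forall>k. shf k u \<in> U))"
    by (rule shift_orbits_small[OF anti]) simp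
  then obtain G where G: "length G \<le> sum b {0..<0 + length (map g ys)}"
    "\<forall>U. fsub b U \<longrightarrow> set G \<subseteq> U \<longrightarrow> (\<forall>u\<in>set (map g ys). \<forall>k. shf k u \<in> U)"
    by (elim exE conjE)
  define W where "W = V.span (tv ` set G)"
  have W: "submodule class_ring W V.V" unfolding W_def by (rule V.span_is_submodule) auto
  define U where "U = {u. tv u \<in> W}"
  have U: "fsub b U"
    unfolding fsub_def U_def using tv_null tv_lin W
    by (auto simp: submodule_def module_vec_simps class_ring_simps)
  have GU: "set G \<subseteq> U" unfolding U_def W_def using V.in_own_span[of "tv ` set G"]
    by (auto simp: image_subset_iff)
  \<comment> \<open>\<open>U\<close> is not known to be closed under shifts, so the induction
    carries all shifts of the coordinate vector along.\<close>
  have "\<exists>u. (B ^\<^sub>m k) *\<^sub>v x = tv u \<and> (\<forall>j. shf j u \<in> U)" if x: "x \<in> set ys" for k x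
  proof (induction k)
    case 0
    have "x \<in> carrier_vec r" using x ys by blast
    then have "(B ^\<^sub>m 0) *\<^sub>v x = tv (g x)" using g[OF x] B by simp
    moreover have "\<forall>j. shf j (g x) \<in> U" using G(2) U GU x by simp
    ultimately show ?case by blast
  next
    case (Suc k)
    then obtain u where u: "(B ^\<^sub>m k) *\<^sub>v x = tv u" "\<And>j. shf j u \<in> U" by blast
    have "(B ^\<^sub>m Suc k) *\<^sub>v x = B *\<^sub>v ((B ^\<^sub>m k) *\<^sub>v x)"
      by (rule pow_Suc_mult_vec) (use x ys in blast)
    also have "\<dots> = tv (\<lambda>x. shf 1 u x + c * u x)" by (simp add: u B_tv)
    finally have "(B ^\<^sub>m Suc k) *\<^sub>v x = tv (\<lambda>x. shf 1 u x + c * u x)" .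
    moreover have "shf j (\<lambda>x. shf 1 u x + c * u x) \<in> U" for j
    proof -
      have "shf j (\<lambda>x. shf 1 u x + c * u x) = (\<lambda>x. shf (j + 1) u x + c * shf j u x)"
        by (rule ext) (auto simp: shf_def)
      then show ?thesis using fsub_lin[OF U u(2) u(2)] by simp
    qed
    ultimately show ?case by blast
  qed
  moreover have "shf 0 u = u" for u by (rule ext) (auto simp: shf_def)
  ultimately have "(B ^\<^sub>m k) *\<^sub>v x \<in> W" if "x \<in> set ys" for k x
    using that unfolding U_def mem_Collect_eq by metis
  then have "{(B ^\<^sub>m k) *\<^sub>v x | k x. x \<in> set ys} \<subseteq> W" by blast
  moreover note orbit_carrier[OF ys]
  ultimately have "vectorspace.dim class_ring (V.span_vs {(B ^\<^sub>m k) *\<^sub>v x | k x. x \<in> set ys})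
      \<le> card (tv ` set G)"
    unfolding W_def by (intro V.dim_span_le_card) auto
  also have "\<dots> \<le> card (set G)" by (rule card_image_le) simp
  also have "\<dots> \<le> length G" by (rule card_length)
  finally show ?thesis using G(1) by (simp add: atLeast0LessThan)
qed

definition unit_at :: "nat \<Rightarrow> nat \<Rightarrow> complex vec" where
  "unit_at s k = tv (\<lambda>x. if x = (s,k) then 1 else 0)"

lemma unit_at_Suc: "unit_at s (Suc k) = B *\<^sub>v unit_at s k + (- c) \<cdot>\<^sub>v unit_at s k"
proof -
  have "(\<lambda>x. if x = (s, Suc k) then 1 else 0 :: complex)
    = (\<lambda>x. (shf 1 (\<lambda>x. if x = (s,k) then 1 else 0) x + c * (if x = (s,k) then 1 else 0))
        + (-c) * (if x = (s,k) then 1 else 0))"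
    by (rule ext) (auto simp: shf_def split: if_splits)
  then show ?thesis unfolding unit_at_def B_tv tv_lin[symmetric] by simp
qed

lemma unit_at_col: "i < r \<Longrightarrow> xs ! i = (c,s,k) \<Longrightarrow> unit_at s k = col P i"
proof -
  assume i: "i < r" and xi: "xs ! i = (c,s,k)"
  have "snd (xs ! j) = (s,k) \<longleftrightarrow> j = i" if "j < r" for j
    using that i xi fst_xs[OF that] nth_eq_iff_index_eq[OF dist, of j i] len by (auto simp: prod_eq_iff)
  then have "vec r (\<lambda>j. if snd (xs ! j) = (s,k) then 1 else 0 :: complex) = unit_vec r i"
    using i by (intro eq_vecI) auto
  moreover have "P *\<^sub>v unit_vec r i = col P i" using P i by (intro eq_vecI) auto
  ultimately show ?thesis unfolding unit_at_def tv_def by simp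
qed

lemma span_orbit_closed:
  assumes ys: "set ys \<subseteq> carrier_vec r" and y: "y \<in> V.span {(B ^\<^sub>m k) *\<^sub>v x | k x. x \<in> set ys}"
  shows "B *\<^sub>v y \<in> V.span {(B ^\<^sub>m k) *\<^sub>v x | k x. x \<in> set ys}"
proof -
  define S where "S = {(B ^\<^sub>m k) *\<^sub>v x | k x. x \<in> set ys}"
  have S: "S \<subseteq> carrier_vec r" unfolding S_def by (rule orbit_carrier[OF ys])
  have W: "submodule class_ring (V.span S) V.V" by (rule V.span_is_submodule) (use S in auto)
  define Z where "Z = {y \<in> carrier_vec r. B *\<^sub>v y \<in> V.span S}"
  have "submodule class_ring Z V.V"
  proof (unfold submodule_def, intro conjI allI impI ballI)
    show "Module.module class_ring V.V" by (rule V.module_axioms)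
    show "Z \<subseteq> carrier V.V" by (auto simp: Z_def)
    show "v \<oplus>\<^bsub>V.V\<^esub> w \<in> Z" if "v \<in> Z" "w \<in> Z" for v w
      using that W B by (auto simp: Z_def submodule_def mult_add_distrib_mat_vec[of _ r r] module_vec_simps)
    show "\<zero>\<^bsub>V.V\<^esub> \<in> Z"
    proof -
      have "B *\<^sub>v 0\<^sub>v r = 0\<^sub>v r" using B by auto
      then show ?thesis using W by (auto simp: Z_def submodule_def module_vec_simps)
    qed
    show "a \<odot>\<^bsub>V.V\<^esub> v \<in> Z" if "a \<in> carrier class_ring" "v \<in> Z" for a v
      using that W B by (auto simp: Z_def submodule_def mult_mat_vec[of _ r r] module_vec_simps)
  qed
  moreover have "S \<subseteq> Z"
  proof
    fix y assume "y \<in> S"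
    then obtain k x where y: "y = (B ^\<^sub>m k) *\<^sub>v x" "x \<in> set ys" by (auto simp: S_def)
    have "B *\<^sub>v y = (B ^\<^sub>m Suc k) *\<^sub>v x" unfolding y(1) by (rule pow_Suc_mult_vec[symmetric]) (use y ys in blast)
    then have "B *\<^sub>v y \<in> S" using y(2) unfolding S_def by blast
    then show "y \<in> Z" using \<open>y \<in> S\<close> S V.in_own_span[of S] by (auto simp: Z_def)
  qed
  ultimately have "V.span S \<subseteq> Z" by (rule V.span_is_subset[rotated])
  then show ?thesis using y by (auto simp: Z_def S_def)
qed

text \<open>The first vectors of the chains in \<open>T\<close> generate these chains completely,
  since \<open>B - c\<close> moves each chain vector to the next one. The vectors obtained are
  columns of the invertible \<open>P\<close>, hence independent.\<close>

lemma orbits_dim_ge: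
  assumes T: "finite T"
  obtains ys where "length ys = card T" "set ys \<subseteq> carrier_vec r"
    "sum b T \<le> vectorspace.dim class_ring (V.span_vs {(B ^\<^sub>m k) *\<^sub>v x | k x. x \<in> set ys})"
proof -
  define ys where "ys = map (\<lambda>s. unit_at s 0) (sorted_list_of_set T)"
  have ys: "set ys \<subseteq> carrier_vec r" by (auto simp: ys_def unit_at_def)
  define S where "S = {(B ^\<^sub>m k) *\<^sub>v x | k x. x \<in> set ys}"
  have S: "S \<subseteq> carrier_vec r" unfolding S_def by (rule orbit_carrier[OF ys])
  have W: "submodule class_ring (V.span S) V.V" by (rule V.span_is_submodule) (use S in auto)
  have in_span: "unit_at s k \<in> V.span S" if s: "s \<in> T" for s k
  proof (induction k)
    case 0
    have "unit_at s 0 \<in> set ys" using s T by (simp add: ys_def)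
    moreover have "(B ^\<^sub>m 0) *\<^sub>v unit_at s 0 = unit_at s 0" using B by (simp add: unit_at_def)
    ultimately have "unit_at s 0 \<in> S" unfolding S_def by (metis (mono_tags, lifting) mem_Collect_eq)
    then show ?case using S V.in_own_span[of S] by auto
  next
    case (Suc k)
    have "B *\<^sub>v unit_at s k \<in> V.span S" using span_orbit_closed[OF ys, of "unit_at s k"] Suc unfolding S_def by blast
    then show ?case using W Suc unfolding unit_at_Suc
      by (auto simp: submodule_def module_vec_simps class_ring_simps)
  qed
  \<comment> \<open>The positions of the labels belonging to chains in \<open>T\<close>; their
    number is the total size of these blocks.\<close>
  define I where "I = {i. i < r \<and> fst (snd (xs ! i)) \<in> T}"
  have cols_inj: "inj_on (col P) {..<r}"
  proof (rule inj_onI)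
    fix i j assume ij: "i \<in> {..<r}" "j \<in> {..<r}" "col P i = col P j"
    have "Q *\<^sub>v col P i = unit_vec r i" if "i < r" for i
    proof -
      have "Q *\<^sub>v col P i = col (Q * P) i" by (rule col_mult2[OF Q P that, symmetric])
      then show ?thesis using QP that by simp
    qed
    with ij have "unit_vec r i = (unit_vec r j :: complex vec)" by (metis lessThan_iff)
    then show "i = j" using ij by (metis index_unit_vec(1) lessThan_iff zero_neq_one)
  qed
  have distP: "distinct (cols P)" using P cols_inj by (simp add: cols_def distinct_map atLeast0LessThan)
  have "det P \<noteq> 0"
    using PQ P Q det_mult[of P r Q] by auto
  then have "V.lin_indpt (set (cols P))"
    using V.full_rank_lin_indpt[OF P _ distP] V.det_rank_iff[OF P] by simp
  moreover have sub: "col P ` I \<subseteq> set (cols P)" using P by (auto simp: cols_def I_def)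
  ultimately have li: "V.lin_indpt (col P ` I)" using V.subset_li_is_li by blast
  have "col P ` I \<subseteq> V.span S"
  proof
    fix y assume "y \<in> col P ` I"
    then obtain i where i: "i < r" "fst (snd (xs ! i)) \<in> T" "y = col P i" by (auto simp: I_def)
    then have "unit_at (fst (snd (xs ! i))) (snd (snd (xs ! i))) = col P i"
      using fst_xs by (intro unit_at_col) (auto simp: prod_eq_iff)
    then show "y \<in> V.span S" using in_span i by metis
  qed
  from V.lin_indpt_le_dim_span[OF S this li]
  have "card (col P ` I) \<le> vectorspace.dim class_ring (V.span_vs S)" .
  moreover have "card (col P ` I) = card I"
    by (rule card_image, rule inj_on_subset[OF cols_inj]) (auto simp: I_def)
  moreover have "card I = sum b T"
  proof -
    have "bij_betw (\<lambda>i. snd (xs ! i)) I (SIGMA s:T. {..<b s})"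
    proof (rule bij_betwI')
      fix i j assume "i \<in> I" "j \<in> I"
      then show "(snd (xs ! i) = snd (xs ! j)) = (i = j)"
        using fst_xs nth_eq_iff_index_eq[OF dist, of i j] len by (auto simp: I_def prod_eq_iff)
    next
      fix i assume "i \<in> I"
      then show "snd (xs ! i) \<in> (SIGMA s:T. {..<b s})"
        using nth_mem[of i xs] set_xs len by (auto simp: I_def layers_def)
    next
      fix y assume y: "y \<in> (SIGMA s:T. {..<b s})"
      then have "(c,y) \<in> set xs" by (auto simp: set_xs layers_def)
      then obtain i where "i < r" "xs ! i = (c,y)" using len by (auto simp: in_set_conv_nth)
      then show "\<exists>i\<in>I. y = snd (xs ! i)" using y by (intro bexI[of _ i]) (auto simp: I_def)
    qed
    then have "card I = card (SIGMA s:T. {..<b s})" by (rule bij_betw_same_card)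
    then show ?thesis using T by simp
  qed
  ultimately show ?thesis using that[of ys] ys T by (simp add: ys_def S_def)
qed

lemma d_ell_le:
  assumes "finite T" "l \<le> sum b T"
  shows "d_ell r B l \<le> card T"
proof -
  obtain ys where "length ys = card T" "set ys \<subseteq> carrier_vec r"
    "sum b T \<le> vectorspace.dim class_ring (V.span_vs {(B ^\<^sub>m k) *\<^sub>v x | k x. x \<in> set ys})"
    using orbits_dim_ge[OF assms(1)] .
  then show ?thesis unfolding d_ell_def using assms(2) by (intro Least_le exI[of _ ys]) auto
qed

text \<open>Together with \<open>d_ell_le\<close> for initial segments \<open>T\<close>, this
  identifies \<open>d_ell r B l\<close> as the least number of largest blocks with total size at
  least \<open>l\<close>. The bound \<open>l \<le> r\<close> ensures that the minimum is taken over
  a nonempty set: all \<open>N\<close> chain heads together reach \<open>r\<close>.\<close>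

lemma d_ell_ge:
  assumes "l \<le> r"
  shows "l \<le> sum b {..<d_ell r B l}"
proof -
  obtain ys where "length ys = N" "set ys \<subseteq> carrier_vec r"
    "sum b {..<N} \<le> vectorspace.dim class_ring (V.span_vs {(B ^\<^sub>m k) *\<^sub>v x | k x. x \<in> set ys})"
    using orbits_dim_ge[of "{..<N}"] by auto
  then have "\<exists>d ys. length ys = d \<and> set ys \<subseteq> carrier_vec r \<and>
     l \<le> vectorspace.dim class_ring (V.span_vs {(B ^\<^sub>m k) *\<^sub>v x | k x. x \<in> set ys})"
    using assms[THEN order_trans, OF eq_refl[OF r_sum]] by (intro exI[of _ "length ys"] exI[of _ ys]) auto
  from LeastI_ex[OF this] obtain ys where "length ys = d_ell r B l" "set ys \<subseteq> carrier_vec r"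
    "l \<le> vectorspace.dim class_ring (V.span_vs {(B ^\<^sub>m k) *\<^sub>v x | k x. x \<in> set ys})"
    unfolding d_ell_def by blast
  with dim_orbits_le[of ys] show ?thesis by simp
qed

end

section \<open>Orders of Taylor coefficients of the characteristic polynomial\<close>

text \<open>The Taylor coefficient at \<open>c\<close>, that is, the derivative in (iii) divided by
  \<open>k!\<close>. In this normalisation products become plain convolutions.\<close>

definition tcoeff :: "complex poly \<Rightarrow> complex \<Rightarrow> nat \<Rightarrow> complex" where
  "tcoeff p c k = coeff (p \<circ>\<^sub>p [:c, 1:]) k"

lemma higher_pderiv_shift: "(pderiv ^^ k) p \<circ>\<^sub>p [:c, 1:] = (pderiv ^^ k) (p \<circ>\<^sub>p [:c, 1 :: complex:])"
proof (induction k)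
  case (Suc k)
  have "pderiv [:c, 1 :: complex:] = 1" by (simp add: pderiv_pCons)
  then have "pderiv ((pderiv ^^ k) p \<circ>\<^sub>p [:c, 1:]) = pderiv ((pderiv ^^ k) p) \<circ>\<^sub>p [:c, 1:]"
    by (simp add: pderiv_pcompose)
  then show ?case using Suc by simp
qed simp

lemma poly_higher_pderiv_tcoeff: "poly ((pderiv ^^ k) p) c = fact k * tcoeff p c k"
proof -
  have "poly ((pderiv ^^ k) p) c = coeff ((pderiv ^^ k) p \<circ>\<^sub>p [:c, 1:]) 0"
    by (simp add: coeff_pcompose_0)
  then show ?thesis using coeff_higher_pderiv[of k "p \<circ>\<^sub>p [:c, 1:]" 0]
    by (simp add: higher_pderiv_shift tcoeff_def pochhammer_fact)
qed

lemma tcoeff_0 [simp]: "tcoeff 0 c k = 0"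
  by (simp add: tcoeff_def)

lemma tcoeff_add: "tcoeff (p + q) c k = tcoeff p c k + tcoeff q c k"
  by (simp add: tcoeff_def pcompose_add)

lemma tcoeff_sum: "tcoeff (sum g X) c k = (\<Sum>x\<in>X. tcoeff (g x) c k)"
  by (induction X rule: infinite_finite_induct) (simp_all add: tcoeff_add)

lemma tcoeff_mult: "tcoeff (p * q) c k = (\<Sum>i\<le>k. tcoeff p c i * tcoeff q c (k - i))"
  by (simp add: tcoeff_def pcompose_mult coeff_mult)

lemma tcoeff_linear: "tcoeff [:a, d:] c k = (if k = 0 then a + c * d else if k = 1 then d else 0)"
  by (auto simp: tcoeff_def pcompose_pCons coeff_pCons split: nat.splits)

lemma tcoeff_const: "tcoeff [:a:] c k = (if k = 0 then a else 0)"
  by (auto simp: tcoeff_def pcompose_pCons coeff_pCons split: nat.splits)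

lemma tcoeff_linear_power: "tcoeff ([:-c, 1:] ^ m) c k = (if k = m then 1 else 0)"
proof -
  have "[:-c, 1:] ^ m \<circ>\<^sub>p [:c, 1:] = monom 1 m"
  proof (induction m)
    case (Suc m)
    have "[:-c, 1:] \<circ>\<^sub>p [:c, 1:] = [:0, 1:]" by (simp add: pcompose_pCons)
    then show ?case by (simp only: power_Suc pcompose_mult Suc) (simp add: monom_Suc)
  qed simp
  then show ?thesis by (simp add: tcoeff_def)
qed

section \<open>Orders at a point of families of polynomials\<close>

definition hfam :: "complex \<Rightarrow> complex \<Rightarrow> (complex \<Rightarrow> complex poly) \<Rightarrow> bool" where
  "hfam p c q \<longleftrightarrow> (\<forall>k. (\<lambda>v. tcoeff (q v) c k) field_differentiable at p)"

lemma hfam_mult: "hfam p c q \<Longrightarrow> hfam p c r \<Longrightarrow> hfam p c (\<lambda>v. q v * r v)"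
  unfolding hfam_def tcoeff_mult
  by (intro allI field_differentiable_sum field_differentiable_mult) auto

lemma hfam_const: "hfam p c (\<lambda>_. q)"
  by (simp add: hfam_def)

lemma hfam_prod: "(\<And>i. i \<in> I \<Longrightarrow> hfam p c (q i)) \<Longrightarrow> hfam p c (\<lambda>v. \<Prod>i\<in>I. q i v)"
  by (induction I rule: infinite_finite_induct) (simp_all add: hfam_const hfam_mult)

text \<open>Membership in the product over \<open>s \<in> S\<close> of the ideals \<open>(v - p, (\<lambda> - c)^(b s))\<close>, read off from the
  Taylor coefficients at \<open>c\<close>: the subset \<open>T\<close> records where the generator \<open>v - p\<close> is chosen.\<close>

definition vfam :: "(nat \<Rightarrow> nat) \<Rightarrow> complex \<Rightarrow> complex \<Rightarrow> nat set \<Rightarrow> (complex \<Rightarrow> complex poly) \<Rightarrow> bool" where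
  "vfam b p c S q \<longleftrightarrow> (\<forall>k e. (\<forall>T\<subseteq>S. sum b (S - T) \<le> k \<longrightarrow> e \<le> card T) \<longrightarrow>
     (\<lambda>v. tcoeff (q v) c k) \<in> O[at p](\<lambda>v. (v - p) ^ e))"

lemma field_differentiable_bigo_1:
  assumes "g field_differentiable at (p :: complex)"
  shows "g \<in> O[at p](\<lambda>_. 1)"
  using field_differentiable_imp_continuous_at[OF assms]
  by (intro bigoI_tendsto[of _ _ "g p"]) (auto simp: isCont_def)

lemma field_differentiable_bigo_linear:
  assumes "g field_differentiable at (p :: complex)" "g p = 0"
  shows "g \<in> O[at p](\<lambda>v. v - p)"
proof -
  from assms(1) obtain D where "(g has_field_derivative D) (at p)" by (auto simp: field_differentiable_def)
  then have "((\<lambda>v. (g v - g p) / (v - p)) \<longlongrightarrow> D) (at p)" by (simp add: has_field_derivative_iff)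
  then show ?thesis using assms(2)
    by (intro bigoI_tendsto[of _ _ D]) (auto simp: eventually_at_filter)
qed

lemma hfam_vfam_empty: "hfam p c q \<Longrightarrow> vfam b p c {} q"
  by (auto simp: vfam_def hfam_def intro: field_differentiable_bigo_1)

text \<open>In each term of the convolution, either the coefficient of \<open>r\<close> has index
  below \<open>b s\<close>; it then vanishes at \<open>p\<close> and contributes a factor
  \<open>v - p\<close>, so \<open>s\<close> joins \<open>T\<close>. Or at least \<open>b s\<close>
  of the index \<open>k\<close> is used up by \<open>r\<close>, and \<open>s\<close> stays in the
  complement of \<open>T\<close>.\<close>

lemma vfam_insert:
  assumes q: "vfam b p c S q" and hr: "hfam p c r"
    and r: "\<And>k. k < b s \<Longrightarrow> tcoeff (r p) c k = 0" and s: "s \<notin> S" and S: "finite S"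
  shows "vfam b p c (insert s S) (\<lambda>v. q v * r v)"
  unfolding vfam_def
proof (intro allI impI)
  fix k e
  assume e: "\<forall>T\<subseteq>insert s S. sum b (insert s S - T) \<le> k \<longrightarrow> e \<le> card T"
  have r1: "(\<lambda>v. tcoeff (r v) c i) \<in> O[at p](\<lambda>_. 1)" for i
    using hr by (auto simp: hfam_def intro: field_differentiable_bigo_1)
  have "(\<lambda>v. tcoeff (q v) c i * tcoeff (r v) c (k - i)) \<in> O[at p](\<lambda>v. (v - p) ^ e)" if i: "i \<le> k" for i
  proof (cases "k - i < b s")
    case True
    show ?thesis
    proof (cases e)
      case 0
      have "(\<lambda>v. tcoeff (q v) c i) \<in> O[at p](\<lambda>v. (v - p) ^ 0)"
        using q unfolding vfam_def by blast
      from landau_o.big.mult[OF this r1] show ?thesis by (simp add: 0)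
    next
      case (Suc e')
      have "e' \<le> card T" if T: "T \<subseteq> S" "sum b (S - T) \<le> i" for T
      proof -
        have "insert s S - insert s T = S - T" using s by auto
        then have "e \<le> card (insert s T)" using e[rule_format, of "insert s T"] T i by auto
        moreover have "finite T" "s \<notin> T" using T s S finite_subset by auto
        ultimately show ?thesis by (simp add: Suc)
      qed
      then have "(\<lambda>v. tcoeff (q v) c i) \<in> O[at p](\<lambda>v. (v - p) ^ e')"
        using q by (auto simp: vfam_def)
      moreover have "(\<lambda>v. tcoeff (r v) c (k - i)) \<in> O[at p](\<lambda>v. v - p)"
        using hr r[OF True] by (auto simp: hfam_def intro: field_differentiable_bigo_linear)
      ultimately show ?thesis using landau_o.big.mult by (fastforce simp: Suc mult.commute)
    qed
  next
    case False
    have "e \<le> card T" if T: "T \<subseteq> S" "sum b (S - T) \<le> i" for T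
    proof -
      have "insert s S - T = insert s (S - T)" using s T by auto
      then have "sum b (insert s S - T) = b s + sum b (S - T)" using S s by simp
      moreover have "T \<subseteq> insert s S" using T by auto
      moreover have "b s + sum b (S - T) \<le> k" using T(2) i False by linarith
      ultimately show ?thesis using e[rule_format, of T] by simp
    qed
    then have "(\<lambda>v. tcoeff (q v) c i) \<in> O[at p](\<lambda>v. (v - p) ^ e)"
      using q by (auto simp: vfam_def)
    from landau_o.big.mult[OF this r1] show ?thesis by simp
  qed
  then show "(\<lambda>v. tcoeff (q v * r v) c k) \<in> O[at p](\<lambda>v. (v - p) ^ e)"
    unfolding tcoeff_mult by (intro big_sum_in_bigo) auto
qed

lemma vfam_sum:
  assumes "\<And>x. x \<in> X \<Longrightarrow> vfam b p c S (q x)"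
  shows "vfam b p c S (\<lambda>v. \<Sum>x\<in>X. q x v)"
  unfolding vfam_def tcoeff_sum using assms by (intro allI impI big_sum_in_bigo) (auto simp: vfam_def)

lemma vfam_prod:
  assumes "finite S" and q: "hfam p c q" and hr: "\<And>s. s \<in> S \<Longrightarrow> hfam p c (r s)"
    and r: "\<And>s k. s \<in> S \<Longrightarrow> k < b s \<Longrightarrow> tcoeff (r s p) c k = 0"
  shows "vfam b p c S (\<lambda>v. q v * (\<Prod>s\<in>S. r s v))"
  using assms(1) hr r
proof (induction S)
  case empty
  then show ?case using hfam_vfam_empty[OF q] by simp
next
  case (insert s S)
  have "vfam b p c (insert s S) (\<lambda>v. (q v * (\<Prod>s\<in>S. r s v)) * r s v)"
    using insert by (intro vfam_insert) auto
  then show ?case using insert.hyps by (simp add: mult_ac)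
qed

text \<open>Suppose no factor vanishes. Then \<open>\<sigma>\<close> fixes every position of the
  chain, by induction along the chain: a nonzero off-diagonal entry leads to the position of the
  preceding label, which is already fixed, against injectivity. The product is therefore the power
  of \<open>[:-c, 1:]\<close> with exponent \<open>b s\<close>.\<close>

lemma block_product_at_jmat:
  assumes dist: "distinct xs" and n: "n = length xs" and \<sigma>: "\<sigma> permutes {0..<n}"
    and lay: "{x \<in> set xs. fst x = c} = layers c b"
    and k: "k < b s"
  defines "I \<equiv> {i. i < n \<and> fst (xs ! i) = c \<and> fst (snd (xs ! i)) = s}"
  shows "tcoeff (\<Prod>i\<in>I. char_poly_matrix (jmat xs) $$ (i, \<sigma> i)) c k = 0"
proof -
  have sn: "\<sigma> i < n" if "i < n" for i using permutes_in_image[OF \<sigma>, of i] that by auto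
  have entry: "char_poly_matrix (jmat xs) $$ (i, j) =
    (if i = j then [:- fst (xs ! i), 1:] else if xs ! i = nxt (xs ! j) then [:-1:] else 0)"
    if "i < n" "j < n" for i j
    using that n by (auto simp: char_poly_matrix_def jmat_def)
  show ?thesis
  proof (cases "\<exists>i\<in>I. char_poly_matrix (jmat xs) $$ (i, \<sigma> i) = 0")
    case True
    have "finite I" by (auto simp: I_def)
    then have "(\<Prod>i\<in>I. char_poly_matrix (jmat xs) $$ (i, \<sigma> i)) = 0" using True by (simp add: prod_zero)
    then show ?thesis by simp
  next
    case False
    have fixed: "\<sigma> i = i" if "i < n" "xs ! i = (c, s, m)" for i m
      using that
    proof (induction m arbitrary: i rule: less_induct)
      case (less m)
      show ?case
      proof (rule ccontr)
        assume ne: "\<sigma> i \<noteq> i"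
        have "i \<in> I" using less.prems by (simp add: I_def)
        then have "char_poly_matrix (jmat xs) $$ (i, \<sigma> i) \<noteq> 0" using False by blast
        then have "xs ! i = nxt (xs ! \<sigma> i)"
          using entry[OF less.prems(1) sn[OF less.prems(1)]] ne by (auto split: if_splits)
        then obtain m' where m': "m = Suc m'" "xs ! \<sigma> i = (c, s, m')"
          using less.prems(2) by (cases "xs ! \<sigma> i") (auto simp: nxt_def)
        then have "\<sigma> (\<sigma> i) = \<sigma> i" using less.IH[of m' "\<sigma> i"] sn less.prems(1) by simp
        then have "\<sigma> i = i" using permutes_inj[OF \<sigma>] by (auto dest: injD)
        then show False using ne by simp
      qed
    qed
    have fixI: "\<sigma> i = i" if "i \<in> I" for i
      using that fixed[of i "snd (snd (xs ! i))"] by (auto simp: I_def prod_eq_iff)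
    have "(\<Prod>i\<in>I. char_poly_matrix (jmat xs) $$ (i, \<sigma> i)) = (\<Prod>i\<in>I. [:-c, 1:])"
    proof (rule prod.cong)
      fix i assume i: "i \<in> I"
      then show "char_poly_matrix (jmat xs) $$ (i, \<sigma> i) = [:-c, 1:]"
        using fixI[OF i] entry[of i i] by (simp add: I_def)
    qed simp
    then have eq: "(\<Prod>i\<in>I. char_poly_matrix (jmat xs) $$ (i, \<sigma> i)) = [:-c, 1:] ^ card I" by simp
    have "bij_betw (\<lambda>i. snd (snd (xs ! i))) I {..<b s}"
    proof (rule bij_betwI')
      fix i j assume "i \<in> I" "j \<in> I"
      then show "(snd (snd (xs ! i)) = snd (snd (xs ! j))) = (i = j)"
        using nth_eq_iff_index_eq[OF dist, of i j] n by (auto simp: I_def prod_eq_iff)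
    next
      fix i assume i: "i \<in> I"
      then have "xs ! i \<in> {x \<in> set xs. fst x = c}" using n by (auto simp: I_def)
      then have "xs ! i \<in> layers c b" unfolding lay .
      then obtain s' m where "xs ! i = (c, s', m)" "m < b s'" by (auto simp: layers_def)
      then show "snd (snd (xs ! i)) \<in> {..<b s}" using i by (auto simp: I_def)
    next
      fix m assume "m \<in> {..<b s}"
      then have "(c,s,m) \<in> {x \<in> set xs. fst x = c}" unfolding lay by (auto simp: layers_def)
      then obtain i where "i < n" "xs ! i = (c,s,m)" using n by (auto simp: in_set_conv_nth)
      then show "\<exists>i\<in>I. m = snd (snd (xs ! i))" by (intro bexI[of _ i]) (auto simp: I_def)
    qed
    then have "card I = b s" using bij_betw_same_card by fastforce
    then show ?thesis using k by (simp add: eq tcoeff_linear_power)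
  qed
qed

lemma mat_mult_entry:
  assumes "A \<in> carrier_mat n n" "B \<in> carrier_mat n n" "i < n" "j < n"
  shows "(A * B) $$ (i,j) = (\<Sum>l<n. A $$ (i,l) * B $$ (l,j))"
  using assms by (simp add: scalar_prod_def atLeast0LessThan)

text \<open>Conjugating by constant matrices makes the value at \<open>p\<close> a Jordan matrix and
  preserves holomorphy. In each Leibniz term the rows of chain \<open>s\<close> then give a factor
  whose Taylor coefficients below \<open>b s\<close> vanish at \<open>p\<close>, which is the input
  of \<open>vfam_prod\<close>.\<close>

lemma char_poly_family_order:
  assumes U: "open U" "p \<in> U" and F: "holo_mat n F U"
    and wit: "similar_mat_wit (F p) (jmat xs) P Q" and dist: "distinct xs"
    and lay: "{x \<in> set xs. fst x = c} = layers c b" and bN: "\<And>s. s \<ge> N \<Longrightarrow> b s = 0"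
    and e: "\<And>T. T \<subseteq> {..<N} \<Longrightarrow> sum b ({..<N} - T) \<le> k \<Longrightarrow> e \<le> card T"
  shows "(\<lambda>v. tcoeff (char_poly (F v)) c k) \<in> O[at p](\<lambda>v. (v - p) ^ e)"
proof -
  have Fc: "F v \<in> carrier_mat n n" if "v \<in> U" for v using F that by (simp add: holo_mat_def)
  from similar_mat_witD2[OF Fc[OF U(2)] wit]
  have P: "P \<in> carrier_mat n n" and Q: "Q \<in> carrier_mat n n" and PQ: "P * Q = 1\<^sub>m n" "Q * P = 1\<^sub>m n"
    and J: "jmat xs \<in> carrier_mat n n" and Fp: "F p = P * jmat xs * Q" by auto
  have len: "length xs = n" using J by auto
  define E where "E v = Q * F v * P" for v
  have Ec: "E v \<in> carrier_mat n n" if "v \<in> U" for v using Fc[OF that] P Q by (simp add: E_def)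
  have Ep: "E p = jmat xs"
  proof -
    have "E p = (Q * P) * jmat xs * (Q * P)"
      unfolding E_def Fp using P Q J by (simp add: assoc_mult_mat[of _ n n _ n _ n])
    then show ?thesis using PQ J by (simp add: left_mult_one_mat[OF J] right_mult_one_mat[OF J])
  qed
  have cp: "char_poly (F v) = char_poly (E v)" if "v \<in> U" for v
  proof (rule char_poly_similar[OF similar_mat_sym])
    show "similar_mat (E v) (F v)"
      by (rule similar_matI[of _ _ Q P n]) (use PQ P Q Fc[OF that] Ec[OF that] E_def in auto)
  qed
  have hE: "(\<lambda>v. E v $$ (i,j)) field_differentiable at p" if "i < n" "j < n" for i j
  proof -
    have "(\<lambda>v. F v $$ (i,j)) holomorphic_on U" if "i < n" "j < n" for i j
      using F that by (simp add: holo_mat_def)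
    then have "(\<lambda>v. \<Sum>l<n. (\<Sum>m<n. Q $$ (i,m) * F v $$ (m,l)) * P $$ (l,j)) holomorphic_on U"
      using that by (intro holomorphic_intros) auto
    moreover have "E v $$ (i,j) = (\<Sum>l<n. (\<Sum>m<n. Q $$ (i,m) * F v $$ (m,l)) * P $$ (l,j))"
      if "v \<in> U" for v
    proof -
      have QF: "Q * F v \<in> carrier_mat n n" using Q Fc[OF that] by simp
      show ?thesis
        unfolding E_def using \<open>i < n\<close> \<open>j < n\<close> P Q QF Fc[OF that]
        by (simp add: mat_mult_entry[OF QF P] mat_mult_entry[OF Q Fc[OF that]] del: index_mult_mat assoc_mult_mat)
    qed
    ultimately have "(\<lambda>v. E v $$ (i,j)) holomorphic_on U" by (simp cong: holomorphic_cong)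
    then show ?thesis using U holomorphic_on_imp_differentiable_at by blast
  qed
  define X where "X v i j = (if i = j then [:0,1:] else 0) + [:- E v $$ (i,j):]" for v i j
  have hX: "hfam p c (\<lambda>v. X v i j)" if "i < n" "j < n" for i j
    unfolding hfam_def X_def tcoeff_add using hE[OF that]
    by (intro allI field_differentiable_add, simp)
      (rename_tac k, case_tac "k = 0", auto simp: tcoeff_const field_differentiable_minus)
  have Xeq: "char_poly_matrix (E v) $$ (i,j) = X v i j" if "v \<in> U" "i < n" "j < n" for v i j
    using Ec[OF that(1)] that by (auto simp: char_poly_matrix_def X_def)
  define I where "I s = {i. i < n \<and> fst (xs ! i) = c \<and> fst (snd (xs ! i)) = s}" for s
  define R where "R = {i. i < n \<and> fst (xs ! i) \<noteq> c}"
  \<comment> \<open>\<open>R\<close> holds the rows of the other eigenvalues. They contribute only a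
    factor with differentiable coefficients.\<close>
  have split: "(\<Prod>i = 0..<n. g i) = (\<Prod>i\<in>R. g i) * (\<Prod>s<N. \<Prod>i\<in>I s. g i)" for g :: "nat \<Rightarrow> complex poly"
  proof -
    have "{0..<n} = R \<union> (\<Union>s<N. I s)"
    proof -
      have "fst (snd (xs ! i)) < N" if "i < n" "fst (xs ! i) = c" for i
      proof -
        have "xs ! i \<in> layers c b" unfolding lay[symmetric] using that len by auto
        then show ?thesis using bN by (force simp: layers_def not_less[symmetric])
      qed
      then show ?thesis by (auto simp: R_def I_def)
    qed
    then have "(\<Prod>i = 0..<n. g i) = (\<Prod>i\<in>R. g i) * (\<Prod>i\<in>(\<Union>s<N. I s). g i)"
      by (simp only:) (rule prod.union_disjoint, auto simp: R_def I_def)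
    also have "(\<Prod>i\<in>(\<Union>s<N. I s). g i) = (\<Prod>s<N. \<Prod>i\<in>I s. g i)"
      by (rule prod.UNION_disjoint) (auto simp: I_def)
    finally show ?thesis .
  qed
  have "vfam b p c {..<N} (\<lambda>v. \<Sum>\<sigma>\<in>{\<sigma>. \<sigma> permutes {0..<n}}. 
    (signof \<sigma> * (\<Prod>i\<in>R. X v i (\<sigma> i))) * (\<Prod>s<N. \<Prod>i\<in>I s. X v i (\<sigma> i)))"
  proof (rule vfam_sum)
    fix \<sigma> assume "\<sigma> \<in> {\<sigma>. \<sigma> permutes {0..<n}}"
    then have \<sigma>: "\<sigma> permutes {0..<n}" by simp
    have sn: "\<sigma> i < n" if "i < n" for i using permutes_in_image[OF \<sigma>, of i] that by auto
    show "vfam b p c {..<N} (\<lambda>v. (signof \<sigma> * (\<Prod>i\<in>R. X v i (\<sigma> i))) * (\<Prod>s<N. \<Prod>i\<in>I s. X v i (\<sigma> i)))"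
    proof (rule vfam_prod)
      show "hfam p c (\<lambda>v. signof \<sigma> * (\<Prod>i\<in>R. X v i (\<sigma> i)))"
        by (intro hfam_mult hfam_const hfam_prod hX) (auto simp: R_def sn)
      show "hfam p c (\<lambda>v. \<Prod>i\<in>I s. X v i (\<sigma> i))" for s
        by (intro hfam_prod hX) (auto simp: I_def sn)
      fix s k assume "s \<in> {..<N}" "k < b s"
      have "(\<Prod>i\<in>I s. X p i (\<sigma> i)) = (\<Prod>i\<in>I s. char_poly_matrix (jmat xs) $$ (i, \<sigma> i))"
        using Xeq[OF U(2)] sn by (intro prod.cong) (auto simp: I_def Ep)
      then show "tcoeff (\<Prod>i\<in>I s. X p i (\<sigma> i)) c k = 0"
        using block_product_at_jmat[OF dist len[symmetric] \<sigma> lay \<open>k < b s\<close>] by (simp add: I_def)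
    qed simp
  qed
  then have main: "(\<lambda>v. tcoeff (\<Sum>\<sigma>\<in>{\<sigma>. \<sigma> permutes {0..<n}}. 
    (signof \<sigma> * (\<Prod>i\<in>R. X v i (\<sigma> i))) * (\<Prod>s<N. \<Prod>i\<in>I s. X v i (\<sigma> i))) c k) \<in> O[at p](\<lambda>v. (v - p) ^ e)"
    using e by (auto simp: vfam_def)
  have "char_poly (F v) = (\<Sum>\<sigma>\<in>{\<sigma>. \<sigma> permutes {0..<n}}. 
    (signof \<sigma> * (\<Prod>i\<in>R. X v i (\<sigma> i))) * (\<Prod>s<N. \<Prod>i\<in>I s. X v i (\<sigma> i)))" if v: "v \<in> U" for v
  proof -
    have "char_poly (F v) = (\<Sum>\<sigma>\<in>{\<sigma>. \<sigma> permutes {0..<n}}. signof \<sigma> * (\<Prod>i = 0..<n. X v i (\<sigma> i)))"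
      unfolding cp[OF v] unfolding char_poly_def
      by (subst det_def'[OF char_poly_matrix_closed[OF Ec[OF v]]], intro sum.cong refl arg_cong2[of _ _ _ _ "(*)"]
         prod.cong Xeq v) (auto simp: permutes_in_image)
    then show ?thesis unfolding split by (simp add: mult.assoc)
  qed
  moreover have "\<forall>\<^sub>F v in at p. v \<in> U" using U by (rule eventually_at_in_open')
  ultimately show ?thesis
    by (intro landau_o.big.in_cong[THEN iffD2, OF _ main]) (auto elim: eventually_mono)
qed

section \<open>Necessity of the order condition\<close>

lemma coeff_chi_pt:
  "coeff (chi_pt n x) k = (if k = n then 1 else if k < n then (-1) ^ (n - k) * x (n - k) else 0)"
proof -
  have "(\<Sum>j=1..n. coeff (monom ((-1)^j * x j) (n - j)) k) =
    (\<Sum>j=1..n. if j = n - k \<and> k < n then (-1) ^ j * x j else 0)"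
    by (intro sum.cong) auto
  also have "\<dots> = (if k < n then (-1) ^ (n - k) * x (n - k) else 0)"
    by (cases "k < n") auto
  finally show ?thesis by (simp add: chi_pt_def coeff_sum)
qed

lemma chi_pt_piA:
  assumes A: "A \<in> carrier_mat n n"
  shows "chi_pt n (piA n A) = char_poly A"
proof (rule poly_eqI)
  fix k
  from degree_monic_char_poly[OF A] have d: "degree (char_poly A) = n" "coeff (char_poly A) n = 1" by auto
  show "coeff (chi_pt n (piA n A)) k = coeff (char_poly A) k"
    using d coeff_eq_0[of "char_poly A" k]
    by (auto simp: coeff_chi_pt piA_def simp flip: mult.assoc power_add)
qed

lemma chi_pt_piA_inj:
  assumes A: "A \<in> carrier_mat n n" and x: "\<And>j. j \<notin> {1..n} \<Longrightarrow> x j = 0" and eq: "char_poly A = chi_pt n x"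
  shows "piA n A = x"
proof
  fix j
  show "piA n A j = x j"
    using x[of j] by (auto simp: piA_def eq coeff_chi_pt simp flip: mult.assoc power_add)
qed

text \<open>Vieta's formulas: the product is expanded over the sets of factors that contribute their
  constant term.\<close>

lemma chi_pt_symm_polydisc:
  assumes "x \<in> symm_polydisc n"
  obtains z where "\<And>i. i < n \<Longrightarrow> norm (z i) < 1" "chi_pt n x = (\<Prod>i\<in>{0..<n}. [:- z i, 1:])"
proof -
  from assms obtain z where z: "\<And>i. i < n \<Longrightarrow> norm (z i) < 1"
    and x: "x = (\<lambda>j. if j \<in> {1..n} then esym n j z else 0)" by (auto simp: symm_polydisc_def)
  have "(\<Prod>i\<in>{0..<n}. [:- z i, 1:]) = (\<Prod>i\<in>{0..<n}. [:- z i:] + [:0, 1:])" by simp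
  also have "\<dots> = (\<Sum>S\<in>Pow {0..<n}. (\<Prod>i\<in>S. [:- z i:]) * (\<Prod>i\<in>{0..<n} - S. [:0, 1:]))"
    by (rule prod_add) simp
  also have "\<dots> = (\<Sum>S\<in>Pow {0..<n}. monom ((-1) ^ card S * (\<Prod>i\<in>S. z i)) (n - card S))"
  proof (rule sum.cong)
    fix S assume S: "S \<in> Pow {0..<n}"
    have "(\<Prod>i\<in>S. [:- z i:]) = [:\<Prod>i\<in>S. - z i:]"
      by (induction S rule: infinite_finite_induct) (auto simp: one_pCons)
    moreover have "(\<Prod>i\<in>S. - z i) = (-1) ^ card S * (\<Prod>i\<in>S. z i)"
      using prod.distrib[of "\<lambda>_. -1" z S] by simp
    moreover have "card ({0..<n} - S) = n - card S" using S card_Diff_subset[of S "{0..<n}"] finite_subset by fastforce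
    ultimately show "(\<Prod>i\<in>S. [:- z i:]) * (\<Prod>i\<in>{0..<n} - S. [:0, 1:]) =
       monom ((-1) ^ card S * (\<Prod>i\<in>S. z i)) (n - card S)"
      by (simp add: monom_altdef)
  qed simp
  finally have prod_eq: "(\<Prod>i\<in>{0..<n}. [:- z i, 1:]) =
    (\<Sum>S\<in>Pow {0..<n}. monom ((-1) ^ card S * (\<Prod>i\<in>S. z i)) (n - card S))" .
  have "chi_pt n x = (\<Prod>i\<in>{0..<n}. [:- z i, 1:])"
  proof (rule poly_eqI)
    fix k
    have "coeff (\<Prod>i\<in>{0..<n}. [:- z i, 1:]) k =
      (\<Sum>S\<in>Pow {0..<n}. if n - card S = k then (-1) ^ card S * (\<Prod>i\<in>S. z i) else 0)"
      unfolding prod_eq coeff_sum by simp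
    also have "\<dots> = (\<Sum>S\<in>{S\<in>Pow {0..<n}. n - card S = k}. (-1) ^ card S * (\<Prod>i\<in>S. z i))"
      by (rule sum.inter_filter[symmetric]) simp
    also have "\<dots> = coeff (chi_pt n x) k"
    proof (cases "k \<le> n")
      case True
      have le: "card S \<le> n" if "S \<subseteq> {0..<n}" for S using card_mono[OF _ that] by simp
      have "{S\<in>Pow {0..<n}. n - card S = k} = {S. S \<subseteq> {0..<n} \<and> card S = n - k}"
        using True le by fastforce
      then have "(\<Sum>S\<in>{S\<in>Pow {0..<n}. n - card S = k}. (-1) ^ card S * (\<Prod>i\<in>S. z i))
        = (-1) ^ (n - k) * esym n (n - k) z"
        by (simp add: esym_def sum_distrib_left)
      \<comment> \<open>Needed for \<open>k = n\<close>: the coordinate \<open>x 0\<close> is 0 by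
        convention, and the leading coefficient 1 of \<open>chi_pt\<close> corresponds to the empty
        set.\<close>
      moreover have "esym n 0 z = 1"
      proof -
        have "{S. S \<subseteq> {0..<n} \<and> card S = 0} = {{}}" using finite_subset by fastforce
        then show ?thesis by (simp add: esym_def)
      qed
      ultimately show ?thesis using True by (auto simp: coeff_chi_pt x)
    next
      case False
      then have empty: "{S\<in>Pow {0..<n}. n - card S = k} = {}" by auto
      show ?thesis unfolding empty using False by (simp add: coeff_chi_pt)
    qed
    finally show "coeff (chi_pt n x) k = coeff (\<Prod>i\<in>{0..<n}. [:- z i, 1:]) k" by simp
  qed
  with z show ?thesis using that by blast
qed

text \<open>The spectral radius is attained at an eigenvalue, and the eigenvalues are among the
  roots \<open>z i\<close>. Hence a lift of a map into the symmetrized polydisc takes its values in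
  the spectral ball automatically.\<close>

lemma spectral_ballI:
  assumes A: "A \<in> carrier_mat n n" and n: "n > 0" and pi: "piA n A \<in> symm_polydisc n"
  shows "A \<in> spectral_ball n"
proof -
  obtain z where z: "\<And>i. i < n \<Longrightarrow> norm (z i) < 1"
    and chi: "chi_pt n (piA n A) = (\<Prod>i\<in>{0..<n}. [:- z i, 1:])"
    using chi_pt_symm_polydisc[OF pi] by metis
  obtain c where c: "c \<in> spectrum A" "spectral_radius A = norm c"
    using spectral_radius_mem_max(1)[OF A n] by auto
  then have "poly (char_poly A) c = 0" by (simp add: spectrum_root_char_poly[OF A])
  then have "\<exists>i<n. z i = c" using chi by (auto simp: chi_pt_piA[OF A] poly_prod)
  then show ?thesis using z c A by (auto simp: spectral_ball_def)
qed

text \<open>Each block is brought to Jordan form separately, which is what \<open>d_ell\<close> of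
  that block sees. Since the eigenvalues are distinct, the label sets are disjoint and not linked by
  \<open>nxt\<close>, so any listing of their union is a Jordan form of \<open>M\<close>.\<close>

lemma block_decomp_labels:
  assumes bd: "block_decomp M lams Bs ns"
  obtains b :: "nat \<Rightarrow> nat \<Rightarrow> nat" and N :: "nat \<Rightarrow> nat" and xss :: "nat \<Rightarrow> label list"
  where "\<And>j. j < length Bs \<Longrightarrow> antimono (b j)" "\<And>j s. j < length Bs \<Longrightarrow> s \<ge> N j \<Longrightarrow> b j s = 0"
    "\<And>j. j < length Bs \<Longrightarrow> distinct (xss j)" "\<And>j. j < length Bs \<Longrightarrow> set (xss j) = layers (lams ! j) (b j)"
    "\<And>j. j < length Bs \<Longrightarrow> similar_mat (Bs ! j) (jmat (xss j))"
    "\<And>xs. distinct xs \<Longrightarrow> set xs = (\<Union>j<length Bs. layers (lams ! j) (b j)) \<Longrightarrow> similar_mat M (jmat xs)"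
proof -
  have len: "length lams = length Bs" and dl: "distinct lams"
    and B: "\<And>j. j < length Bs \<Longrightarrow> Bs ! j \<in> carrier_mat (ns ! j) (ns ! j)"
    and sp: "\<And>j. j < length Bs \<Longrightarrow> spectrum (Bs ! j) = {lams ! j}"
    and sim: "similar_mat M (diag_block_mat Bs)" using bd by (auto simp: block_decomp_def)
  have "\<exists>t. j < length Bs \<longrightarrow> (antimono (fst t) \<and> (\<forall>s\<ge>fst (snd t). fst t s = 0) \<and> distinct (snd (snd t)) \<and>
     set (snd (snd t)) = layers (lams ! j) (fst t) \<and> similar_mat (Bs ! j) (jmat (snd (snd t))))" for j
  proof (cases "j < length Bs")
    case True
    obtain b N where b: "antimono b" "\<And>s. s \<ge> N \<Longrightarrow> b s = 0"
      "\<And>xs. distinct xs \<Longrightarrow> set xs = layers (lams ! j) b \<Longrightarrow> similar_mat (Bs ! j) (jmat xs)"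
      using jordan_layers[OF B[OF True], of "lams ! j"] sp[OF True] by blast
    have "finite (layers (lams ! j) b)" using b(2) by (rule finite_layers)
    then obtain xs where "set xs = layers (lams ! j) b" "distinct xs"
      using finite_distinct_list by blast
    then show ?thesis using b by (intro exI[of _ "(b, N, xs)"]) auto
  qed auto
  then obtain t where t: "\<And>j. j < length Bs \<Longrightarrow> antimono (fst (t j)) \<and> (\<forall>s\<ge>fst (snd (t j)). fst (t j) s = 0) \<and> distinct (snd (snd (t j))) \<and>
     set (snd (snd (t j))) = layers (lams ! j) (fst (t j)) \<and> similar_mat (Bs ! j) (jmat (snd (snd (t j))))"
    by metis
  define b where "b j = fst (t j)" for j
  define xss where "xss j = snd (snd (t j))" for j
  have xd: "distinct (xss j)" "set (xss j) = layers (lams ! j) (b j)" "similar_mat (Bs ! j) (jmat (xss j))"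
    if "j < length Bs" for j using t[OF that] by (auto simp: b_def xss_def)
  have ne: "lams ! i \<noteq> lams ! j" if "i < length Bs" "j < length Bs" "i \<noteq> j" for i j
    using that dl len by (simp add: nth_eq_iff_index_eq)
  show ?thesis
  proof (rule that)
    fix j assume j: "j < length Bs"
    show "antimono (b j)" "\<And>s. s \<ge> fst (snd (t j)) \<Longrightarrow> b j s = 0" using t[OF j] by (auto simp: b_def)
    show "distinct (xss j)" "set (xss j) = layers (lams ! j) (b j)" "similar_mat (Bs ! j) (jmat (xss j))"
      by (fact xd[OF j])+
  next
    fix xs assume xs: "distinct xs" "set xs = (\<Union>j<length Bs. layers (lams ! j) (b j))"
    define Ms where "Ms = map (\<lambda>j. (Bs ! j, jmat (xss j))) [0..<length Bs]"
    have "similar_mat (diag_block_mat (map fst Ms)) (diag_block_mat (map snd Ms))"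
      by (rule similar_diag_mat_block_mat) (use xd in \<open>auto simp: Ms_def\<close>)
    moreover have "map fst Ms = Bs"
      by (rule nth_equalityI) (auto simp: Ms_def)
    moreover have "map snd Ms = map (\<lambda>j. jmat (xss j)) [0..<length Bs]" by (simp add: Ms_def)
    moreover have "diag_block_mat (map (\<lambda>j. jmat (xss j)) [0..<length Bs]) = jmat (concat (map xss [0..<length Bs]))"
    proof (rule diag_block_jmat)
      fix i j x y assume "i \<in> set [0..<length Bs]" "j \<in> set [0..<length Bs]" "i \<noteq> j" "x \<in> set (xss i)" "y \<in> set (xss j)"
      then show "x \<noteq> nxt y" using ne[of i j] xd(2) by (auto simp: layers_def nxt_def)
    qed simp
    ultimately have "similar_mat (diag_block_mat Bs) (jmat (concat (map xss [0..<length Bs])))" by simp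
    moreover have "mset (concat (map xss [0..<length Bs])) = mset xs"
    proof -
      have "distinct (concat (map xss js))" if "distinct js" "set js \<subseteq> {..<length Bs}" for js
        using that
      proof (induction js)
        case (Cons j js)
        have "set (xss j) \<inter> set (concat (map xss js)) = {}"
        proof -
          have "set (xss j) \<inter> set (xss i) = {}" if "i \<in> set js" for i
          proof -
            have "i \<noteq> j" "i < length Bs" "j < length Bs" using Cons.prems that by auto
            then show ?thesis using ne[of i j] xd(2) by (auto simp: layers_def)
          qed
          then show ?thesis by auto
        qed
        then show ?case using Cons xd by auto
      qed simp
      from this[of "[0..<length Bs]"] have "distinct (concat (map xss [0..<length Bs]))"
        by (simp only: set_upt atLeast0LessThan distinct_upt)
      moreover have "set (concat (map xss [0..<length Bs])) = set xs"
        using xd(2) by (auto simp: xs(2) atLeast0LessThan)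
      ultimately show ?thesis using xs(1) set_eq_iff_mset_eq_distinct by blast
    qed
    ultimately show "similar_mat M (jmat xs)"
      using sim similar_jmat_mset similar_mat_trans by blast
  qed
qed

lemma cond_iii_altdef:
  "cond_iii n f p M \<longleftrightarrow> (\<forall>lams Bs ns. block_decomp M lams Bs ns \<longrightarrow> (\<forall>j<length Bs. \<forall>k<ns ! j.
     (\<lambda>v. tcoeff (chi_pt n (f v)) (lams ! j) k) \<in> O[at p](\<lambda>v. (v - p) ^ d_ell (ns ! j) (Bs ! j) (ns ! j - k))))"
  by (simp add: cond_iii_def block_decomp_def poly_higher_pderiv_tcoeff)

theorem local_lift_imp_cond_iii:
  assumes U: "open U" "p \<in> U" and F: "holo_mat n F U" and pi: "\<And>z. z \<in> U \<Longrightarrow> piA n (F z) = f z"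
  shows "cond_iii n f p (F p)"
  unfolding cond_iii_altdef
proof (intro allI impI)
  fix lams Bs ns j k
  assume bd: "block_decomp (F p) lams Bs ns" and j: "j < length Bs" and k: "k < ns ! j"
  obtain b N xss where b: "\<And>j. j < length Bs \<Longrightarrow> antimono (b j)" "\<And>j s. j < length Bs \<Longrightarrow> s \<ge> N j \<Longrightarrow> b j s = 0"
    and xss: "\<And>j. j < length Bs \<Longrightarrow> distinct (xss j)" "\<And>j. j < length Bs \<Longrightarrow> set (xss j) = layers (lams ! j) (b j)"
    "\<And>j. j < length Bs \<Longrightarrow> similar_mat (Bs ! j) (jmat (xss j))"
    and M: "\<And>xs. distinct xs \<Longrightarrow> set xs = (\<Union>j<length Bs. layers (lams ! j) (b j)) \<Longrightarrow> similar_mat (F p) (jmat xs)"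
    by (rule block_decomp_labels[OF bd]) (rule that)
  have Bj: "Bs ! j \<in> carrier_mat (ns ! j) (ns ! j)" using bd j by (simp add: block_decomp_def)
  obtain P Q where wit: "similar_mat_wit (Bs ! j) (jmat (xss j)) P Q" using xss(3)[OF j] by (auto simp: similar_mat_def)
  interpret jordan_coords "Bs ! j" "ns ! j" "lams ! j" "b j" "N j" "xss j" P Q
    by unfold_locales (use Bj b[OF j] xss[OF j] wit in auto)
  have "finite (\<Union>j<length Bs. layers (lams ! j) (b j))"
  proof (rule finite_UN_I)
    fix i assume "i \<in> {..<length Bs}"
    then show "finite (layers (lams ! i) (b i))" using b(2)[of i] by (intro finite_layers[of "N i"]) auto
  qed simp
  then obtain xs where xs: "set xs = (\<Union>j<length Bs. layers (lams ! j) (b j))" "distinct xs"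
    using finite_distinct_list by blast
  then obtain P' Q' where wit': "similar_mat_wit (F p) (jmat xs) P' Q'"
    using M[OF xs(2,1)] unfolding similar_mat_def by blast
  have lay: "{x \<in> set xs. fst x = lams ! j} = layers (lams ! j) (b j)"
  proof -
    have "i = j" if "i < length Bs" "lams ! i = lams ! j" for i
      using that j bd by (auto simp: block_decomp_def nth_eq_iff_index_eq)
    note 1 = this
    show ?thesis
    proof (intro equalityI subsetI)
      fix x assume "x \<in> {x \<in> set xs. fst x = lams ! j}"
      then obtain i where "i < length Bs" "x \<in> layers (lams ! i) (b i)" "fst x = lams ! j" by (auto simp: xs)
      moreover from this have "i = j" by (intro 1) (auto simp: layers_def)
      ultimately show "x \<in> layers (lams ! j) (b j)" by simp
    qed (use j in \<open>auto simp: xs layers_def\<close>)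
  qed
  have main: "(\<lambda>v. tcoeff (char_poly (F v)) (lams ! j) k) \<in> O[at p](\<lambda>v. (v - p) ^ d_ell (ns ! j) (Bs ! j) (ns ! j - k))"
  proof (rule char_poly_family_order[OF U F wit' xs(2) lay b(2)[OF j]])
    fix T assume T: "T \<subseteq> {..<N j}" "sum (b j) ({..<N j} - T) \<le> k"
    \<comment> \<open>If the blocks outside \<open>T\<close> have total size at most
      \<open>k\<close>, those in \<open>T\<close> have total size at least
      \<open>ns ! j - k\<close>, so \<open>T\<close> competes in the minimum defining
      \<open>d_ell\<close>.\<close>
    have "ns ! j = sum (b j) ({..<N j} - T) + sum (b j) T"
      using r_sum T(1) sum.subset_diff[of T "{..<N j}" "b j"] by simp
    then have "ns ! j - k \<le> sum (b j) T" using T(2) by simp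
    then show "d_ell (ns ! j) (Bs ! j) (ns ! j - k) \<le> card T"
      using d_ell_le[of T] T(1) finite_subset by blast
  qed
  have "\<forall>\<^sub>F v in at p. chi_pt n (f v) = char_poly (F v)"
  proof -
    have "\<forall>\<^sub>F v in at p. v \<in> U" using U by (rule eventually_at_in_open')
    then show ?thesis
    proof eventually_elim
      case (elim v)
      then have "F v \<in> carrier_mat n n" using F by (simp add: holo_mat_def)
      from chi_pt_piA[OF this] show ?case using pi[OF elim] by simp
    qed
  qed
  then have "\<forall>\<^sub>F v in at p. tcoeff (chi_pt n (f v)) (lams ! j) k = tcoeff (char_poly (F v)) (lams ! j) k"
    by eventually_elim simp
  from landau_o.big.in_cong[OF this] main show "(\<lambda>v. tcoeff (chi_pt n (f v)) (lams ! j) k)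
      \<in> O[at p](\<lambda>v. (v - p) ^ d_ell (ns ! j) (Bs ! j) (ns ! j - k))"
    by (rule iffD2)
qed

section \<open>Bidiagonal matrices and Newton expansions\<close>

text \<open>The inverse is written through the adjugate so that it depends holomorphically on the
  matrix.\<close>

lemma det_nonzero_inverse:
  assumes "(P :: complex mat) \<in> carrier_mat n n" "det P \<noteq> 0"
  defines "Q \<equiv> (1 / det P) \<cdot>\<^sub>m adj_mat P"
  shows "Q \<in> carrier_mat n n" "P * Q = 1\<^sub>m n" "Q * P = 1\<^sub>m n"
proof -
  have adj: "adj_mat P \<in> carrier_mat n n" using adj_mat(1)[OF assms(1)] .
  show Q: "Q \<in> carrier_mat n n" using adj by (simp add: Q_def)
  have "P * Q = (1 / det P) \<cdot>\<^sub>m (P * adj_mat P)"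
    unfolding Q_def by (rule mult_smult_distrib[OF assms(1) adj])
  then show "P * Q = 1\<^sub>m n" using adj_mat(2)[OF assms(1)] assms(2) by (auto intro!: eq_matI)
  then show "Q * P = 1\<^sub>m n" using mat_mult_left_right_inverse[OF assms(1) Q] by simp
qed

text \<open>\<open>m c\<close> is the multiplicity of the root \<open>c\<close>; the remaining
  factor does not vanish there.\<close>

lemma tcoeff_prod_linear:
  fixes l :: "'b \<Rightarrow> complex"
  assumes "finite I"
  defines "m \<equiv> \<lambda>c. card {i \<in> I. l i = c}"
  shows "k < m c \<Longrightarrow> tcoeff (\<Prod>i\<in>I. [:- l i, 1:]) c k = 0"
    and "tcoeff (\<Prod>i\<in>I. [:- l i, 1:]) c (m c) \<noteq> 0"
proof -
  define r where "r = (\<Prod>i\<in>{i\<in>I. l i \<noteq> c}. [:- l i, 1:])"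
  have "I = {i\<in>I. l i = c} \<union> {i\<in>I. l i \<noteq> c}" by auto
  then have "(\<Prod>i\<in>I. [:- l i, 1:]) = (\<Prod>i\<in>{i\<in>I. l i = c}. [:- l i, 1:]) * r"
    unfolding r_def using assms(1) by (subst prod.union_disjoint[symmetric]) auto
  also have "(\<Prod>i\<in>{i\<in>I. l i = c}. [:- l i, 1:]) = (\<Prod>i\<in>{i\<in>I. l i = c}. [:- c, 1:])"
    by (intro prod.cong) auto
  finally have eq: "(\<Prod>i\<in>I. [:- l i, 1:]) = [:-c, 1:] ^ m c * r" by (simp add: m_def)
  have tc: "tcoeff (\<Prod>i\<in>I. [:- l i, 1:]) c k = (if m c \<le> k then tcoeff r c (k - m c) else 0)" for k
  proof -
    have "tcoeff (\<Prod>i\<in>I. [:- l i, 1:]) c k = (\<Sum>i\<le>k. if i = m c then tcoeff r c (k - i) else 0)"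
      unfolding eq tcoeff_mult tcoeff_linear_power by (intro sum.cong) auto
    then show ?thesis by simp
  qed
  show "k < m c \<Longrightarrow> tcoeff (\<Prod>i\<in>I. [:- l i, 1:]) c k = 0" by (simp add: tc)
  have "tcoeff r c 0 = poly r c" by (simp add: tcoeff_def coeff_pcompose_0)
  also have "\<dots> \<noteq> 0" using assms(1) by (auto simp: r_def poly_prod)
  finally show "tcoeff (\<Prod>i\<in>I. [:- l i, 1:]) c (m c) \<noteq> 0" by (simp add: tc)
qed

definition bidiag :: "nat \<Rightarrow> (nat \<Rightarrow> complex) \<Rightarrow> (nat \<Rightarrow> complex) \<Rightarrow> complex mat" where
  "bidiag n d s = mat n n (\<lambda>(i,j). if i = j then d i else if i = Suc j then s j else 0)"

text \<open>The arrangement used at a node: higher chain numbers first, so each layer is an interval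
  of indices. Inside a layer every chain is complete and runs upwards, but chains of different
  eigenvalues may be interleaved.\<close>

locale layered =
  fixes xs :: "label list" and n :: nat
  assumes len: "length xs = n" and dist: "distinct xs"
    and closed: "\<And>c s k k'. (c,s,k) \<in> set xs \<Longrightarrow> k' < k \<Longrightarrow> (c,s,k') \<in> set xs"
    and lay_mono: "\<And>i j. i \<le> j \<Longrightarrow> j < n \<Longrightarrow> fst (snd (xs ! j)) \<le> fst (snd (xs ! i))"
    and pos_mono: "\<And>i j. i < j \<Longrightarrow> j < n \<Longrightarrow> fst (xs ! i) = fst (xs ! j) \<Longrightarrow>
      fst (snd (xs ! i)) = fst (snd (xs ! j)) \<Longrightarrow> snd (snd (xs ! i)) < snd (snd (xs ! j))"
begin

definition "lam i = fst (xs ! i)"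
definition "ly i = fst (snd (xs ! i))"
definition "kp i = snd (snd (xs ! i))"

lemma xs_nth: "xs ! i = (lam i, ly i, kp i)"
  by (simp add: lam_def ly_def kp_def)

text \<open>\<open>closed\<close> supplies every smaller position of the chain and
  \<open>pos_mono\<close> places it earlier. The number obtained is the order of vanishing at
  \<open>lam t\<close> of the product of the preceding factors of the layer.\<close>

lemma card_earlier:
  assumes t: "t < n"
  shows "card {i. i < t \<and> ly i = ly t \<and> lam i = lam t} = kp t"
proof -
  have "bij_betw kp {i. i < t \<and> ly i = ly t \<and> lam i = lam t} {..<kp t}"
  proof (rule bij_betwI')
    fix i j assume ij: "i \<in> {i. i < t \<and> ly i = ly t \<and> lam i = lam t}" "j \<in> {i. i < t \<and> ly i = ly t \<and> lam i = lam t}"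
    have "i = j" if "kp i = kp j"
    proof -
      have "xs ! i = xs ! j" using ij that by (simp add: xs_nth)
      then show ?thesis using nth_eq_iff_index_eq[OF dist, of i j] ij t len by auto
    qed
    then show "(kp i = kp j) = (i = j)" by auto
  next
    fix i assume "i \<in> {i. i < t \<and> ly i = ly t \<and> lam i = lam t}"
    then show "kp i \<in> {..<kp t}" using pos_mono[of i t] t by (auto simp: ly_def lam_def kp_def)
  next
    fix k assume k: "k \<in> {..<kp t}"
    have "(lam t, ly t, kp t) \<in> set xs" using t len nth_mem[of t xs] by (simp add: xs_nth)
    then have "(lam t, ly t, k) \<in> set xs" by (rule closed) (use k in simp)
    then obtain i where i: "i < n" "xs ! i = (lam t, ly t, k)" using len by (auto simp: in_set_conv_nth)
    have il: "lam i = lam t" "ly i = ly t" "kp i = k"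
      using i(2) unfolding lam_def[of i] ly_def[of i] kp_def[of i] by simp_all
    have "i < t"
    proof (rule ccontr)
      assume "\<not> i < t"
      then consider "i = t" | "t < i" by linarith
      then show False
      proof cases
        case 2
        have "kp t < kp i"
          by (rule pos_mono[of t i, folded lam_def ly_def kp_def]) (use 2 i(1) il in simp_all)
        then show False using il k by simp
      qed (use il k in auto)
    qed
    then show "\<exists>i\<in>{i. i < t \<and> ly i = ly t \<and> lam i = lam t}. k = kp i" using il by auto
  qed
  then show ?thesis using bij_betw_same_card by fastforce
qed

definition "qp i = (\<Prod>j\<in>{j. j < i \<and> ly j = ly i}. [:- lam j, 1:])"

lemma card_before:
  assumes "t < i" "t < n"
  shows "kp t < card {j \<in> {j. j < i \<and> ly j = ly t}. lam j = lam t}"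
proof -
  have "insert t {j. j < t \<and> ly j = ly t \<and> lam j = lam t} \<subseteq> {j \<in> {j. j < i \<and> ly j = ly t}. lam j = lam t}"
    using assms by auto
  from card_mono[OF _ this] card_earlier[OF assms(2)] show ?thesis by simp
qed

text \<open>On a layer both matrices are multiplication by the variable modulo the product of all
  \<open>[:- lam j, 1:]\<close> of that layer: bidiagonal in the Newton basis \<open>qp\<close>, up
  to scaling, and Jordan in the Taylor coordinates at the eigenvalues. Column \<open>i\<close> of
  \<open>P\<close> lists the Taylor coordinates of the scaled basis element
  \<open>qp i\<close>.\<close>

lemma jmat_similar_bidiag:
  assumes s: "\<And>i. Suc i < n \<Longrightarrow> s i \<noteq> 0 \<longleftrightarrow> ly i = ly (Suc i)"
  shows "similar_mat (jmat xs) (bidiag n lam s)"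
proof -
  \<comment> \<open>The scaling turns subdiagonal entries 1 into \<open>s i\<close>. Where
    \<open>s k = 0\<close> the factor 1 keeps \<open>w\<close> nonzero.\<close>
  define w where "w i = (\<Prod>k<i. if s k = 0 then 1 else 1 / s k)" for i
  have w0: "w i \<noteq> 0" for i by (auto simp: w_def)
  define P where "P = mat n n (\<lambda>(t,i). if ly t = ly i then w i * tcoeff (qp i) (lam t) (kp t) else 0)"
  have Pc: "P \<in> carrier_mat n n" by (simp add: P_def)
  have Jc: "jmat xs \<in> carrier_mat n n" using len jmat_carrier[of xs] by simp
  have Lc: "bidiag n lam s \<in> carrier_mat n n" by (simp add: bidiag_def)
  have lower: "P $$ (t,i) = 0" if "t < i" "i < n" for t i
  proof -
    have "tcoeff (qp i) (lam t) (kp t) = 0" if "ly t = ly i"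
      unfolding qp_def by (rule tcoeff_prod_linear(1)) (use card_before[of t i] \<open>t < i\<close> \<open>i < n\<close> that in auto)
    then show ?thesis using that by (simp add: P_def)
  qed
  have diag: "P $$ (t,t) \<noteq> 0" if t: "t < n" for t
  proof -
    have "{j \<in> {j. j < t \<and> ly j = ly t}. lam j = lam t} = {i. i < t \<and> ly i = ly t \<and> lam i = lam t}" by auto
    then have "card {j \<in> {j. j < t \<and> ly j = ly t}. lam j = lam t} = kp t" using card_earlier[OF t] by simp
    then have "tcoeff (qp t) (lam t) (kp t) \<noteq> 0"
      unfolding qp_def using tcoeff_prod_linear(2)[of "{j. j < t \<and> ly j = ly t}" lam "lam t"] by simp
    then show ?thesis using t w0 by (simp add: P_def)
  qed
  have "det P = prod_list (diag_mat P)" by (rule det_lower_triangular[OF lower Pc])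
  moreover have "0 \<notin> set (diag_mat P)" using diag Pc by (auto simp: diag_mat_def)
  ultimately have detP: "det P \<noteq> 0" by (simp add: prod_list_zero_iff)
  have JP: "jmat xs * P = P * bidiag n lam s"
  proof (rule eq_matI)
    fix t i assume "t < dim_row (P * bidiag n lam s)" "i < dim_col (P * bidiag n lam s)"
    then have t: "t < n" and i: "i < n" using Pc Lc by auto
    define T where "T k = tcoeff (qp i) (lam t) k" for k
    have "(jmat xs * P) $$ (t,i) = (\<Sum>j<n. jmat xs $$ (t,j) * P $$ (j,i))"
      by (rule mat_mult_entry[OF Jc Pc t i])
    also have "\<dots> = (\<Sum>j<n. (if j = t then lam t * P $$ (t,i) else 0) +
        (if xs ! t = nxt (xs ! j) then P $$ (j,i) else 0))"
      using t len by (intro sum.cong) (auto simp: jmat_def nxt_def lam_def prod_eq_iff)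
    also have "\<dots> = lam t * P $$ (t,i) + (\<Sum>j<n. (if xs ! t = nxt (xs ! j) then P $$ (j,i) else 0))"
      using t by (simp add: sum.distrib)
    also have "(\<Sum>j<n. (if xs ! t = nxt (xs ! j) then P $$ (j,i) else 0)) =
        (if ly t = ly i then w i * (if kp t = 0 then 0 else T (kp t - 1)) else 0)"
    proof (cases "kp t")
      case 0
      then show ?thesis by (auto simp: xs_nth nxt_def)
    next
      case (Suc k)
      have "(lam t, ly t, kp t) \<in> set xs" using t len nth_mem[of t xs] by (simp add: xs_nth)
      then have "(lam t, ly t, k) \<in> set xs" by (rule closed) (simp add: Suc)
      then obtain j where j: "j < n" "xs ! j = (lam t, ly t, k)" using len by (auto simp: in_set_conv_nth)
      have "xs ! t = nxt (xs ! l) \<longleftrightarrow> l = j" if "l < n" for l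
        using that j Suc nth_eq_iff_index_eq[OF dist, of l j] len by (auto simp: nxt_def xs_nth[of t] prod_eq_iff)
      then have "(\<Sum>l<n. (if xs ! t = nxt (xs ! l) then P $$ (l,i) else 0)) = (\<Sum>l<n. (if l = j then P $$ (l,i) else 0))"
        by (intro sum.cong) auto
      also have "\<dots> = P $$ (j,i)" using j by simp
      also have "\<dots> = (if ly t = ly i then w i * T k else 0)"
        using j i by (simp add: P_def T_def lam_def ly_def kp_def)
      finally show ?thesis using Suc by simp
    qed
    finally have lhs: "(jmat xs * P) $$ (t,i) =
       (if ly t = ly i then w i * (lam t * T (kp t) + (if kp t = 0 then 0 else T (kp t - 1))) else 0)"
      using t i by (simp add: P_def T_def algebra_simps)
    have "(P * bidiag n lam s) $$ (t,i) = (\<Sum>j<n. P $$ (t,j) * bidiag n lam s $$ (j,i))"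
      by (rule mat_mult_entry[OF Pc Lc t i])
    also have "\<dots> = (\<Sum>j<n. (if j = i then P $$ (t,i) * lam i else 0) + (if j = Suc i then P $$ (t,Suc i) * s i else 0))"
      using i by (intro sum.cong) (auto simp: bidiag_def)
    also have "\<dots> = P $$ (t,i) * lam i + (if Suc i < n then P $$ (t,Suc i) * s i else 0)"
      using i by (simp add: sum.distrib)
    finally have rhs: "(P * bidiag n lam s) $$ (t,i) = P $$ (t,i) * lam i + (if Suc i < n then P $$ (t,Suc i) * s i else 0)" .
    have step: "tcoeff ([:- lam i, 1:] * qp i) (lam t) (kp t) =
        (lam t - lam i) * T (kp t) + (if kp t = 0 then 0 else T (kp t - 1))"
    proof -
      have "tcoeff ([:- lam i, 1:] * qp i) (lam t) (kp t) = (\<Sum>j\<le>kp t. (if j = 0 then (lam t - lam i) * T (kp t) else 0) 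
         + (if j = 1 then T (kp t - 1) else 0))"
        unfolding tcoeff_mult by (intro sum.cong) (auto simp: tcoeff_linear T_def)
      then show ?thesis by (simp add: sum.distrib)
    qed
    show "(jmat xs * P) $$ (t,i) = (P * bidiag n lam s) $$ (t,i)"
    proof (cases "Suc i < n \<and> ly i = ly (Suc i)")
      case True
      then have si: "s i \<noteq> 0" using s by blast
      have "{j. j < Suc i \<and> ly j = ly (Suc i)} = insert i {j. j < i \<and> ly j = ly i}"
        using True by (auto simp: less_Suc_eq)
      then have "qp (Suc i) = [:- lam i, 1:] * qp i" by (simp add: qp_def)
      moreover have "w (Suc i) * s i = w i" using si by (simp add: w_def)
      ultimately have "P $$ (t, Suc i) * s i = (if ly t = ly i then w i * tcoeff ([:- lam i, 1:] * qp i) (lam t) (kp t) else 0)"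
        using True t by (auto simp: P_def mult.assoc mult.commute mult.left_commute)
      then show ?thesis unfolding lhs rhs step using True t i by (simp add: P_def T_def algebra_simps)
    next
      \<comment> \<open>Now \<open>i\<close> is the last index of its layer, and multiplying
        \<open>qp i\<close> by its linear factor gives the full product of the layer, which is zero
        in the quotient.\<close>
      case False
      have "(if Suc i < n then P $$ (t,Suc i) * s i else 0) = 0" using False s[of i] by auto
      moreover have "tcoeff ([:- lam i, 1:] * qp i) (lam t) (kp t) = 0" if l: "ly t = ly i"
      proof -
        have "t < Suc i"
        proof (rule ccontr)
          assume "\<not> t < Suc i"
          then have "Suc i \<le> t" by simp
          then have "ly (Suc i) = ly i" "Suc i < n"
            using lay_mono[of "Suc i" t] lay_mono[of i "Suc i"] t l by (auto simp: ly_def)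
          then show False using False by simp
        qed
        have "{j. j < Suc i \<and> ly j = ly i} = insert i {j. j < i \<and> ly j = ly i}" by (auto simp: less_Suc_eq)
        then have "[:- lam i, 1:] * qp i = (\<Prod>j\<in>{j. j < Suc i \<and> ly j = ly i}. [:- lam j, 1:])"
          by (simp add: qp_def)
        moreover have "tcoeff \<dots> (lam t) (kp t) = 0"
          by (rule tcoeff_prod_linear(1)) (use card_before[OF \<open>t < Suc i\<close> t] l in auto)
        ultimately show ?thesis by simp
      qed
      ultimately show ?thesis unfolding lhs rhs using t i step by (auto simp: P_def T_def algebra_simps)
    qed
  qed (use Pc Lc Jc in auto)
  define Q where "Q = (1 / det P) \<cdot>\<^sub>m adj_mat P"
  note Q = det_nonzero_inverse[OF Pc detP, folded Q_def]
  have "jmat xs = jmat xs * (P * Q)" using Q Jc right_mult_one_mat[OF Jc] by simp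
  also have "\<dots> = (jmat xs * P) * Q" using Pc Q(1) Jc by (simp add: assoc_mult_mat[of _ n n _ n _ n])
  finally have "jmat xs = P * bidiag n lam s * Q" by (simp add: JP)
  then show ?thesis using Pc Q Jc Lc by (intro similar_matI[of _ _ P Q n]) auto
qed

end

section \<open>Companion matrices of Newton expansions\<close>

definition hess :: "nat \<Rightarrow> (nat \<Rightarrow> 'a) \<Rightarrow> (nat \<Rightarrow> 'a) \<Rightarrow> (nat \<Rightarrow> 'a) \<Rightarrow> 'a :: comm_ring_1 mat" where
  "hess n d s g = mat n n (\<lambda>(i,j). (if i = j then d i else 0) + (if i = Suc j then - s j else 0)
      + (if Suc j = n then g i else 0))"

text \<open>Laplace expansion along the first row, which is supported in the first and the last
  column (they coincide for size one). The first minor has the same shape; the last is triangular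
  with diagonal entries \<open>- s k\<close>, and its sign cancels that of the cofactor.\<close>

lemma det_hess:
  "det (hess n d s g) = (\<Sum>i<n. g i * (\<Prod>k=i..<n - 1. s k) * (\<Prod>k<i. d k)) + (\<Prod>k<n. d k)"
proof (induction n arbitrary: d s g)
  case 0
  have "hess 0 d s g \<in> carrier_mat 0 0" by (simp add: hess_def)
  then show ?case by simp
next
  case (Suc m)
  have H: "hess (Suc m) d s g \<in> carrier_mat (Suc m) (Suc m)" by (simp add: hess_def)
  have c0: "cofactor (hess (Suc m) d s g) 0 0 = det (hess m (\<lambda>i. d (Suc i)) (\<lambda>i. s (Suc i)) (\<lambda>i. g (Suc i)))"
  proof -
    have "mat_delete (hess (Suc m) d s g) 0 0 = hess m (\<lambda>i. d (Suc i)) (\<lambda>i. s (Suc i)) (\<lambda>i. g (Suc i))"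
      by (rule eq_matI) (auto simp: mat_delete_def hess_def)
    then show ?thesis by (simp add: cofactor_def)
  qed
  have cm: "cofactor (hess (Suc m) d s g) 0 m = (\<Prod>k<m. s k)"
  proof -
    define D where "D = mat_delete (hess (Suc m) d s g) 0 m"
    have Dc: "D \<in> carrier_mat m m" by (simp add: D_def mat_delete_def hess_def)
    have Dij: "D $$ (i,j) = (if Suc i = j then d j else 0) + (if i = j then - s j else 0)" if "i < m" "j < m" for i j
      using that by (auto simp: D_def mat_delete_def hess_def)
    have "upper_triangular D" using Dc Dij by (auto simp: upper_triangular_def)
    then have "det D = prod_list (diag_mat D)" using Dc by (rule det_upper_triangular)
    also have "diag_mat D = map (\<lambda>j. - s j) [0..<m]"
      using Dc Dij by (intro nth_equalityI) (auto simp: diag_mat_def)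
    also have "prod_list (map (\<lambda>j. - s j) [0..<m]) = (\<Prod>k<m. - s k)"
      by (induction m) (simp_all add: mult.commute)
    also have "\<dots> = (-1) ^ m * (\<Prod>k<m. s k)" using prod.distrib[of "\<lambda>_. -1" s "{..<m}"] by simp
    finally show ?thesis by (simp add: cofactor_def D_def flip: mult.assoc power_add mult_2)
  qed
  have "det (hess (Suc m) d s g) = (\<Sum>j<Suc m. hess (Suc m) d s g $$ (0,j) * cofactor (hess (Suc m) d s g) 0 j)"
    by (rule laplace_expansion_row[OF H]) simp
  also have "\<dots> = (\<Sum>j<Suc m. (if j = 0 then d 0 * cofactor (hess (Suc m) d s g) 0 0 else 0) +
      (if j = m then g 0 * cofactor (hess (Suc m) d s g) 0 m else 0))"
    by (intro sum.cong) (auto simp: hess_def algebra_simps)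
  also have "\<dots> = d 0 * cofactor (hess (Suc m) d s g) 0 0 + g 0 * cofactor (hess (Suc m) d s g) 0 m"
    by (simp add: sum.distrib)
  also have "\<dots> = d 0 * ((\<Sum>i<m. g (Suc i) * (\<Prod>k=i..<m - 1. s (Suc k)) * (\<Prod>k<i. d (Suc k))) + (\<Prod>k<m. d (Suc k)))
      + g 0 * (\<Prod>k<m. s k)"
    unfolding c0 cm Suc ..
  also have "\<dots> = (\<Sum>i<Suc m. g i * (\<Prod>k=i..<Suc m - 1. s k) * (\<Prod>k<i. d k)) + (\<Prod>k<Suc m. d k)"
  proof -
    have "(\<Prod>k=i..<m - 1. s (Suc k)) = (\<Prod>k=Suc i..<m. s k)" if "i < m" for i
      using prod.shift_bounds_Suc_ivl[of s i "m - 1"] that by simp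
    then have "(\<Sum>i<m. g (Suc i) * (\<Prod>k=i..<m - 1. s (Suc k)) * (\<Prod>k<i. d (Suc k))) * d 0
      = (\<Sum>i<m. g (Suc i) * (\<Prod>k=Suc i..<m. s k) * (\<Prod>k<Suc i. d k))"
      unfolding sum_distrib_right
      by (intro sum.cong) (auto simp: prod.lessThan_Suc_shift mult_ac simp del: prod.lessThan_Suc)
    then show ?thesis
      by (simp add: sum.lessThan_Suc_shift prod.lessThan_Suc_shift atLeast0LessThan algebra_simps
         del: sum.lessThan_Suc prod.lessThan_Suc)
  qed
  finally show ?case .
qed

definition newton_companion :: "nat \<Rightarrow> (nat \<Rightarrow> complex) \<Rightarrow> (nat \<Rightarrow> complex) \<Rightarrow> (nat \<Rightarrow> complex) \<Rightarrow> complex mat" where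
  "newton_companion n d s g = mat n n (\<lambda>(i,j). (if i = j then d i else 0) + (if i = Suc j then s j else 0)
      - (if Suc j = n then g i else 0))"

text \<open>Only the product of \<open>g i\<close> with the subdiagonal entries from
  \<open>s i\<close> on enters the Newton coefficient. This is the freedom that allows powers to be
  moved between the last column and the subdiagonal.\<close>

lemma char_poly_newton_companion:
  "char_poly (newton_companion n d s g) =
    (\<Sum>i<n. [:g i * (\<Prod>k=i..<n - 1. s k):] * (\<Prod>k<i. [:- d k, 1:])) + (\<Prod>k<n. [:- d k, 1:])"
proof -
  have "char_poly_matrix (newton_companion n d s g) = hess n (\<lambda>i. [:- d i, 1:]) (\<lambda>i. [:s i:]) (\<lambda>i. [:g i:])"
    by (rule eq_matI) (auto simp: char_poly_matrix_def newton_companion_def hess_def)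
  moreover have "(\<Prod>k\<in>K. [:s k:]) = [:\<Prod>k\<in>K. s k:]" for K
    by (induction K rule: infinite_finite_induct) (auto simp: one_pCons)
  ultimately show ?thesis by (simp add: char_poly_def det_hess mult.commute)
qed

primrec ndiv :: "nat \<Rightarrow> (nat \<Rightarrow> complex) \<Rightarrow> complex poly \<Rightarrow> complex poly" where
  "ndiv 0 \<mu> p = p"
| "ndiv (Suc i) \<mu> p = synthetic_div (ndiv i \<mu> p) (\<mu> i)"

text \<open>The divided difference of \<open>p\<close> at the nodes \<open>\<mu> 0\<close>, ...,
  \<open>\<mu> i\<close>. Obtaining it by repeated synthetic division allows nodes to
  coincide.\<close>

definition ncoeff :: "nat \<Rightarrow> (nat \<Rightarrow> complex) \<Rightarrow> complex poly \<Rightarrow> complex" where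
  "ncoeff i \<mu> p = poly (ndiv i \<mu> p) (\<mu> i)"

lemma ndiv_step: "ndiv i \<mu> p = [:- \<mu> i, 1:] * ndiv (Suc i) \<mu> p + [:ncoeff i \<mu> p:]"
  using synthetic_div_correct'[of "\<mu> i" "ndiv i \<mu> p"] by (simp add: ncoeff_def)

lemma newton_expansion:
  "p = (\<Sum>i<n. [:ncoeff i \<mu> p:] * (\<Prod>k<i. [:- \<mu> k, 1:])) + (\<Prod>k<n. [:- \<mu> k, 1:]) * ndiv n \<mu> p"
proof (induction n)
  case (Suc n)
  have "(\<Prod>k<n. [:- \<mu> k, 1:]) * ndiv n \<mu> p = (\<Prod>k<Suc n. [:- \<mu> k, 1:]) * ndiv (Suc n) \<mu> p
     + [:ncoeff n \<mu> p:] * (\<Prod>k<n. [:- \<mu> k, 1:])"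
    by (subst ndiv_step) (simp only: prod.lessThan_Suc ring_distribs mult_ac)
  with Suc show ?case by (simp only: sum.lessThan_Suc) (simp only: add_ac)
qed simp

lemma coeff_synthetic_div: "coeff (synthetic_div p c) k = coeff p (Suc k) + c * coeff (synthetic_div p c) (Suc k)"
  using arg_cong[OF synthetic_div_correct[of p c], of "\<lambda>q. coeff q (Suc k)"] by simp

lemma ndiv_monic:
  assumes "degree p = n" "coeff p n = 1" "i \<le> n"
  shows "degree (ndiv i \<mu> p) = n - i \<and> coeff (ndiv i \<mu> p) (n - i) = 1"
  using assms(3)
proof (induction i)
  case (Suc i)
  then have IH: "degree (ndiv i \<mu> p) = Suc (n - Suc i)" "coeff (ndiv i \<mu> p) (Suc (n - Suc i)) = 1"
    by (auto simp: Suc_diff_Suc)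
  have "degree (ndiv (Suc i) \<mu> p) = n - Suc i" using IH by (simp add: degree_synthetic_div)
  moreover have "coeff (ndiv (Suc i) \<mu> p) (n - Suc i) = 1"
    using coeff_synthetic_div[of "ndiv i \<mu> p" "\<mu> i" "n - Suc i"] IH calculation
      coeff_eq_0[of "ndiv (Suc i) \<mu> p" "Suc (n - Suc i)"] by simp
  ultimately show ?case by simp
qed (use assms in simp)

lemma newton_expansion_monic:
  assumes "degree p = n" "coeff p n = 1"
  shows "p = (\<Sum>i<n. [:ncoeff i \<mu> p:] * (\<Prod>k<i. [:- \<mu> k, 1:])) + (\<Prod>k<n. [:- \<mu> k, 1:])"
proof -
  have "ndiv n \<mu> p = 1"
  proof -
    have "degree (ndiv n \<mu> p) = 0" "coeff (ndiv n \<mu> p) 0 = 1" using ndiv_monic[OF assms, of n \<mu>] by auto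
    then show ?thesis by (auto elim!: degree_eq_zeroE simp: one_pCons)
  qed
  then show ?thesis using newton_expansion[of p \<mu> n] by simp
qed

text \<open>Up to errors of order \<open>d\<close>, the nodes are the constants
  \<open>\<nu> j\<close> and \<open>q\<close> is divisible by the linear factors for
  \<open>\<nu> 0\<close>, ..., \<open>\<nu> i\<close>. Each division removes one of these roots, so
  the polynomial reached at stage \<open>i\<close> still has the root \<open>\<nu> i\<close>, and
  its value there is the Newton coefficient.\<close>

lemma newton_order:
  fixes q :: "complex \<Rightarrow> complex poly"
  assumes h: "\<And>j c. j \<le> Suc i \<Longrightarrow> hfam p c (\<lambda>v. ndiv j (\<mu> v) (q v))"
    and mu: "\<And>j. j \<le> i \<Longrightarrow> (\<lambda>v. \<mu> v j - \<nu> j) \<in> O[at p](\<lambda>v. (v - p) ^ d)"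
    and tc: "\<And>c k. k < card {j. j \<le> i \<and> \<nu> j = c} \<Longrightarrow> (\<lambda>v. tcoeff (q v) c k) \<in> O[at p](\<lambda>v. (v - p) ^ d)"
  shows "(\<lambda>v. ncoeff i (\<mu> v) (q v)) \<in> O[at p](\<lambda>v. (v - p) ^ d)"
proof -
  define K where "K = O[at p](\<lambda>v. (v - p) ^ d)"
  have Kadd: "(\<lambda>v. g v + h v) \<in> K" if "g \<in> K" "h \<in> K" for g h using that by (auto simp: K_def intro: sum_in_bigo)
  have Kdiff: "(\<lambda>v. g v - h v) \<in> K" if "g \<in> K" "h \<in> K" for g h using that by (auto simp: K_def intro: sum_in_bigo)
  have Kcm: "(\<lambda>v. a * g v) \<in> K" if "g \<in> K" for g a using that by (auto simp: K_def)
  have Kmult: "(\<lambda>v. (\<mu> v j - \<nu> j) * tcoeff (ndiv l (\<mu> v) (q v)) c k) \<in> K" if "j \<le> i" "l \<le> Suc i" for j l c k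
  proof -
    have "(\<lambda>v. tcoeff (ndiv l (\<mu> v) (q v)) c k) \<in> O[at p](\<lambda>_. 1)"
      using h[OF that(2)] by (auto simp: hfam_def intro: field_differentiable_bigo_1)
    from landau_o.big.mult[OF mu[OF that(1)] this] show ?thesis by (simp add: K_def)
  qed
  \<comment> \<open>The division step read off in Taylor coefficients at \<open>c\<close>;
    everything below solves this relation for one of its terms.\<close>
  have rel: "tcoeff (ndiv j (\<mu> v) (q v)) c k = (c - \<mu> v j) * tcoeff (ndiv (Suc j) (\<mu> v) (q v)) c k
      + (if k = 0 then ncoeff j (\<mu> v) (q v) else tcoeff (ndiv (Suc j) (\<mu> v) (q v)) c (k - 1))" for j v c k
  proof -
    have "tcoeff ([:- \<mu> v j, 1:] * ndiv (Suc j) (\<mu> v) (q v)) c k =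
      (\<Sum>l\<le>k. (if l = 0 then (c - \<mu> v j) * tcoeff (ndiv (Suc j) (\<mu> v) (q v)) c k else 0)
         + (if l = 1 then tcoeff (ndiv (Suc j) (\<mu> v) (q v)) c (k - 1) else 0))"
      unfolding tcoeff_mult by (intro sum.cong) (auto simp: tcoeff_linear)
    also have "\<dots> = (c - \<mu> v j) * tcoeff (ndiv (Suc j) (\<mu> v) (q v)) c k + (if k = 0 then 0 else tcoeff (ndiv (Suc j) (\<mu> v) (q v)) c (k - 1))"
      by (simp add: sum.distrib)
    finally show ?thesis by (subst ndiv_step) (simp only: tcoeff_add, simp add: tcoeff_const del: ndiv.simps)
  qed
  have main: "(\<lambda>v. tcoeff (ndiv j (\<mu> v) (q v)) c k) \<in> K"
    if "j \<le> i" "k < card {l. j \<le> l \<and> l \<le> i \<and> \<nu> l = c}" for j c k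
    using that
  proof (induction j arbitrary: c k)
    case 0
    then show ?case using tc by (simp add: K_def)
  next
    case (Suc j)
    define t where "t c k = (\<lambda>v. tcoeff (ndiv (Suc j) (\<mu> v) (q v)) c k)" for c k
    have ji: "j \<le> i" using Suc.prems by simp
    note IH = Suc.IH[OF ji]
    have split: "{l. j \<le> l \<and> l \<le> i \<and> \<nu> l = c} = (if \<nu> j = c then insert j {l. Suc j \<le> l \<and> l \<le> i \<and> \<nu> l = c}
        else {l. Suc j \<le> l \<and> l \<le> i \<and> \<nu> l = c})" for c
      using ji by (auto simp: Suc_le_eq le_less)
    have cnt: "card {l. j \<le> l \<and> l \<le> i \<and> \<nu> l = c} = card {l. Suc j \<le> l \<and> l \<le> i \<and> \<nu> l = c} + (if \<nu> j = c then 1 else 0)" for c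
      unfolding split by auto
    \<comment> \<open>At \<open>c = \<nu> j\<close> and index 0 the relation shows that the
      remainder of the division is itself of order \<open>d\<close>.\<close>
    have nc: "(\<lambda>v. ncoeff j (\<mu> v) (q v)) \<in> K"
    proof -
      have "(\<lambda>v. tcoeff (ndiv j (\<mu> v) (q v)) (\<nu> j) 0) \<in> K" by (rule Suc.IH[OF ji]) (simp add: cnt)
      moreover have "(\<lambda>v. (\<mu> v j - \<nu> j) * t (\<nu> j) 0 v) \<in> K" unfolding t_def by (rule Kmult) (use Suc.prems in auto)
      ultimately have "(\<lambda>v. tcoeff (ndiv j (\<mu> v) (q v)) (\<nu> j) 0 + (\<mu> v j - \<nu> j) * t (\<nu> j) 0 v) \<in> K" by (rule Kadd)
      moreover have "(\<lambda>v. tcoeff (ndiv j (\<mu> v) (q v)) (\<nu> j) 0 + (\<mu> v j - \<nu> j) * t (\<nu> j) 0 v) = (\<lambda>v. ncoeff j (\<mu> v) (q v))"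
        unfolding t_def by (rule ext) (subst rel, simp add: algebra_simps del: ndiv.simps)
      ultimately show ?thesis by simp
    qed
    have small: "(\<lambda>v. (\<mu> v j - \<nu> j) * t c k v) \<in> K" for c k unfolding t_def by (rule Kmult) (use Suc.prems in auto)
    \<comment> \<open>At the removed root, coefficient \<open>k\<close> of the quotient is
      coefficient \<open>k + 1\<close> of the dividend up to a small term. At any other point one
      divides by the nonzero constant \<open>c - \<nu> j\<close> and proceeds by induction on
      \<open>k\<close>.\<close>
    have "t c k \<in> K" using Suc.prems(2)
    proof (cases "c = \<nu> j")
      case True
      have "(\<lambda>v. tcoeff (ndiv j (\<mu> v) (q v)) c (Suc k)) \<in> K"
        by (rule Suc.IH[OF ji]) (use Suc.prems(2) True cnt in simp)
      from Kadd[OF this small[of c "Suc k"]]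
      have "(\<lambda>v. tcoeff (ndiv j (\<mu> v) (q v)) c (Suc k) + (\<mu> v j - \<nu> j) * t c (Suc k) v) \<in> K" .
      moreover have "(\<lambda>v. tcoeff (ndiv j (\<mu> v) (q v)) c (Suc k) + (\<mu> v j - \<nu> j) * t c (Suc k) v) = t c k"
        unfolding t_def True by (rule ext) (subst rel, simp add: algebra_simps del: ndiv.simps)
      ultimately show ?thesis by simp
    next
      case False
      from Suc.prems(2) show ?thesis
      proof (induction k)
        case 0
        have "(\<lambda>v. tcoeff (ndiv j (\<mu> v) (q v)) c 0) \<in> K"
          by (rule Suc.IH[OF ji]) (use 0 cnt False in simp)
        from Kcm[OF Kadd[OF Kdiff[OF this nc] small[of c 0]], of "1 / (c - \<nu> j)"]
        have "(\<lambda>v. 1 / (c - \<nu> j) * (tcoeff (ndiv j (\<mu> v) (q v)) c 0 - ncoeff j (\<mu> v) (q v) + (\<mu> v j - \<nu> j) * t c 0 v)) \<in> K" .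
        moreover have "(\<lambda>v. 1 / (c - \<nu> j) * (tcoeff (ndiv j (\<mu> v) (q v)) c 0 - ncoeff j (\<mu> v) (q v) + (\<mu> v j - \<nu> j) * t c 0 v)) = t c 0"
          unfolding t_def using False by (intro ext) (subst rel, simp add: field_simps del: ndiv.simps)
        ultimately show ?case by simp
      next
        case (Suc k)
        have "(\<lambda>v. tcoeff (ndiv j (\<mu> v) (q v)) c (Suc k)) \<in> K"
          by (rule IH) (use Suc.prems cnt False in simp)
        moreover have "t c k \<in> K" using Suc by simp
        ultimately have "(\<lambda>v. 1 / (c - \<nu> j) * (tcoeff (ndiv j (\<mu> v) (q v)) c (Suc k) - t c k v + (\<mu> v j - \<nu> j) * t c (Suc k) v)) \<in> K"
          by (intro Kcm Kadd Kdiff small)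
        moreover have "(\<lambda>v. 1 / (c - \<nu> j) * (tcoeff (ndiv j (\<mu> v) (q v)) c (Suc k) - t c k v + (\<mu> v j - \<nu> j) * t c (Suc k) v)) = t c (Suc k)"
          unfolding t_def using False by (intro ext) (subst rel, simp add: field_simps del: ndiv.simps)
        ultimately show ?case by simp
      qed
    qed
    then show ?case by (simp add: t_def)
  qed
  have "{l. i \<le> l \<and> l \<le> i \<and> \<nu> l = \<nu> i} = {i}" by auto
  then have "(\<lambda>v. tcoeff (ndiv i (\<mu> v) (q v)) (\<nu> i) 0) \<in> K" by (intro main) auto
  from Kadd[OF this Kmult[of i "Suc i" "\<nu> i" 0]]
  have "(\<lambda>v. tcoeff (ndiv i (\<mu> v) (q v)) (\<nu> i) 0 + (\<mu> v i - \<nu> i) * tcoeff (ndiv (Suc i) (\<mu> v) (q v)) (\<nu> i) 0) \<in> K" by simp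
  moreover have "(\<lambda>v. tcoeff (ndiv i (\<mu> v) (q v)) (\<nu> i) 0 + (\<mu> v i - \<nu> i) * tcoeff (ndiv (Suc i) (\<mu> v) (q v)) (\<nu> i) 0)
     = (\<lambda>v. ncoeff i (\<mu> v) (q v))"
    by (rule ext) (subst rel, simp add: algebra_simps del: ndiv.simps)
  ultimately show ?thesis by (simp add: K_def)
qed

section \<open>Holomorphic interpolation\<close>

lemma bigo_power_mono:
  assumes "d \<le> e" "g \<in> O[at p](\<lambda>v::complex. (v - p) ^ e)"
  shows "g \<in> O[at p](\<lambda>v. (v - p) ^ d)"
proof -
  have "(\<lambda>v. (v - p) ^ (e - d)) \<in> O[at p](\<lambda>_. 1)"
    by (intro field_differentiable_bigo_1 derivative_intros)
  from landau_o.big.mult[OF landau_o.big_refl[of "\<lambda>v. (v - p) ^ d"] this]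
  have "(\<lambda>v. (v - p) ^ e) \<in> O[at p](\<lambda>v. (v - p) ^ d)" using assms(1) by (simp flip: power_add)
  then show ?thesis using assms(2) landau_o.big_trans by blast
qed

text \<open>Zeros are split off one at a time; the quotient extends holomorphically over
  \<open>a\<close> with the derivative as its value.\<close>

lemma holomorphic_factor_power:
  assumes S: "open S" "a \<in> S" and h: "h holomorphic_on S" and o: "h \<in> O[at a](\<lambda>v. (v - a) ^ e)"
  obtains g where "g holomorphic_on S" "\<And>z. z \<in> S \<Longrightarrow> h z = (z - a) ^ e * g z"
  using h o
proof (induction e arbitrary: h thesis)
  case 0
  then show ?case by (metis mult_1 power_0)
next
  case (Suc e)
  \<comment> \<open>The estimate lives on a punctured neighbourhood, so \<open>h a = 0\<close> is
    obtained from continuity.\<close>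
  have "h \<in> O[at a](\<lambda>v. (v - a) ^ 1)" by (rule bigo_power_mono[OF _ Suc.prems(3)]) simp
  then obtain C where "\<forall>\<^sub>F v in at a. norm (h v) \<le> C * norm ((v - a) ^ 1)" by (elim landau_o.bigE)
  moreover have "((\<lambda>v. C * norm ((v - a) ^ 1)) \<longlongrightarrow> 0) (at a)" by (auto intro!: tendsto_eq_intros)
  ultimately have "(h \<longlongrightarrow> 0) (at a)" by (rule Lim_null_comparison)
  moreover have "(h \<longlongrightarrow> h a) (at a)"
    using Suc.prems(2) S by (meson continuous_on_eq_continuous_at holomorphic_on_imp_continuous_on isCont_def)
  ultimately have ha: "h a = 0" using LIM_unique by blast
  define g where "g z = (if z = a then deriv h a else (h z - h a) / (z - a))" for z
  have g: "g holomorphic_on S" unfolding g_def using Suc.prems(2) S by (intro pole_lemma_open)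
  have hg: "h z = (z - a) * g z" for z by (simp add: g_def ha)
  have "g \<in> O[at a](\<lambda>v. (v - a) ^ e)"
  proof -
    have "(\<lambda>v. h v / (v - a)) \<in> O[at a](\<lambda>v. (v - a) ^ Suc e / (v - a))"
      using Suc.prems(3) by (intro landau_o.big.divide_right) (auto simp: eventually_at_filter)
    moreover have "\<forall>\<^sub>F v in at a. (v - a) ^ Suc e / (v - a) = (v - a) ^ e" by (auto simp: eventually_at_filter)
    moreover have "\<forall>\<^sub>F v in at a. h v / (v - a) = g v" by (auto simp: eventually_at_filter hg)
    ultimately show ?thesis using landau_o.big.cong landau_o.big.in_cong by metis
  qed
  then obtain g' where "g' holomorphic_on S" "\<And>z. z \<in> S \<Longrightarrow> g z = (z - a) ^ e * g' z"
    using Suc.IH[OF _ g] by blast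
  then show ?case using Suc.prems(1)[of g'] hg by (simp add: mult.assoc)
qed

text \<open>Dividing by a power of \<open>z - a l\<close> leaves the orders at the other nodes
  unchanged, as that power is invertible near them.\<close>

lemma holomorphic_factor_prod:
  assumes S: "open S" and L: "finite L" "inj_on a L" "\<And>l. l \<in> L \<Longrightarrow> a l \<in> S" and h: "h holomorphic_on S"
    and o: "\<And>l. l \<in> L \<Longrightarrow> h \<in> O[at (a l)](\<lambda>v. (v - a l) ^ e l)"
  obtains g where "g holomorphic_on S" "\<And>z. z \<in> S \<Longrightarrow> h z = (\<Prod>l\<in>L. (z - a l) ^ e l) * g z"
  using L h o
proof (induction L arbitrary: h thesis)
  case empty
  then show ?case by simp
next
  case (insert l L)
  obtain g where g: "g holomorphic_on S" "\<And>z. z \<in> S \<Longrightarrow> h z = (z - a l) ^ e l * g z"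
    using holomorphic_factor_power[OF S, of "a l" h "e l"] insert.prems by auto
  have "g \<in> O[at (a l')](\<lambda>v. (v - a l') ^ e l')" if l': "l' \<in> L" for l'
  proof -
    have ne: "a l' \<noteq> a l" using insert.prems(2) insert.hyps l' by (auto simp: inj_on_def)
    have "(\<lambda>v. 1 / (v - a l) ^ e l) \<in> O[at (a l')](\<lambda>_. 1)"
      using ne by (intro field_differentiable_bigo_1) (auto intro!: derivative_intros)
    moreover have "h \<in> O[at (a l')](\<lambda>v. (v - a l') ^ e l')" using insert.prems l' by auto
    ultimately have "(\<lambda>v. h v * (1 / (v - a l) ^ e l)) \<in> O[at (a l')](\<lambda>v. (v - a l') ^ e l' * 1)"
      by (rule landau_o.big.mult[rotated])
    then have 1: "(\<lambda>v. h v * (1 / (v - a l) ^ e l)) \<in> O[at (a l')](\<lambda>v. (v - a l') ^ e l')" by simp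
    have "\<forall>\<^sub>F v in at (a l'). v \<in> S - {a l}"
      by (rule eventually_at_in_open') (use ne S insert.prems l' in auto)
    then have "\<forall>\<^sub>F v in at (a l'). g v = h v * (1 / (v - a l) ^ e l)"
      by eventually_elim (use g(2) in auto)
    from landau_o.big.in_cong[OF this] 1 show ?thesis by (rule iffD2)
  qed
  then obtain g' where "g' holomorphic_on S" "\<And>z. z \<in> S \<Longrightarrow> g z = (\<Prod>l\<in>L. (z - a l) ^ e l) * g' z"
    using insert.IH[OF _ _ _ g(1)] insert.prems by (auto simp: inj_on_def)
  then show ?case using insert.prems(1)[of g'] g insert.hyps by (simp add: mult.assoc)
qed

lemma hermite_unit:
  assumes L: "finite L" "inj_on a L" "l \<in> L" and m: "m > 0"
  obtains E :: "complex \<Rightarrow> complex" where "E holomorphic_on UNIV" "E (a l) = 1"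
    "\<And>l'. l' \<in> L \<Longrightarrow> l' \<noteq> l \<Longrightarrow> E (a l') = 0"
    "\<And>l'. l' \<in> L \<Longrightarrow> (\<lambda>z. E z - (if l' = l then 1 else 0)) \<in> O[at (a l')](\<lambda>z. (z - a l') ^ m)"
proof -
  define u where "u z = (\<Prod>l'\<in>L - {l}. (z - a l') / (a l - a l'))" for z
  have ne: "a l \<noteq> a l'" if "l' \<in> L - {l}" for l' using that L by (auto simp: inj_on_def)
  have hu: "u holomorphic_on UNIV" unfolding u_def using ne by (intro holomorphic_intros) auto
  have u1: "u (a l) = 1" unfolding u_def using ne by (intro prod.neutral) auto
  have u0: "u (a l') = 0" if "l' \<in> L" "l' \<noteq> l" for l' unfolding u_def using that L by (intro prod_zero) auto
  have ud: "u field_differentiable at z" for z using hu by (simp add: holomorphic_on_def)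
  \<comment> \<open>\<open>u\<close> is the Lagrange polynomial of the node \<open>a l\<close>.
    Where \<open>u = 1\<close>, the factor \<open>1 - u^m\<close> vanishes, so its
    \<open>m\<close>-th power has order \<open>m\<close>; where \<open>u = 0\<close>, the geometric
    sum shows that \<open>E\<close> is divisible by \<open>u^m\<close>.\<close>
  define E where "E z = 1 - (1 - u z ^ m) ^ m" for z
  show ?thesis
  proof (rule that)
    show "E holomorphic_on UNIV" unfolding E_def by (intro holomorphic_intros hu)
    show "E (a l) = 1" "\<And>l'. l' \<in> L \<Longrightarrow> l' \<noteq> l \<Longrightarrow> E (a l') = 0" using m by (auto simp: E_def u1 u0 zero_power)
    fix l' assume l': "l' \<in> L"
    show "(\<lambda>z. E z - (if l' = l then 1 else 0)) \<in> O[at (a l')](\<lambda>z. (z - a l') ^ m)"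
    proof (cases "l' = l")
      case True
      have "(\<lambda>z. 1 - u z ^ m) \<in> O[at (a l)](\<lambda>z. z - a l)"
        by (intro field_differentiable_bigo_linear derivative_intros ud) (simp add: u1)
      from landau_o.big_power[OF this, of m] show ?thesis by (simp add: True E_def)
    next
      case False
      have "u \<in> O[at (a l')](\<lambda>z. z - a l')"
        by (intro field_differentiable_bigo_linear ud) (use u0 False l' in simp)
      then have 1: "(\<lambda>z. u z ^ m) \<in> O[at (a l')](\<lambda>z. (z - a l') ^ m)" by (rule landau_o.big_power)
      have "(\<lambda>z. \<Sum>i<m. (1 - u z ^ m) ^ i) \<in> O[at (a l')](\<lambda>_. 1)"
        by (intro field_differentiable_bigo_1 derivative_intros ud field_differentiable_sum)
      from landau_o.big.mult[OF 1 this]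
      have "(\<lambda>z. u z ^ m * (\<Sum>i<m. (1 - u z ^ m) ^ i)) \<in> O[at (a l')](\<lambda>z. (z - a l') ^ m)" by simp
      moreover have "E z = u z ^ m * (\<Sum>i<m. (1 - u z ^ m) ^ i)" for z
        using one_diff_power_eq[of "1 - u z ^ m" m] by (simp add: E_def)
      ultimately show ?thesis using False by simp
    qed
  qed
qed

section \<open>Holomorphic families of invertible matrices\<close>

lemma holomorphic_det:
  assumes "holo_mat n P S"
  shows "(\<lambda>z. det (P z)) holomorphic_on S"
proof -
  have "(\<lambda>z. \<Sum>p\<in>{p. p permutes {0..<n}}. signof p * (\<Prod>i = 0..<n. P z $$ (i, p i))) holomorphic_on S"
    using assms by (intro holomorphic_intros) (auto simp: holo_mat_def permutes_in_image)
  moreover have "det (P z) = (\<Sum>p\<in>{p. p permutes {0..<n}}. signof p * (\<Prod>i = 0..<n. P z $$ (i, p i)))" if "z \<in> S" for z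
    using assms that by (intro det_def') (simp add: holo_mat_def)
  ultimately show ?thesis by (simp cong: holomorphic_cong)
qed

lemma holo_mat_mult:
  assumes "holo_mat n P S" "holo_mat n Q S"
  shows "holo_mat n (\<lambda>z. P z * Q z) S"
  unfolding holo_mat_def
proof (intro conjI ballI allI impI)
  fix z assume "z \<in> S"
  then show "P z * Q z \<in> carrier_mat n n" using assms by (auto simp: holo_mat_def)
next
  fix i k assume ik: "i < n" "k < n"
  have "(\<lambda>z. \<Sum>l<n. P z $$ (i,l) * Q z $$ (l,k)) holomorphic_on S"
    using assms ik by (intro holomorphic_intros) (auto simp: holo_mat_def)
  moreover have "(P z * Q z) $$ (i,k) = (\<Sum>l<n. P z $$ (i,l) * Q z $$ (l,k))" if "z \<in> S" for z
    using assms that ik by (intro mat_mult_entry) (auto simp: holo_mat_def)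
  ultimately show "(\<lambda>z. (P z * Q z) $$ (i,k)) holomorphic_on S" by (simp cong: holomorphic_cong)
qed

lemma holo_mat_const: "A \<in> carrier_mat n n \<Longrightarrow> holo_mat n (\<lambda>_. A) S"
  by (simp add: holo_mat_def)

lemma holo_mat_inverse:
  assumes P: "holo_mat n P S" and d: "\<And>z. z \<in> S \<Longrightarrow> det (P z) \<noteq> 0"
  shows "holo_mat n (\<lambda>z. (1 / det (P z)) \<cdot>\<^sub>m adj_mat (P z)) S"
  unfolding holo_mat_def
proof (intro conjI ballI allI impI)
  have Pc: "P z \<in> carrier_mat n n" if "z \<in> S" for z using P that by (simp add: holo_mat_def)
  show "(1 / det (P z)) \<cdot>\<^sub>m adj_mat (P z) \<in> carrier_mat n n" if "z \<in> S" for z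
    using det_nonzero_inverse(1)[OF Pc d] that by blast
  fix i k assume ik: "i < n" "k < n"
  have "holo_mat (n - 1) (\<lambda>z. mat_delete (P z) k i) S"
    unfolding holo_mat_def
  proof (intro conjI ballI allI impI)
    fix z assume "z \<in> S"
    then show "mat_delete (P z) k i \<in> carrier_mat (n - 1) (n - 1)" using Pc mat_delete_carrier by blast
  next
    fix i' k' assume "i' < n - 1" "k' < n - 1"
    then have ik': "(if i' < k then i' else Suc i') < n" "(if k' < i then k' else Suc k') < n" by auto
    then have "(\<lambda>z. P z $$ (if i' < k then i' else Suc i', if k' < i then k' else Suc k')) holomorphic_on S"
      using P by (simp only: holo_mat_def)
    moreover have "mat_delete (P z) k i $$ (i',k') = P z $$ (if i' < k then i' else Suc i', if k' < i then k' else Suc k')"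
      if "z \<in> S" for z
      using Pc[OF that] \<open>i' < n - 1\<close> \<open>k' < n - 1\<close> by (simp add: mat_delete_def)
    ultimately show "(\<lambda>z. mat_delete (P z) k i $$ (i',k')) holomorphic_on S" by (simp cong: holomorphic_cong)
  qed
  from holomorphic_det[OF this]
  have "(\<lambda>z. 1 / det (P z) * ((-1) ^ (k + i) * det (mat_delete (P z) k i))) holomorphic_on S"
    using d by (intro holomorphic_intros holomorphic_det[OF P]) auto
  moreover have "((1 / det (P z)) \<cdot>\<^sub>m adj_mat (P z)) $$ (i,k) = 1 / det (P z) * ((-1) ^ (k + i) * det (mat_delete (P z) k i))"
    if "z \<in> S" for z
    using Pc[OF that] ik by (simp add: adj_mat_def cofactor_def)
  ultimately show "(\<lambda>z. ((1 / det (P z)) \<cdot>\<^sub>m adj_mat (P z)) $$ (i,k)) holomorphic_on S" by (simp cong: holomorphic_cong)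
qed

text \<open>Triangularising the prescribed value by a constant matrix reduces the interpolation to
  scalar functions, with exponentials on the diagonal.\<close>

lemma invertible_interpolation_single:
  assumes M: "M \<in> carrier_mat n n" and dM: "det M \<noteq> 0" and E: "E holomorphic_on UNIV"
  obtains P where "holo_mat n P UNIV" "\<And>z. det (P z) \<noteq> 0" "\<And>z. E z = 1 \<Longrightarrow> P z = M" "\<And>z. E z = 0 \<Longrightarrow> P z = 1\<^sub>m n"
proof -
  obtain es where "char_poly M = (\<Prod>e\<leftarrow>es. [:- e, 1:])" using char_poly_factorized[OF M] by blast
  then obtain T where T: "T \<in> carrier_mat n n" "upper_triangular T" "similar_mat M T"
    using schur_decomposition_exists[OF M] by blast
  then obtain S R where "similar_mat_wit M T S R" by (auto simp: similar_mat_def)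
  from similar_mat_witD2[OF M this]
  have SR: "S * R = 1\<^sub>m n" "R * S = 1\<^sub>m n" "M = S * T * R" "S \<in> carrier_mat n n" "R \<in> carrier_mat n n" by auto
  have "det T \<noteq> 0" using det_similar[OF T(3)] dM by simp
  then have T0: "T $$ (i,i) \<noteq> 0" if "i < n" for i
    using det_upper_triangular[OF T(2,1)] that T(1) by (auto simp: prod_list_zero_iff diag_mat_def)
  \<comment> \<open>At \<open>E z = 0\<close> this is the identity and at \<open>E z = 1\<close> it
    is \<open>T\<close>; in between, the diagonal entries never vanish. The logarithms make sense
    because \<open>T\<close> is invertible.\<close>
  define U where "U z = mat n n (\<lambda>(i,j). if i = j then exp (E z * Ln (T $$ (i,i))) else E z * T $$ (i,j))" for z
  have Uc: "U z \<in> carrier_mat n n" for z by (simp add: U_def)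
  have "holo_mat n U UNIV"
    unfolding holo_mat_def
  proof (intro conjI ballI allI impI)
    fix i k assume "i < n" "k < n"
    then show "(\<lambda>z. U z $$ (i,k)) holomorphic_on UNIV"
      by (cases "i = k") (auto simp: U_def intro!: holomorphic_intros E)
  qed (simp add: U_def)
  then have hP: "holo_mat n (\<lambda>z. S * U z * R) UNIV" using SR by (intro holo_mat_mult holo_mat_const)
  have "upper_triangular (U z)" for z using T(1,2) by (auto simp: upper_triangular_def U_def)
  then have dU: "det (U z) \<noteq> 0" for z
    using det_upper_triangular[OF _ Uc[of z]] by (auto simp: prod_list_zero_iff diag_mat_def U_def)
  have dP: "det (S * U z * R) \<noteq> 0" for z
  proof -
    have "similar_mat (S * U z * R) (U z)"
      by (rule similar_matI[of _ _ S R n]) (use SR Uc[of z] in auto)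
    from det_similar[OF this] dU show ?thesis by simp
  qed
  have P1: "S * U z * R = M" if "E z = 1" for z
  proof -
    have "U z = T" using that T(1) T0 by (intro eq_matI) (auto simp: U_def)
    then show ?thesis by (simp add: SR(3))
  qed
  have P0: "S * U z * R = 1\<^sub>m n" if "E z = 0" for z
  proof -
    have "U z = 1\<^sub>m n" using that by (intro eq_matI) (auto simp: U_def)
    then show ?thesis using SR right_mult_one_mat[OF SR(4)] by simp
  qed
  show ?thesis by (rule that[OF hP dP P1 P0])
qed

text \<open>A product of interpolants, each equal to the prescribed matrix at its own node and to
  the identity at all the others.\<close>

lemma invertible_interpolation:
  fixes M :: "'l \<Rightarrow> complex mat"
  assumes L: "finite L" "inj_on a L" and M: "\<And>l. l \<in> L \<Longrightarrow> M l \<in> carrier_mat n n" "\<And>l. l \<in> L \<Longrightarrow> det (M l) \<noteq> 0"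
  obtains P where "holo_mat n P UNIV" "\<And>z. det (P z) \<noteq> 0" "\<And>l. l \<in> L \<Longrightarrow> P (a l) = M l"
proof -
  have "\<exists>P. holo_mat n P UNIV \<and> (\<forall>z. det (P z) \<noteq> 0) \<and> (\<forall>l\<in>L. P (a l) = (if l \<in> K then M l else 1\<^sub>m n))"
    if "K \<subseteq> L" "finite K" for K
    using that(2,1)
  proof (induction K)
    case empty
    show ?case by (intro exI[of _ "\<lambda>_. 1\<^sub>m n"]) (auto simp: holo_mat_const)
  next
    case (insert l K)
    then obtain P where P: "holo_mat n P UNIV" "\<And>z. det (P z) \<noteq> 0" "\<And>l. l \<in> L \<Longrightarrow> P (a l) = (if l \<in> K then M l else 1\<^sub>m n)"
      by (metis insert_subset)
    have l: "l \<in> L" using insert by auto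
    obtain E where E: "E holomorphic_on UNIV" "E (a l) = 1" "\<And>l'. l' \<in> L \<Longrightarrow> l' \<noteq> l \<Longrightarrow> E (a l') = 0"
    proof (rule hermite_unit[of L a l "Suc 0"])
      show "finite L" "inj_on a L" "l \<in> L" by (fact L l)+
    qed (use that in auto)
    obtain R where R: "holo_mat n R UNIV" "\<And>z. det (R z) \<noteq> 0" "\<And>z. E z = 1 \<Longrightarrow> R z = M l" "\<And>z. E z = 0 \<Longrightarrow> R z = 1\<^sub>m n"
      using invertible_interpolation_single[OF M(1)[OF l] M(2)[OF l] E(1)] by metis
    have Pc: "P z \<in> carrier_mat n n" "R z \<in> carrier_mat n n" for z using P(1) R(1) by (auto simp: holo_mat_def)
    have "det (P z * R z) \<noteq> 0" for z using det_mult[OF Pc] P(2) R(2) by simp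
    moreover have "P (a l') * R (a l') = (if l' \<in> insert l K then M l' else 1\<^sub>m n)" if l': "l' \<in> L" for l'
    proof (cases "l' = l")
      case True
      then show ?thesis using P(3)[OF l] R(3)[OF E(2)] insert.hyps M(1)[OF l] by simp
    next
      case False
      then show ?thesis using P(3)[OF l'] R(4)[OF E(3)[OF l' False]] M(1)[OF l'] by (simp add: right_mult_one_mat)
    qed
    ultimately show ?case using holo_mat_mult[OF P(1) R(1)] by (intro exI[of _ "\<lambda>z. P z * R z"]) auto
  qed
  from this[of L] L(1) show ?thesis using that by auto
qed

section \<open>Holomorphic dependence of Newton coefficients\<close>

lemma holomorphic_ndiv:
  assumes p: "\<And>k. (\<lambda>z. coeff (p z) k) holomorphic_on S" and deg: "\<And>z. degree (p z) \<le> n"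
    and mu: "\<And>i. (\<lambda>z. \<mu> z i) holomorphic_on S"
  shows "(\<lambda>z. coeff (ndiv i (\<mu> z) (p z)) k) holomorphic_on S \<and> (\<forall>z. degree (ndiv i (\<mu> z) (p z)) \<le> n)"
proof (induction i arbitrary: k)
  case 0
  then show ?case using p deg by simp
next
  case (Suc i)
  have deg': "degree (ndiv (Suc i) (\<mu> z) (p z)) \<le> n" for z
    using Suc[THEN conjunct2, rule_format, of z] by (simp add: degree_synthetic_div)
  have "(\<lambda>z. coeff (ndiv (Suc i) (\<mu> z) (p z)) k) holomorphic_on S"
  \<comment> \<open>Downward induction on \<open>k\<close>: the recursion for the quotient starts at
    its top coefficients, which vanish beyond the common degree bound \<open>n\<close>.\<close>
  proof (induction "Suc n - k" arbitrary: k)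
    case 0
    then have "coeff (ndiv (Suc i) (\<mu> z) (p z)) k = 0" for z using deg'[of z] by (intro coeff_eq_0) linarith
    then show ?case by (simp del: ndiv.simps)
  next
    case (Suc d)
    have "(\<lambda>z. coeff (ndiv (Suc i) (\<mu> z) (p z)) (Suc k)) holomorphic_on S"
      by (rule Suc.hyps(1)) (use Suc.hyps(2) in simp)
    then have "(\<lambda>z. coeff (ndiv i (\<mu> z) (p z)) (Suc k) + \<mu> z i * coeff (ndiv (Suc i) (\<mu> z) (p z)) (Suc k)) holomorphic_on S"
      using \<open>\<And>k. (\<lambda>z. coeff (ndiv i (\<mu> z) (p z)) k) holomorphic_on S \<and> (\<forall>z. degree (ndiv i (\<mu> z) (p z)) \<le> n)\<close>
      by (intro holomorphic_intros mu) auto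
    then show ?case by (simp flip: coeff_synthetic_div)
  qed
  then show ?case using deg' by blast
qed

lemma holomorphic_ncoeff:
  assumes p: "\<And>k. (\<lambda>z. coeff (p z) k) holomorphic_on S" and deg: "\<And>z. degree (p z) \<le> n"
    and mu: "\<And>i. (\<lambda>z. \<mu> z i) holomorphic_on S"
  shows "(\<lambda>z. ncoeff i (\<mu> z) (p z)) holomorphic_on S"
proof -
  have "ncoeff i (\<mu> z) (p z) = coeff (ndiv i (\<mu> z) (p z)) 0 + \<mu> z i * coeff (ndiv (Suc i) (\<mu> z) (p z)) 0" for z
    using arg_cong[OF synthetic_div_correct[of "ndiv i (\<mu> z) (p z)" "\<mu> z i"], of "\<lambda>q. coeff q 0"]
    by (simp add: ncoeff_def)
  then show ?thesis using holomorphic_ndiv[OF assms]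
    by (simp only:) (intro holomorphic_intros mu, auto simp del: ndiv.simps)
qed

lemma hfam_holomorphic:
  assumes "open S" "p \<in> S" and q: "\<And>k. (\<lambda>z. coeff (q z) k) holomorphic_on S" and deg: "\<And>z. degree (q z) \<le> n"
  shows "hfam p c q"
  unfolding hfam_def
proof
  fix k
  have "tcoeff (q z) c k = (\<Sum>m\<le>n. coeff (q z) m * tcoeff (monom 1 m) c k)" for z
  proof -
    have "q z = (\<Sum>m\<le>n. [:coeff (q z) m:] * monom 1 m)"
      using poly_as_sum_of_monoms'[OF deg[of z]] by (simp add: smult_monom)
    then have "tcoeff (q z) c k = (\<Sum>m\<le>n. tcoeff ([:coeff (q z) m:] * monom 1 m) c k)"
      by (metis tcoeff_sum)
    also have "\<dots> = (\<Sum>m\<le>n. coeff (q z) m * tcoeff (monom 1 m) c k)"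
      by (intro sum.cong) (auto simp: tcoeff_def pcompose_smult)
    finally show ?thesis .
  qed
  moreover have "(\<lambda>z. coeff (q z) m) field_differentiable at p" for m
    using q assms(1,2) holomorphic_on_imp_differentiable_at by blast
  ultimately show "(\<lambda>v. tcoeff (q v) c k) field_differentiable at p"
    by (simp only:) (intro field_differentiable_sum field_differentiable_mult, auto)
qed

section \<open>Global lifting\<close>

text \<open>Up to an index in layer \<open>s\<close>, the labels of one eigenvalue all lie in layers
  from \<open>s\<close> on. If \<open>k\<close> is below their number, then the \<open>s\<close>
  largest blocks have total size less than \<open>ns ! j - k\<close>, so the exponent in (iii) is at
  least \<open>s + 1\<close>.\<close>

lemma cond_iii_layered:
  assumes Mc: "M \<in> carrier_mat n n" and n: "n > 0" and cond: "cond_iii n f p M"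
  obtains xs where "layered xs n" "similar_mat M (jmat xs)" "fst (snd (xs ! (n - 1))) = 0"
    "\<And>i c k. i < n \<Longrightarrow> k < card {j. j \<le> i \<and> fst (xs ! j) = c} \<Longrightarrow>
       (\<lambda>v. tcoeff (chi_pt n (f v)) c k) \<in> O[at p](\<lambda>v. (v - p) ^ Suc (fst (snd (xs ! i))))"
proof -
  obtain lams Bs ns where bd: "block_decomp M lams Bs ns" using block_decomp_exists[OF Mc] .
  obtain b N xss where b: "\<And>j. j < length Bs \<Longrightarrow> antimono (b j)" "\<And>j s. j < length Bs \<Longrightarrow> s \<ge> N j \<Longrightarrow> b j s = 0"
    and xss: "\<And>j. j < length Bs \<Longrightarrow> distinct (xss j)" "\<And>j. j < length Bs \<Longrightarrow> set (xss j) = layers (lams ! j) (b j)"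
    "\<And>j. j < length Bs \<Longrightarrow> similar_mat (Bs ! j) (jmat (xss j))"
    and M: "\<And>xs. distinct xs \<Longrightarrow> set xs = (\<Union>j<length Bs. layers (lams ! j) (b j)) \<Longrightarrow> similar_mat M (jmat xs)"
    by (rule block_decomp_labels[OF bd]) (rule that)
  define \<Lambda> where "\<Lambda> = (\<Union>j<length Bs. layers (lams ! j) (b j))"
  have fin: "finite \<Lambda>" unfolding \<Lambda>_def
  proof (rule finite_UN_I)
    fix i assume "i \<in> {..<length Bs}"
    then show "finite (layers (lams ! i) (b i))" using b(2)[of i] by (intro finite_layers[of "N i"]) auto
  qed simp
  obtain ys where ys: "set ys = \<Lambda>" "distinct ys" using finite_distinct_list[OF fin] by blast
  define S where "S = Max (insert 0 ((\<lambda>x. fst (snd x)) ` \<Lambda>))"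
  define K where "K = Suc (Max (insert 0 ((\<lambda>x. snd (snd x)) ` \<Lambda>)))"
  have S: "fst (snd x) \<le> S" if "x \<in> \<Lambda>" for x unfolding S_def using that fin by (intro Max_ge) auto
  have K: "snd (snd x) < K" if "x \<in> \<Lambda>" for x unfolding K_def less_Suc_eq_le using that fin by (intro Max_ge) auto
  \<comment> \<open>A lexicographic order in one number: decreasing chain number, then increasing
    position, with \<open>K\<close> exceeding every position.\<close>
  define key where "key x = (S - fst (snd x)) * K + snd (snd x)" for x :: label
  define xs where "xs = sort_key key ys"
  have xs: "set xs = \<Lambda>" "distinct xs" using ys by (simp_all add: xs_def)
  have sim: "similar_mat M (jmat xs)" using M xs unfolding \<Lambda>_def by blast
  have len_xs: "length xs = n"
  proof -
    from similar_matD[OF sim] obtain m where "M \<in> carrier_mat m m" "jmat xs \<in> carrier_mat m m" by auto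
    then show ?thesis using Mc by (metis carrier_matD(1) jmat_dim(1))
  qed
  have mem: "xs ! i \<in> \<Lambda>" if "i < n" for i using that xs(1) len_xs nth_mem by blast
  have key_mono: "key (xs ! i) \<le> key (xs ! j)" if "i \<le> j" "j < n" for i j
  proof -
    have "sorted (map key xs)" by (simp add: xs_def)
    from sorted_nth_mono[OF this that(1)] that len_xs show ?thesis by simp
  qed
  have lay_mono: "fst (snd (xs ! j)) \<le> fst (snd (xs ! i))" if ij: "i \<le> j" "j < n" for i j
  proof (rule ccontr)
    assume "\<not> fst (snd (xs ! j)) \<le> fst (snd (xs ! i))"
    moreover have "fst (snd (xs ! j)) \<le> S" using S mem ij by simp
    ultimately have "Suc (S - fst (snd (xs ! j))) \<le> S - fst (snd (xs ! i))" by linarith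
    then have "Suc (S - fst (snd (xs ! j))) * K \<le> (S - fst (snd (xs ! i))) * K" by (rule mult_le_mono1)
    moreover have "snd (snd (xs ! j)) < K" using K mem ij by simp
    ultimately have "key (xs ! j) < key (xs ! i)" unfolding key_def by simp
    then show False using key_mono[OF ij] by simp
  qed
  have lay: "layered xs n"
  proof
    show "length xs = n" "distinct xs" by (fact len_xs xs)+
    show "(c,s,k') \<in> set xs" if "(c,s,k) \<in> set xs" "k' < k" for c s k k'
      using that unfolding xs(1) \<Lambda>_def by (auto simp: layers_def)
    show "fst (snd (xs ! j)) \<le> fst (snd (xs ! i))" if "i \<le> j" "j < n" for i j using lay_mono[OF that] .
    fix i j assume ij: "i < j" "j < n" and eq: "fst (xs ! i) = fst (xs ! j)" "fst (snd (xs ! i)) = fst (snd (xs ! j))"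
    have "snd (snd (xs ! i)) \<le> snd (snd (xs ! j))"
      using key_mono[of i j] ij eq(2) by (simp add: key_def)
    moreover have "xs ! i \<noteq> xs ! j" using nth_eq_iff_index_eq[OF xs(2), of i j] ij len_xs by simp
    ultimately show "snd (snd (xs ! i)) < snd (snd (xs ! j))" using eq by (auto simp: prod_eq_iff)
  qed
  \<comment> \<open>Every eigenvalue that occurs has a chain number 0, because the block sizes
    decrease; hence the final layer is layer 0.\<close>
  have last: "fst (snd (xs ! (n - 1))) = 0"
  proof -
    have "xs ! 0 \<in> \<Lambda>" using mem n by simp
    then obtain j s k where j: "j < length Bs" "xs ! 0 = (lams ! j, s, k)" "k < b j s" by (auto simp: \<Lambda>_def layers_def)
    have "b j s \<le> b j 0" by (rule antimonoD[OF b(1)[OF j(1)]]) simp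
    then have "(lams ! j, 0, k) \<in> set xs" using j unfolding xs(1) \<Lambda>_def layers_def by auto
    then obtain i where "i < n" "xs ! i = (lams ! j, 0, k)" using len_xs by (auto simp: in_set_conv_nth)
    then show ?thesis using lay_mono[of i "n - 1"] n by simp
  qed
  have order: "(\<lambda>v. tcoeff (chi_pt n (f v)) c k) \<in> O[at p](\<lambda>v. (v - p) ^ Suc (fst (snd (xs ! i))))"
    if i: "i < n" and k: "k < card {j. j \<le> i \<and> fst (xs ! j) = c}" for i c k
  proof -
    define s where "s = fst (snd (xs ! i))"
    from k have "{j. j \<le> i \<and> fst (xs ! j) = c} \<noteq> {}" by (metis card.empty not_less0)
    then obtain j' where "j' \<le> i" "fst (xs ! j') = c" by blast
    moreover from this have "xs ! j' \<in> \<Lambda>" using mem i by simp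
    ultimately obtain j where j: "j < length Bs" and c: "c = lams ! j" by (auto simp: \<Lambda>_def layers_def)
    have Bj: "Bs ! j \<in> carrier_mat (ns ! j) (ns ! j)" using bd j by (simp add: block_decomp_def)
    obtain P Q where wit: "similar_mat_wit (Bs ! j) (jmat (xss j)) P Q" using xss(3)[OF j] by (auto simp: similar_mat_def)
    interpret jordan_coords "Bs ! j" "ns ! j" "lams ! j" "b j" "N j" "xss j" P Q
      by unfold_locales (use Bj b[OF j] xss[OF j] wit in auto)
    have "card {j. j \<le> i \<and> fst (xs ! j) = c} \<le> sum (b j) {s..<N j}"
    proof -
      have inj: "inj_on (\<lambda>i. xs ! i) {j. j \<le> i \<and> fst (xs ! j) = c}"
      proof (rule inj_onI)
        fix u v assume "u \<in> {j. j \<le> i \<and> fst (xs ! j) = c}" "v \<in> {j. j \<le> i \<and> fst (xs ! j) = c}" "xs ! u = xs ! v"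
        then show "u = v" using i nth_eq_iff_index_eq[OF xs(2), of u v] len_xs by simp
      qed
      have sub: "(\<lambda>i. xs ! i) ` {j. j \<le> i \<and> fst (xs ! j) = c} \<subseteq> (\<lambda>(s,k). (c,s,k)) ` (SIGMA s:{s..<N j}. {..<b j s})"
      proof
        fix x assume "x \<in> (\<lambda>i. xs ! i) ` {j. j \<le> i \<and> fst (xs ! j) = c}"
        then obtain l where l: "l \<le> i" "fst (xs ! l) = c" "x = xs ! l" by auto
        then have "x \<in> \<Lambda>" using mem i by simp
        then obtain j1 s1 k1 where x: "j1 < length Bs" "x = (lams ! j1, s1, k1)" "k1 < b j1 s1"
          by (auto simp: \<Lambda>_def layers_def)
        have "j1 = j" using x(1,2) l j c bd by (auto simp: block_decomp_def nth_eq_iff_index_eq)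
        moreover have "xs ! l = (lams ! j1, s1, k1)" using l x by simp
        then have "s \<le> s1" using lay_mono[of l i] l i by (simp add: s_def)
        moreover have "s1 < N j" using b(2)[OF j, of s1] x(3) \<open>j1 = j\<close> by (cases "s1 < N j") auto
        ultimately show "x \<in> (\<lambda>(s,k). (c,s,k)) ` (SIGMA s:{s..<N j}. {..<b j s})"
          using x c by (intro image_eqI[of _ _ "(s1,k1)"]) auto
      qed
      have "card {j. j \<le> i \<and> fst (xs ! j) = c} = card ((\<lambda>i. xs ! i) ` {j. j \<le> i \<and> fst (xs ! j) = c})"
        using card_image[OF inj] by simp
      also have "\<dots> \<le> card ((\<lambda>(s,k). (c,s,k)) ` (SIGMA s:{s..<N j}. {..<b j s}))"
        by (rule card_mono[OF _ sub]) auto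
      also have "\<dots> \<le> card (SIGMA s:{s..<N j}. {..<b j s})" by (rule card_image_le) auto
      also have "\<dots> = sum (b j) {s..<N j}" by simp
      finally show ?thesis .
    qed
    with k have ks: "k < sum (b j) {s..<N j}" by simp
    then have "s < N j" by (cases "s < N j") auto
    then have tot: "ns ! j = sum (b j) {..<s} + sum (b j) {s..<N j}"
      unfolding r_sum using sum.atLeastLessThan_concat[of 0 s "N j" "b j"] by (simp add: atLeast0LessThan)
    define d where "d = d_ell (ns ! j) (Bs ! j) (ns ! j - k)"
    have "ns ! j - k \<le> sum (b j) {..<d}" unfolding d_def by (rule d_ell_ge) simp
    moreover have "sum (b j) {..<s} < ns ! j - k" using tot ks by linarith
    \<comment> \<open>Partial sums of block sizes are monotone in the number of blocks, so a strict
      inequality between them forces \<open>s < d\<close>.\<close>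
    ultimately have "sum (b j) {..<s} < sum (b j) {..<d}" by simp
    then have "s < d" by (metis (no_types) finite_lessThan lessThan_subset_iff not_less sum_mono2 zero_le)
    moreover have "(\<lambda>v. tcoeff (chi_pt n (f v)) c k) \<in> O[at p](\<lambda>v. (v - p) ^ d)"
      using cond[unfolded cond_iii_altdef, rule_format, OF bd j, of k] tot ks unfolding c d_def by simp
    ultimately show ?thesis unfolding s_def[symmetric] by (intro bigo_power_mono[of "Suc s" d]) auto
  qed
  show ?thesis by (rule that[OF lay sim last order])
qed

text \<open>Telescoping survives truncated subtraction because \<open>t\<close> decreases. It
  computes the exponent of one node in a product of consecutive subdiagonal entries.\<close>

lemma sum_diff_antimono_nat:
  fixes t :: "nat \<Rightarrow> nat"
  assumes "i \<le> m" "\<And>k. i \<le> k \<Longrightarrow> k < m \<Longrightarrow> t (Suc k) \<le> t k"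
  shows "(\<Sum>k=i..<m. t k - t (Suc k)) + t m = t i"
  using assms
proof (induction m rule: dec_induct)
  case (step m)
  have "(\<Sum>k=i..<m. t k - t (Suc k)) + t m = t i" using step.prems by (intro step.IH) simp
  moreover have "t (Suc m) \<le> t m" using step by simp
  ultimately show ?case using step.hyps by simp
qed simp

lemma chi_pt_monic: "degree (chi_pt n x) = n" "coeff (chi_pt n x) n = 1"
proof -
  show "coeff (chi_pt n x) n = 1" by (simp add: coeff_chi_pt)
  moreover have "degree (chi_pt n x) \<le> n" by (rule degree_le) (simp add: coeff_chi_pt)
  ultimately show "degree (chi_pt n x) = n" by (intro antisym le_degree) auto
qed

theorem global_lift:
  fixes a :: "'l \<Rightarrow> complex"
  assumes n: "n > 0" and L: "finite L" "inj_on a L" "\<And>l. l \<in> L \<Longrightarrow> a l \<in> D" and D: "open D"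
    and A: "\<And>l. l \<in> L \<Longrightarrow> A l \<in> carrier_mat n n" and f: "holo_vec n f D"
    and cond: "\<And>l. l \<in> L \<Longrightarrow> cond_iii n f (a l) (A l)"
  obtains F where "holo_mat n F D" "\<And>z. z \<in> D \<Longrightarrow> char_poly (F z) = chi_pt n (f z)"
    "\<And>l. l \<in> L \<Longrightarrow> F (a l) = A l"
proof -
  define good where "good l xs \<longleftrightarrow> layered xs n \<and> similar_mat (A l) (jmat xs) \<and> fst (snd (xs ! (n - 1))) = 0 \<and>
    (\<forall>i c k. i < n \<longrightarrow> k < card {j. j \<le> i \<and> fst (xs ! j) = c} \<longrightarrow>
       (\<lambda>v. tcoeff (chi_pt n (f v)) c k) \<in> O[at (a l)](\<lambda>v. (v - a l) ^ Suc (fst (snd (xs ! i)))))" for l xs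
  have "\<forall>l\<in>L. \<exists>xs. good l xs"
  proof
    fix l assume l: "l \<in> L"
    obtain xs where "layered xs n" "similar_mat (A l) (jmat xs)" "fst (snd (xs ! (n - 1))) = 0"
      "\<And>i c k. i < n \<Longrightarrow> k < card {j. j \<le> i \<and> fst (xs ! j) = c} \<Longrightarrow>
         (\<lambda>v. tcoeff (chi_pt n (f v)) c k) \<in> O[at (a l)](\<lambda>v. (v - a l) ^ Suc (fst (snd (xs ! i))))"
      by (rule cond_iii_layered[OF A[OF l] n cond[OF l]]) (rule that)
    then have "good l xs" unfolding good_def by blast
    then show "\<exists>xs. good l xs" ..
  qed
  from bchoice[OF this] obtain xs where good: "\<forall>l\<in>L. good l (xs l)" ..
  have xs: "layered (xs l) n" "similar_mat (A l) (jmat (xs l))" "fst (snd (xs l ! (n - 1))) = 0"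
    "i < n \<Longrightarrow> k < card {j. j \<le> i \<and> fst (xs l ! j) = c} \<Longrightarrow>
       (\<lambda>v. tcoeff (chi_pt n (f v)) c k) \<in> O[at (a l)](\<lambda>v. (v - a l) ^ Suc (fst (snd (xs l ! i))))" 
    if "l \<in> L" for l i c k
    using good that unfolding good_def by blast+
  define lam where "lam l i = fst (xs l ! i)" for l i
  define ly where "ly l i = fst (snd (xs l ! i))" for l i
  have ly_last: "ly l (n - 1) = 0" if "l \<in> L" for l using xs(3)[OF that] by (simp add: ly_def)
  have ly_mono: "ly l j \<le> ly l i" if "l \<in> L" "i \<le> j" "j < n" for l i j
    using layered.lay_mono[OF xs(1)[OF that(1)] that(2,3)] by (simp add: ly_def)
  \<comment> \<open>Any exponent that dominates all orders \<open>Suc (ly l i)\<close> would do; the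
    sum of all of them is such a bound.\<close>
  define m where "m = Suc (\<Sum>l\<in>L. \<Sum>i<n. Suc (ly l i))"
  have m: "m > 0" by (simp add: m_def)
  have ly_m: "Suc (ly l i) \<le> m" if "l \<in> L" "i < n" for l i
  proof -
    have "Suc (ly l i) \<le> (\<Sum>i<n. Suc (ly l i))" using that by (intro member_le_sum) auto
    also have "\<dots> \<le> (\<Sum>l\<in>L. \<Sum>i<n. Suc (ly l i))" using that L by (intro member_le_sum) auto
    finally show ?thesis by (simp add: m_def)
  qed
  define hunit where "hunit l E \<longleftrightarrow> E holomorphic_on UNIV \<and> E (a l) = 1 \<and> (\<forall>l'\<in>L. l' \<noteq> l \<longrightarrow> E (a l') = 0) \<and>
    (\<forall>l'\<in>L. (\<lambda>z. E z - (if l' = l then 1 else 0)) \<in> O[at (a l')](\<lambda>z. (z - a l') ^ m))" for l E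
  have "\<forall>l\<in>L. \<exists>E. hunit l E"
  proof
    fix l assume l: "l \<in> L"
    obtain E where "E holomorphic_on UNIV" "E (a l) = 1" "\<And>l'. l' \<in> L \<Longrightarrow> l' \<noteq> l \<Longrightarrow> E (a l') = 0"
      "\<And>l'. l' \<in> L \<Longrightarrow> (\<lambda>z. E z - (if l' = l then 1 else 0)) \<in> O[at (a l')](\<lambda>z. (z - a l') ^ m)"
      by (rule hermite_unit[OF L(1,2) l m]) (rule that)
    then have "hunit l E" unfolding hunit_def by blast
    then show "\<exists>E. hunit l E" by blast
  qed
  from bchoice[OF this] obtain E where hunit: "\<forall>l\<in>L. hunit l (E l)" ..
  have E: "E l holomorphic_on UNIV" "E l (a l) = 1" "l' \<in> L \<Longrightarrow> l' \<noteq> l \<Longrightarrow> E l (a l') = 0"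
    "l' \<in> L \<Longrightarrow> (\<lambda>z. E l z - (if l' = l then 1 else 0)) \<in> O[at (a l')](\<lambda>z. (z - a l') ^ m)" if "l \<in> L" for l l'
    using hunit that unfolding hunit_def by blast+
  \<comment> \<open>At each \<open>a l\<close> the entire function \<open>\<mu> _ i\<close> agrees
    with the \<open>i\<close>-th listed eigenvalue of \<open>A l\<close> up to order
    \<open>m\<close>, beyond the accuracy needed in \<open>newton_order\<close>.\<close>
  define \<mu> where "\<mu> z i = (\<Sum>l\<in>L. lam l i * E l z)" for z i
  have hmu: "(\<lambda>z. \<mu> z i) holomorphic_on D" for i
    unfolding \<mu>_def using E(1) by (intro holomorphic_intros) (auto intro: holomorphic_on_subset)
  have mu_at: "\<mu> (a l) i = lam l i" if l: "l \<in> L" for l i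
  proof -
    have "\<mu> (a l) i = (\<Sum>l'\<in>L. if l' = l then lam l i else 0)"
      unfolding \<mu>_def using E(2,3) l by (intro sum.cong) auto
    then show ?thesis using l L by simp
  qed
  have mu_o: "(\<lambda>v. \<mu> v i - lam l i) \<in> O[at (a l)](\<lambda>v. (v - a l) ^ m)" if l: "l \<in> L" for l i
  proof -
    have "\<mu> v i - lam l i = (\<Sum>l'\<in>L. lam l' i * (E l' v - (if l = l' then 1 else 0)))" for v
    proof -
      have "(\<Sum>l'\<in>L. lam l' i * (if l = l' then 1 else 0)) = lam l i" using l L by (simp add: if_distrib cong: if_cong)
      then show ?thesis by (simp add: \<mu>_def right_diff_distrib sum_subtractf)
    qed
    moreover have "(\<lambda>v. \<Sum>l'\<in>L. lam l' i * (E l' v - (if l = l' then 1 else 0))) \<in> O[at (a l)](\<lambda>v. (v - a l) ^ m)"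
    proof (rule big_sum_in_bigo)
      fix l' assume "l' \<in> L"
      from E(4)[OF this l] show "(\<lambda>v. lam l' i * (E l' v - (if l = l' then 1 else 0))) \<in> O[at (a l)](\<lambda>v. (v - a l) ^ m)"
        by simp
    qed
    ultimately show ?thesis by simp
  qed
  define p where "p z = chi_pt n (f z)" for z
  have hp: "(\<lambda>z. coeff (p z) k) holomorphic_on D" for k
  proof -
    have "(\<lambda>z. (-1) ^ (n - k) * f z (n - k)) holomorphic_on D" if "k < n"
      using f that by (intro holomorphic_intros) (auto simp: holo_vec_def)
    then show ?thesis unfolding p_def coeff_chi_pt by (cases "k = n"; cases "k < n") auto
  qed
  have degp: "degree (p z) \<le> n" for z by (simp add: p_def chi_pt_monic)
  define cc where "cc i z = ncoeff i (\<mu> z) (p z)" for i z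
  have hcc: "cc i holomorphic_on D" for i
    unfolding cc_def by (rule holomorphic_ncoeff[OF hp degp hmu])
  have occ: "cc i \<in> O[at (a l)](\<lambda>v. (v - a l) ^ Suc (ly l i))" if l: "l \<in> L" and i: "i < n" for l i
    unfolding cc_def
  proof (rule newton_order[where \<nu> = "lam l"])
    fix j c
    show "hfam (a l) c (\<lambda>v. ndiv j (\<mu> v) (p v))"
    proof (rule hfam_holomorphic[OF D L(3)[OF l]])
      show "(\<lambda>z. coeff (ndiv j (\<mu> z) (p z)) k) holomorphic_on D" "degree (ndiv j (\<mu> z) (p z)) \<le> n" for k z
        using holomorphic_ndiv[where p = p and \<mu> = \<mu>, OF hp degp hmu] by blast+
    qed
  next
    show "(\<lambda>v. \<mu> v j - lam l j) \<in> O[at (a l)](\<lambda>v. (v - a l) ^ Suc (ly l i))" for j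
      by (rule bigo_power_mono[OF ly_m[OF l i] mu_o[OF l]])
  next
    fix c k assume "k < card {j. j \<le> i \<and> lam l j = c}"
    then show "(\<lambda>v. tcoeff (p v) c k) \<in> O[at (a l)](\<lambda>v. (v - a l) ^ Suc (ly l i))"
      using xs(4)[OF l i, of k c] unfolding p_def lam_def ly_def by blast
  qed
  have "\<forall>i\<in>{..<n}. \<exists>h. h holomorphic_on D \<and> (\<forall>z\<in>D. cc i z = (\<Prod>l\<in>L. (z - a l) ^ Suc (ly l i)) * h z)"
  proof
    fix i assume i: "i \<in> {..<n}"
    obtain h where "h holomorphic_on D" "\<And>z. z \<in> D \<Longrightarrow> cc i z = (\<Prod>l\<in>L. (z - a l) ^ Suc (ly l i)) * h z"
    proof (rule holomorphic_factor_prod[OF D L hcc])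
      show "cc i \<in> O[at (a l)](\<lambda>v. (v - a l) ^ Suc (ly l i))" if "l \<in> L" for l
        using occ[OF that] i by simp
    qed (assumption, rule that)
    then show "\<exists>h. h holomorphic_on D \<and> (\<forall>z\<in>D. cc i z = (\<Prod>l\<in>L. (z - a l) ^ Suc (ly l i)) * h z)" by blast
  qed
  from bchoice[OF this] obtain h where "\<forall>i\<in>{..<n}. h i holomorphic_on D \<and> (\<forall>z\<in>D. cc i z = (\<Prod>l\<in>L. (z - a l) ^ Suc (ly l i)) * h i z)" ..
  then have h: "h i holomorphic_on D"
    "z \<in> D \<Longrightarrow> cc i z = (\<Prod>l\<in>L. (z - a l) ^ Suc (ly l i)) * h i z" if "i < n" for i z using that by blast+
  \<comment> \<open>One factor for each node is retained, so the last column of \<open>G\<close>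
    loses its \<open>g\<close> part at every \<open>a l\<close>.\<close>
  define g where "g i z = (\<Prod>l\<in>L. z - a l) * h i z" for i z
  \<comment> \<open>The exponent is the drop of the layer number from \<open>i\<close> to
    \<open>Suc i\<close>.\<close>
  define s where "s i z = (\<Prod>l\<in>L. (z - a l) ^ (ly l i - ly l (Suc i)))" for i z
  define G where "G z = newton_companion n (\<mu> z) (\<lambda>i. s i z) (\<lambda>i. g i z)" for z
  \<comment> \<open>The drops from \<open>i\<close> to the last index, which has layer 0, add up to
    \<open>ly l i\<close>. With the retained factor this restores the order
    \<open>Suc (ly l i)\<close> of the Newton coefficient.\<close>
  have gs: "g i z * (\<Prod>k=i..<n - 1. s k z) = cc i z" if i: "i < n" and z: "z \<in> D" for i z
  proof -
    have "(\<Prod>k=i..<n - 1. s k z) = (\<Prod>l\<in>L. \<Prod>k=i..<n - 1. (z - a l) ^ (ly l k - ly l (Suc k)))"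
      unfolding s_def by (rule prod.swap)
    also have "\<dots> = (\<Prod>l\<in>L. (z - a l) ^ ly l i)"
    proof (rule prod.cong)
      fix l assume l: "l \<in> L"
      have "(\<Sum>k=i..<n - 1. ly l k - ly l (Suc k)) + ly l (n - 1) = ly l i"
        using i ly_mono[OF l] by (intro sum_diff_antimono_nat) auto
      then show "(\<Prod>k=i..<n - 1. (z - a l) ^ (ly l k - ly l (Suc k))) = (z - a l) ^ ly l i"
        using ly_last[OF l] by (simp flip: power_sum)
    qed simp
    finally show ?thesis using h(2)[OF i z] by (simp add: g_def prod.distrib mult_ac)
  qed
  have cpG: "char_poly (G z) = p z" if z: "z \<in> D" for z
  proof -
    have "char_poly (G z) = (\<Sum>i<n. [:ncoeff i (\<mu> z) (p z):] * (\<Prod>k<i. [:- \<mu> z k, 1:])) + (\<Prod>k<n. [:- \<mu> z k, 1:])"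
      unfolding G_def char_poly_newton_companion using gs[OF _ z] by (simp add: cc_def)
    also have "\<dots> = p z"
      by (rule newton_expansion_monic[symmetric]) (simp_all add: p_def chi_pt_monic)
    finally show ?thesis .
  qed
  have hG: "holo_mat n G D"
    unfolding holo_mat_def
  proof (intro conjI ballI allI impI)
    fix i k assume ik: "i < n" "k < n"
    have if_hol: "(\<lambda>z. if b then u z else 0) holomorphic_on D" if "u holomorphic_on D" for b and u :: "complex \<Rightarrow> complex"
      using that by (cases b) auto
    have 1: "(\<lambda>z. s k z) holomorphic_on D" unfolding s_def by (intro holomorphic_intros)
    have 2: "(\<lambda>z. g i z) holomorphic_on D" unfolding g_def by (intro holomorphic_intros h(1) ik)
    have "(\<lambda>z. (if i = k then \<mu> z i else 0) + (if i = Suc k then s k z else 0) - (if Suc k = n then g i z else 0)) holomorphic_on D"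
      by (intro holomorphic_on_add holomorphic_on_diff if_hol 1 2 hmu)
    then show "(\<lambda>z. G z $$ (i,k)) holomorphic_on D" using ik by (simp add: G_def newton_companion_def)
  qed (simp add: G_def newton_companion_def)
  have Gc: "G z \<in> carrier_mat n n" for z by (simp add: G_def newton_companion_def)
  have simG: "similar_mat (A l) (G (a l))" if l: "l \<in> L" for l
  proof -
    interpret X: layered "xs l" n by (rule xs(1)[OF l])
    have lamX: "X.lam = lam l" "X.ly = ly l" by (auto simp: X.lam_def X.ly_def lam_def ly_def)
    have "g i (a l) = 0" for i unfolding g_def using l L by (auto intro: prod_zero)
    then have "G (a l) = bidiag n X.lam (\<lambda>i. s i (a l))"
      using mu_at[OF l] by (intro eq_matI) (auto simp: G_def newton_companion_def bidiag_def lamX)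
    moreover have "similar_mat (jmat (xs l)) (bidiag n X.lam (\<lambda>i. s i (a l)))"
    proof (rule X.jmat_similar_bidiag)
      fix i assume i: "Suc i < n"
      \<comment> \<open>Factors of other nodes do not vanish at \<open>a l\<close>; the own factor
        is a power of 0, which is 1 exactly when the layer does not drop.\<close>
      have "s i (a l) \<noteq> 0 \<longleftrightarrow> (\<forall>l'\<in>L. (a l - a l') ^ (ly l' i - ly l' (Suc i)) \<noteq> 0)"
        unfolding s_def using L by (simp add: prod_zero_iff)
      also have "\<dots> \<longleftrightarrow> ly l i - ly l (Suc i) = 0"
        using l L by (auto simp: inj_on_def)
      also have "\<dots> \<longleftrightarrow> ly l i = ly l (Suc i)" using ly_mono[OF l, of i "Suc i"] i by auto
      finally show "s i (a l) \<noteq> 0 \<longleftrightarrow> X.ly i = X.ly (Suc i)" by (simp add: lamX)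
    qed
    ultimately have "similar_mat (jmat (xs l)) (G (a l))" by simp
    with xs(2)[OF l] show ?thesis by (rule similar_mat_trans)
  qed
  have "\<forall>l\<in>L. \<exists>X. similar_mat_wit (A l) (G (a l)) (fst X) (snd X)"
  proof
    fix l assume "l \<in> L"
    from simG[OF this] obtain P Q where "similar_mat_wit (A l) (G (a l)) P Q" unfolding similar_mat_def by blast
    then show "\<exists>X. similar_mat_wit (A l) (G (a l)) (fst X) (snd X)" by (intro exI[of _ "(P,Q)"]) simp
  qed
  from bchoice[OF this] obtain X where X: "\<forall>l\<in>L. similar_mat_wit (A l) (G (a l)) (fst (X l)) (snd (X l))" ..
  define P0 where "P0 l = fst (X l)" for l
  define Q0 where "Q0 l = snd (X l)" for l
  have "similar_mat_wit (A l) (G (a l)) (P0 l) (Q0 l)" if "l \<in> L" for l using X that by (simp add: P0_def Q0_def)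
  note PQ = similar_mat_witD2[OF A this]
  have detP: "det (P0 l) \<noteq> 0" if "l \<in> L" for l
    using PQ(1,6,7)[OF that that] det_mult[of "P0 l" n "Q0 l"] by auto
  obtain P where P: "holo_mat n P UNIV" "\<And>z. det (P z) \<noteq> 0" "\<And>l. l \<in> L \<Longrightarrow> P (a l) = P0 l"
  proof (rule invertible_interpolation[OF L(1,2)])
    show "P0 l \<in> carrier_mat n n" "det (P0 l) \<noteq> 0" if "l \<in> L" for l using PQ(6)[OF that that] detP[OF that] by auto
  qed (rule that)
  have Pc: "P z \<in> carrier_mat n n" for z using P(1) by (simp add: holo_mat_def)
  define R where "R z = (1 / det (P z)) \<cdot>\<^sub>m adj_mat (P z)" for z
  have R: "R z \<in> carrier_mat n n" "P z * R z = 1\<^sub>m n" "R z * P z = 1\<^sub>m n" for z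
    unfolding R_def using det_nonzero_inverse[OF Pc P(2)] by auto
  have hR: "holo_mat n R UNIV" unfolding R_def by (rule holo_mat_inverse[OF P(1,2)])
  have subD: "holo_mat n X D" if "holo_mat n X UNIV" for X
    using that by (auto simp: holo_mat_def intro: holomorphic_on_subset)
  have F1: "holo_mat n (\<lambda>z. P z * G z * R z) D"
    by (intro holo_mat_mult hG subD P(1) hR)
  have F2: "char_poly (P z * G z * R z) = chi_pt n (f z)" if z: "z \<in> D" for z
  proof -
    have "similar_mat (P z * G z * R z) (G z)"
      by (rule similar_matI[of _ _ "P z" "R z" n]) (use Pc[of z] Gc[of z] R[of z] in auto)
    from char_poly_similar[OF this] show ?thesis using cpG[OF z] by (simp add: p_def)
  qed
  have F3: "P (a l) * G (a l) * R (a l) = A l" if l: "l \<in> L" for l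
  proof -
    have Q0c: "Q0 l \<in> carrier_mat n n" using PQ(7)[OF l l] .
    have PRQ: "P0 l * R (a l) = 1\<^sub>m n" using R(2)[of "a l"] P(3)[OF l] by simp
    \<comment> \<open>\<open>R (a l)\<close> and \<open>Q0 l\<close> both invert
      \<open>P0 l\<close>, hence coincide, and the conjugate at the node is exactly
      \<open>A l\<close>.\<close>
    have "R (a l) = (Q0 l * P0 l) * R (a l)" using PQ(2)[OF l l] left_mult_one_mat[OF R(1)] by simp
    also have "\<dots> = Q0 l * (P0 l * R (a l))" using Q0c PQ(6)[OF l l] R(1)[of "a l"] by (simp add: assoc_mult_mat[of _ n n _ n _ n])
    also have "\<dots> = Q0 l" using PRQ Q0c by simp
    finally show ?thesis using PQ(3)[OF l l] P(3)[OF l] by simp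
  qed
  show ?thesis by (rule that[of "\<lambda>z. P z * G z * R z", OF F1 F2 F3])
qed

text \<open>The conditions are linked in a circle: a global lift restricts to local ones with the
  whole disc as neighbourhood, local lifts force the orders in (iii), and these orders yield a lift
  on the disc at once, so no passage from local to global lifts is made.\<close>

theorem theorem1:
  fixes n m :: nat and a :: "nat \<Rightarrow> complex" and A :: "nat \<Rightarrow> complex mat"
    and f :: "complex \<Rightarrow> nat \<Rightarrow> complex"
  assumes "n \<ge> 2"
    and "\<forall>l\<in>{1..m}. a l \<in> ball 0 1"
    and "inj_on a {1..m}"
    and "\<forall>l\<in>{1..m}. A l \<in> spectral_ball n"
    and "holo_vec n f (ball 0 1)"
    and "\<forall>z\<in>ball 0 1. f z \<in> symm_polydisc n"
    and "\<forall>l\<in>{1..m}. f (a l) = piA n (A l)"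
  shows "((\<exists>F. holo_mat n F (ball 0 1) \<and> (\<forall>z\<in>ball 0 1. F z \<in> spectral_ball n)
              \<and> (\<forall>z\<in>ball 0 1. piA n (F z) = f z) \<and> (\<forall>l\<in>{1..m}. F (a l) = A l))
         \<longleftrightarrow> (\<forall>l\<in>{1..m}. \<exists>U Fl. open U \<and> a l \<in> U \<and> U \<subseteq> ball 0 1 \<and> holo_mat n Fl U
              \<and> (\<forall>z\<in>U. Fl z \<in> spectral_ball n) \<and> (\<forall>z\<in>U. piA n (Fl z) = f z) \<and> Fl (a l) = A l))
       \<and> ((\<forall>l\<in>{1..m}. \<exists>U Fl. open U \<and> a l \<in> U \<and> U \<subseteq> ball 0 1 \<and> holo_mat n Fl U
              \<and> (\<forall>z\<in>U. Fl z \<in> spectral_ball n) \<and> (\<forall>z\<in>U. piA n (Fl z) = f z) \<and> Fl (a l) = A l)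
         \<longleftrightarrow> (\<forall>l\<in>{1..m}. cond_iii n f (a l) (A l)))"
    (is "(?i \<longleftrightarrow> ?ii) \<and> (?ii \<longleftrightarrow> ?iii)")
proof -
  have 12: "?i \<Longrightarrow> ?ii"
  proof
    fix l assume ?i and l: "l \<in> {1..m}"
    then obtain F where "holo_mat n F (ball 0 1)" "\<forall>z\<in>ball 0 1. F z \<in> spectral_ball n"
      "\<forall>z\<in>ball 0 1. piA n (F z) = f z" "F (a l) = A l" by blast
    then show "\<exists>U Fl. open U \<and> a l \<in> U \<and> U \<subseteq> ball 0 1 \<and> holo_mat n Fl U
       \<and> (\<forall>z\<in>U. Fl z \<in> spectral_ball n) \<and> (\<forall>z\<in>U. piA n (Fl z) = f z) \<and> Fl (a l) = A l"
      using assms(2) l by (intro exI[of _ "ball 0 1"] exI[of _ F]) auto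
  qed
  have 23: "?ii \<Longrightarrow> ?iii"
  proof
    fix l assume ii: ?ii and l: "l \<in> {1..m}"
    from bspec[OF ii l] obtain U Fl where "open U" "a l \<in> U" "holo_mat n Fl U" "\<forall>z\<in>U. piA n (Fl z) = f z" "Fl (a l) = A l"
      by (elim exE conjE)
    then show "cond_iii n f (a l) (A l)" using local_lift_imp_cond_iii[of U "a l" n Fl f] by auto
  qed
  have 31: "?iii \<Longrightarrow> ?i"
  proof -
    assume iii: ?iii
    have n0: "n > 0" using assms(1) by simp
    have aD: "a l \<in> ball 0 1" if "l \<in> {1..m}" for l using assms(2) that by blast
    have Ac: "A l \<in> carrier_mat n n" if "l \<in> {1..m}" for l using assms(4) that by (auto simp: spectral_ball_def)
    have cond: "cond_iii n f (a l) (A l)" if "l \<in> {1..m}" for l using iii that by blast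
    obtain F where F: "holo_mat n F (ball 0 1)" "\<And>z. z \<in> ball 0 1 \<Longrightarrow> char_poly (F z) = chi_pt n (f z)"
      "\<And>l. l \<in> {1..m} \<Longrightarrow> F (a l) = A l"
      by (rule global_lift[OF n0 finite_atLeastAtMost assms(3) aD open_ball Ac assms(5) cond]) (assumption+, rule that)
    have Fc: "F z \<in> carrier_mat n n" if "z \<in> ball 0 1" for z using F(1) that by (simp add: holo_mat_def)
    have pi: "piA n (F z) = f z" if z: "z \<in> ball 0 1" for z
    proof (rule chi_pt_piA_inj[OF Fc[OF z] _ F(2)[OF z]])
      fix j assume "j \<notin> {1..n}"
      moreover have "f z \<in> symm_polydisc n" using assms(6) z by blast
      ultimately show "f z j = 0" unfolding symm_polydisc_def mem_Collect_eq by (elim exE conjE) auto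
    qed
    \<comment> \<open>\<open>global_lift\<close> controls only the characteristic polynomial; the
      spectral bound follows from \<open>f z\<close> lying in the symmetrized polydisc.\<close>
    have sb: "F z \<in> spectral_ball n" if z: "z \<in> ball 0 1" for z
    proof (rule spectral_ballI[OF Fc[OF z] n0])
      show "piA n (F z) \<in> symm_polydisc n" using pi[OF z] assms(6) z by simp
    qed
    show ?i by (intro exI[of _ F] conjI ballI F(1,3) pi sb)
  qed
  show ?thesis
    by (rule conjI; rule iffI) (erule 12, erule 31[OF 23], erule 23, erule 12[OF 31])
qed

end
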